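(* Let $C\subset\mathbb R^n$ be an $n$-dimensional compact convex set with $C=-C$, let $f:C\to[0,\infty)$ be concave, and let $\phi:[0,\infty)\to[0,\infty)$ be not identically zero, convex, such that $\phi(0)=0$. Then \[ \frac{1}{|C|}\int_C\phi(f(x))\,dx\leq\frac12\int_{-1}^1\phi\big(f(0)(1+t)\big)\,dt. \] If $\phi$ is strictly convex, equality holds if and only if, after applying a suitable rotation, there exist an $(n-1)$-dimensional compact convex set $C_0\subset\mathbb R^{n-1}$ with $C_0=-C_0$ and $x_0\in\mathbb R^n$ with $(x_0)_1>0$ such that \[ C=[-x_0,x_0]+(\{0\}\times C_0) \] and such that $f$ is an affine function with $f(-x_0+x)=0$ for every $x\in\{0\}\times\mathbb R^{n-1}$.
   Context: $|C|$ denotes the volume (Lebesgue measure) of $C$; $(x_0)_1$ is the first coordinate of $x_0$; $[-x_0,x_0]$ is the line segment with endpoints $-x_0,x_0$, and $+$ between sets is Minkowski addition. At points outside $C$, the affine function $f$ is understood through its affine extension to $\mathbb R^n$.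
   Formalization: The equality case is stated for f upper semicontinuous and not identically zero on C, and also for every f with "f = 0 on C" as an alternative and f affine only on the interior of C; for n = 1 the reflection x ↦ -x counts as a rotation. *)

theory Defs
  imports "HOL-Analysis.Analysis"
begin

definition strictly_convex_on :: "real set \<Rightarrow> (real \<Rightarrow> real) \<Rightarrow> bool" where
  "strictly_convex_on S \<phi> \<longleftrightarrow> convex S \<and>
     (\<forall>s\<in>S. \<forall>t\<in>S. \<forall>u. s \<noteq> t \<longrightarrow> 0 < u \<longrightarrow> u < 1 \<longrightarrow>
        \<phi> ((1 - u) * s + u * t) < (1 - u) * \<phi> s + u * \<phi> t)"

definition affine_function :: "(real ^ 'n \<Rightarrow> real) \<Rightarrow> bool" where
  "affine_function g \<longleftrightarrow> (\<exists>l c. linear l \<and> g = (\<lambda>x. l x + c))"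

definition upper_semicontinuous_fun_on :: "(real ^ 'n) set \<Rightarrow> (real ^ 'n \<Rightarrow> real) \<Rightarrow> bool" where
  "upper_semicontinuous_fun_on C f \<longleftrightarrow>
     (\<forall>x\<in>C. \<forall>e>0. eventually (\<lambda>y. f y < f x + e) (at x within C))"

(* The only proper rotation of the line is the identity, so in dimension one the reflection
   x \<mapsto> - x has to be admitted as well; otherwise the determinant is 1. *)
definition is_rotation :: "(real ^ 'n \<Rightarrow> real ^ 'n) \<Rightarrow> bool" where
  "is_rotation T \<longleftrightarrow> orthogonal_transformation T \<and> (CARD('n) \<ge> 2 \<longrightarrow> det (matrix T) = 1)"

(* The coordinate k plays the role of the first coordinate, and the hyperplane {x. x $ k = 0}
   that of {0} x R^(n-1); D stands for the set {0} x C_0. The affine function g is the affine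
   extension of f, which is required to agree with f on the set S: either C, or its interior, because
   a concave function on C may jump down at boundary points without changing any integral.
   Reflection in the origin is written with uminus ` _, since - C is the complement of C, and
   + is the Minkowski sum. *)
definition cylinder_with_affine_function ::
    "'n \<Rightarrow> (real ^ 'n) set \<Rightarrow> (real ^ 'n) set \<Rightarrow> (real ^ 'n \<Rightarrow> real) \<Rightarrow> bool" where
  "cylinder_with_affine_function k S C f \<longleftrightarrow>
     (\<exists>D x0 g.
        D \<subseteq> {x. x $ k = 0} \<and> compact D \<and> convex D \<and>
        aff_dim D = int CARD('n) - 1 \<and> uminus ` D = D \<and>
        x0 $ k > 0 \<and>
        C = closed_segment (- x0) x0 + D \<and>
        affine_function g \<and> (\<forall>x\<in>S. f x = g x) \<and>
        (\<forall>x. x $ k = 0 \<longrightarrow> g (- x0 + x) = 0))"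

end

theory Submission
  imports Defs
begin

text \<open>
  Since \<open>f\<close> is concave and \<open>0\<close> is interior, \<open>f\<close> lies below an affine function \<open>f 0 + a \<bullet> x\<close>, which is
  nonnegative on \<open>C\<close> because \<open>f\<close> is; and \<open>\<phi>\<close> is nondecreasing. After a rotation \<open>a\<close> points along the
  \<open>k\<close>-th axis, so only the distribution of one coordinate on \<open>C\<close> matters: the integral is at
  most \<open>\<integral> \<phi> (f 0 + |a| s) m(s) ds\<close>, where \<open>m(s)\<close> is the volume of the slice of \<open>C\<close> at height \<open>s\<close>. The body
  is symmetric, so \<open>m\<close> is even and \<open>\<phi>\<close> may be replaced by its average over \<open>\<plusminus>s\<close>, which increases with
  \<open>|s|\<close>. By the theorem of Prekopa (\<open>prekopa\<close>) \<open>m\<close> is log-concave, and an even log-concave function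
  decreases with \<open>|s|\<close>. A decreasing weight gives an increasing function a smaller average than the
  uniform weight does (\<open>unimodal_average_le\<close>), which is the inequality.

  If equality holds, \<open>\<phi>\<close> is strictly convex and \<open>f\<close> is not \<open>0\<close> on \<open>C\<close>, then \<open>f\<close> agrees with the affine function in the interior,
  the affine function vanishes at the bottom of \<open>C\<close>, and all slices have the same volume. It remains to
  see that such a body is a cylinder. For this the monotonicity of slice integrals is used for weights
  other than \<open>1\<close>. Let \<open>M\<close> be the centroid of the slice at height \<open>s\<close> and \<open>c\<close> a vector orthogonal to \<open>M\<close>.
  Squares of positive affine functions are log-concave, and this shows that the second moment
  of \<open>x \<bullet> c\<close> is at most as large on the slice at \<open>s\<close> as on the central slice. On the other hand every
  even convex function of \<open>x \<bullet> c\<close> has at least as large an integral on the slice at \<open>s\<close> as on the central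
  one. Applied to the Huber function, which is the square on the range of \<open>x \<bullet> c\<close> over the central slice and
  smaller than the square elsewhere, the two facts force \<open>x \<bullet> c\<close> to have no larger range on the slice at
  \<open>s\<close> (\<open>slice_bound_centred\<close>). So the slice at \<open>s\<close>, moved by \<open>- M\<close>, is contained in the central
  slice. Cutting with slabs gives the opposite inclusion (\<open>slice_bound_central\<close>), hence every slice is a
  translate of the central one (\<open>slice_eq_translate\<close>), and convexity makes the translation vector
  proportional to \<open>s\<close> (\<open>cylinder_decomposition\<close>).
\<close>

section \<open>Lebesgue measure on coordinate subspaces\<close>

text \<open>
  Lebesgue measure of the span of the coordinate vectors in \<open>A\<close>, as a measure on the whole space. It is
  built as an image of a product measure so that one coordinate can be split off at a time.
\<close>

definition coord_lborel :: "'a::euclidean_space set \<Rightarrow> 'a measure" where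
  "coord_lborel A = distr (\<Pi>\<^sub>M b\<in>A. lborel) borel (\<lambda>f. \<Sum>b\<in>A. f b *\<^sub>R b)"

lemma sets_coord_lborel [measurable_cong, simp]: "sets (coord_lborel A) = sets borel"
  by (simp add: coord_lborel_def)

lemma space_coord_lborel [simp]: "space (coord_lborel A) = UNIV"
  by (simp add: coord_lborel_def)

lemma coord_lborel_Basis: "coord_lborel Basis = lborel"
  by (simp add: coord_lborel_def lborel_eq[symmetric])

lemma measurable_coord_sum [measurable]:
  "(\<lambda>f. \<Sum>b\<in>A. f b *\<^sub>R b) \<in> (\<Pi>\<^sub>M b\<in>A. lborel) \<rightarrow>\<^sub>M (borel :: 'a::euclidean_space measure)"
  by measurable

lemma nn_integral_coord_lborel_empty:
  assumes "F \<in> borel_measurable borel"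
  shows "(\<integral>\<^sup>+y. F y \<partial>coord_lborel {}) = F 0"
  unfolding coord_lborel_def
  by (subst nn_integral_distr) (use assms in \<open>simp_all add: PiM_empty nn_integral_count_space_finite\<close>)

lemma nn_integral_coord_lborel_insert:
  fixes b :: "'a::euclidean_space"
  assumes "finite A" "b \<notin> A" and F [measurable]: "F \<in> borel_measurable borel"
  shows "(\<integral>\<^sup>+y. F y \<partial>coord_lborel (insert b A))
           = (\<integral>\<^sup>+t. (\<integral>\<^sup>+y. F (t *\<^sub>R b + y) \<partial>coord_lborel A) \<partial>lborel)"
proof -
  interpret product_sigma_finite "\<lambda>b::'a. lborel :: real measure" ..
  have *: "(\<Sum>c\<in>A. (if c = b then t else f c) *\<^sub>R c) = (\<Sum>c\<in>A. f c *\<^sub>R c)" for t :: real and f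
    using assms(2) by (intro sum.cong) auto
  have "(\<integral>\<^sup>+y. F y \<partial>coord_lborel (insert b A))
      = (\<integral>\<^sup>+f. F (\<Sum>c\<in>insert b A. f c *\<^sub>R c) \<partial>(\<Pi>\<^sub>M b\<in>insert b A. lborel))"
    unfolding coord_lborel_def by (subst nn_integral_distr) simp_all
  also have "\<dots> = (\<integral>\<^sup>+t. (\<integral>\<^sup>+f. F (\<Sum>c\<in>insert b A. (f(b := t)) c *\<^sub>R c) \<partial>(\<Pi>\<^sub>M b\<in>A. lborel)) \<partial>lborel)"
    by (rule product_nn_integral_insert_rev[OF assms(1,2)]) measurable
  also have "\<dots> = (\<integral>\<^sup>+t. (\<integral>\<^sup>+f. F (t *\<^sub>R b + (\<Sum>c\<in>A. f c *\<^sub>R c)) \<partial>(\<Pi>\<^sub>M b\<in>A. lborel)) \<partial>lborel)"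
    using assms by (simp add: *)
  also have "\<dots> = (\<integral>\<^sup>+t. (\<integral>\<^sup>+y. F (t *\<^sub>R b + y) \<partial>coord_lborel A) \<partial>lborel)"
    unfolding coord_lborel_def by (subst nn_integral_distr) simp_all
  finally show ?thesis .
qed

lemma coord_sum_inner:
  assumes "A \<subseteq> (Basis :: 'a::euclidean_space set)" "b \<in> Basis"
  shows "(\<Sum>c\<in>A. f c *\<^sub>R c) \<bullet> b = (if b \<in> A then f b else 0)"
proof -
  have fin: "finite A" using assms finite_Basis finite_subset by blast
  have "(\<Sum>c\<in>A. f c *\<^sub>R c) \<bullet> b = (\<Sum>c\<in>A. if c = b then f b else 0)"
    unfolding inner_sum_left using assms by (intro sum.cong) (auto simp: inner_Basis subset_iff)
  then show ?thesis using fin by simp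
qed

lemma emeasure_coord_lborel_bounded:
  assumes "A \<subseteq> (Basis :: 'a::euclidean_space set)" "bounded (S :: 'a set)"
  shows "emeasure (coord_lborel A) S < \<infinity>"
proof -
  interpret product_sigma_finite "\<lambda>b::'a. lborel :: real measure" ..
  let ?P = "\<Pi>\<^sub>M b\<in>A. lborel :: real measure"
  have fin: "finite A" using assms(1) finite_Basis finite_subset by blast
  obtain a where S: "S \<subseteq> cbox (- a) a"
    using bounded_subset_cbox_symmetric[OF assms(2)] by blast
  have "emeasure (coord_lborel A) S \<le> emeasure (coord_lborel A) (cbox (- a) a)"
    using S by (intro emeasure_mono) auto
  also have "\<dots> = emeasure ?P ((\<lambda>f. \<Sum>b\<in>A. f b *\<^sub>R b) -` cbox (- a) a \<inter> space ?P)"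
    unfolding coord_lborel_def by (subst emeasure_distr) simp_all
  also have "\<dots> \<le> emeasure ?P (\<Pi>\<^sub>E b\<in>A. {- (a \<bullet> b) .. a \<bullet> b})"
  proof (rule emeasure_mono)
    show "(\<lambda>f. \<Sum>b\<in>A. f b *\<^sub>R b) -` cbox (- a) a \<inter> space ?P \<subseteq> (\<Pi>\<^sub>E b\<in>A. {- (a \<bullet> b) .. a \<bullet> b})"
    proof
      fix f assume f: "f \<in> (\<lambda>f. \<Sum>b\<in>A. f b *\<^sub>R b) -` cbox (- a) a \<inter> space ?P"
      have "f b \<in> {- (a \<bullet> b) .. a \<bullet> b}" if "b \<in> A" for b
      proof -
        have b: "b \<in> Basis" using that assms by blast
        then have "- (a \<bullet> b) \<le> (\<Sum>b\<in>A. f b *\<^sub>R b) \<bullet> b" "(\<Sum>b\<in>A. f b *\<^sub>R b) \<bullet> b \<le> a \<bullet> b"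
          using f by (auto simp: mem_box)
        then show ?thesis using that by (simp add: coord_sum_inner[OF assms(1) b])
      qed
      with f show "f \<in> (\<Pi>\<^sub>E b\<in>A. {- (a \<bullet> b) .. a \<bullet> b})"
        by (simp add: space_PiM PiE_iff)
    qed
    show "(\<Pi>\<^sub>E b\<in>A. {- (a \<bullet> b) .. a \<bullet> b}) \<in> sets ?P"
      by (rule sets_PiM_I_finite) (use fin in auto)
  qed
  also have "\<dots> = (\<Prod>b\<in>A. emeasure lborel {- (a \<bullet> b) .. a \<bullet> b})"
    by (rule emeasure_PiM) (use fin in auto)
  also have "\<dots> = ennreal (\<Prod>b\<in>A. measure lborel {- (a \<bullet> b) .. a \<bullet> b})"
    by (subst prod_ennreal[symmetric]) (auto simp: emeasure_eq_ennreal_measure emeasure_lborel_Icc_eq)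
  also have "\<dots> < \<infinity>" by simp
  finally show ?thesis .
qed

lemma sigma_finite_coord_lborel:
  assumes "A \<subseteq> (Basis :: 'a::euclidean_space set)"
  shows "sigma_finite_measure (coord_lborel A)"
proof -
  let ?R = "range (\<lambda>n::nat. cball (0::'a) (real n))"
  have "(\<Union>n::nat. cball (0::'a) (real n)) = UNIV"
    using real_arch_simple by (auto simp: set_eq_iff)
  then have "countable ?R \<and> ?R \<subseteq> sets (coord_lborel A) \<and> \<Union> ?R = space (coord_lborel A)
      \<and> (\<forall>a\<in>?R. emeasure (coord_lborel A) a \<noteq> \<infinity>)"
    using emeasure_coord_lborel_bounded[OF assms] by (auto simp: less_top)
  then have "\<exists>R. countable R \<and> R \<subseteq> sets (coord_lborel A) \<and> \<Union> R = space (coord_lborel A)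
      \<and> (\<forall>a\<in>R. emeasure (coord_lborel A) a \<noteq> \<infinity>)"
    by (rule exI)
  then show ?thesis
    by (rule sigma_finite_measure.intro)
qed

lemma measurable_coord_section:
  assumes "A \<subseteq> (Basis :: 'a::euclidean_space set)"
   and [measurable]: "F \<in> borel_measurable (borel :: 'a measure)"
  shows "(\<lambda>x. \<integral>\<^sup>+y. F (x + y) \<partial>coord_lborel A) \<in> borel_measurable borel"
proof -
  interpret sigma_finite_measure "coord_lborel A" by (rule sigma_finite_coord_lborel[OF assms(1)])
  show ?thesis by measurable
qed

lemma coord_lborel_induct [consumes 1, case_names empty insert]:
  assumes "A \<subseteq> (Basis :: 'a::euclidean_space set)"
    and "P {}"
    and "\<And>b A. finite A \<Longrightarrow> b \<notin> A \<Longrightarrow> b \<in> Basis \<Longrightarrow> A \<subseteq> Basis \<Longrightarrow> P A \<Longrightarrow> P (insert b A)"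
  shows "P A"
proof -
  have "finite A" using assms(1) finite_Basis finite_subset by blast
  then show ?thesis using assms(1)
    by (induction A rule: finite_induct) (use assms(2,3) in auto)
qed

lemma nn_integral_coord_lborel_uminus:
  assumes "A \<subseteq> (Basis :: 'a::euclidean_space set)" and "F \<in> borel_measurable (borel :: 'a measure)"
  shows "(\<integral>\<^sup>+y. F (- y) \<partial>coord_lborel A) = (\<integral>\<^sup>+y. F y \<partial>coord_lborel A)"
  using assms
proof (induction A arbitrary: F rule: coord_lborel_induct)
  case (empty F)
  then show ?case by (simp add: nn_integral_coord_lborel_empty)
next
  case (insert b A F)
  note [measurable] = insert.prems
  define H where "H t = (\<integral>\<^sup>+y. F (t *\<^sub>R b + y) \<partial>coord_lborel A)" for t
  have [measurable]: "H \<in> borel_measurable borel"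
    unfolding H_def by (rule measurable_compose[OF _ measurable_coord_section[OF insert.hyps(4) insert.prems]]) simp
  have "(\<integral>\<^sup>+y. F (- y) \<partial>coord_lborel (insert b A))
       = (\<integral>\<^sup>+t. (\<integral>\<^sup>+y. F (- (t *\<^sub>R b + y)) \<partial>coord_lborel A) \<partial>lborel)"
    using insert by (intro nn_integral_coord_lborel_insert) auto
  also have "\<dots> = (\<integral>\<^sup>+t. H (- t) \<partial>lborel)"
  proof (rule nn_integral_cong)
    fix t :: real
    show "(\<integral>\<^sup>+y. F (- (t *\<^sub>R b + y)) \<partial>coord_lborel A) = H (- t)"
      using insert.IH[of "\<lambda>y. F (- (t *\<^sub>R b) + y)"] by (simp add: H_def algebra_simps)
  qed
  also have "\<dots> = (\<integral>\<^sup>+t. H t \<partial>lborel)"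
    by (subst (2) nn_integral_real_affine[where c = "-1" and t = 0]) auto
  finally show ?case
    using insert by (subst nn_integral_coord_lborel_insert) (auto simp: H_def)
qed

lemma nn_integral_coord_lborel_translate:
  assumes "A \<subseteq> (Basis :: 'a::euclidean_space set)" and "F \<in> borel_measurable (borel :: 'a measure)"
    and "\<And>b. b \<in> Basis - A \<Longrightarrow> z \<bullet> b = 0"
  shows "(\<integral>\<^sup>+y. F (z + y) \<partial>coord_lborel A) = (\<integral>\<^sup>+y. F y \<partial>coord_lborel A)"
  using assms
proof (induction A arbitrary: F z rule: coord_lborel_induct)
  case (empty F)
  then have "z = 0" by (simp add: euclidean_eq_iff[of z])
  then show ?case by simp
next
  case (insert b A F z)
  note [measurable] = insert.prems(1)
  define H where "H t = (\<integral>\<^sup>+y. F (t *\<^sub>R b + y) \<partial>coord_lborel A)" for t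
  have [measurable]: "H \<in> borel_measurable borel"
    unfolding H_def by (rule measurable_compose[OF _ measurable_coord_section[OF insert.hyps(4) insert.prems(1)]]) simp
  define z' where "z' = z - (z \<bullet> b) *\<^sub>R b"
  have z': "z' \<bullet> c = 0" if "c \<in> Basis - A" for c
    using that insert.prems(2)[of c] insert.hyps(3) by (cases "c = b") (auto simp: z'_def inner_simps inner_Basis)
  have "(\<integral>\<^sup>+y. F (z + y) \<partial>coord_lborel (insert b A))
       = (\<integral>\<^sup>+t. (\<integral>\<^sup>+y. F (z + (t *\<^sub>R b + y)) \<partial>coord_lborel A) \<partial>lborel)"
    using insert by (intro nn_integral_coord_lborel_insert) auto
  also have "\<dots> = (\<integral>\<^sup>+t. H (z \<bullet> b + 1 * t) \<partial>lborel)"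
  proof (rule nn_integral_cong)
    fix t :: real
    show "(\<integral>\<^sup>+y. F (z + (t *\<^sub>R b + y)) \<partial>coord_lborel A) = H (z \<bullet> b + 1 * t)"
      using insert.IH[of "\<lambda>y. F ((z \<bullet> b + t) *\<^sub>R b + y)" z'] z' by (simp add: H_def z'_def algebra_simps)
  qed
  also have "\<dots> = (\<integral>\<^sup>+t. H t \<partial>lborel)"
    by (subst (2) nn_integral_real_affine[where c = "1" and t = "z \<bullet> b"]) auto
  finally show ?case
    using insert by (subst nn_integral_coord_lborel_insert) (auto simp: H_def)
qed

text \<open>
  Slices of open sets have positive measure, by splitting off one coordinate after the other: a
  function that is positive on an open set of parameters has a positive integral.
\<close>

lemma nn_integral_coord_lborel_open_pos:
  assumes "A \<subseteq> (Basis :: 'a::euclidean_space set)" and "open U" "x \<in> U"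
  shows "(\<integral>\<^sup>+y. indicator U (x + y) \<partial>coord_lborel A) > 0"
  using assms
proof (induction A arbitrary: x rule: coord_lborel_induct)
  case (empty x)
  then have "(\<lambda>y. indicator U (x + y) :: ennreal) \<in> borel_measurable borel"
    by (intro measurable_compose[OF _ borel_measurable_indicator[of U borel]]) auto
  then show ?case using empty by (subst nn_integral_coord_lborel_empty) auto
next
  case (insert b A x)
  have [measurable]: "U \<in> sets borel" using insert.prems by auto
  define H where "H t = (\<integral>\<^sup>+y. indicator U (x + t *\<^sub>R b + y) \<partial>coord_lborel A :: ennreal)" for t
  have [measurable]: "H \<in> borel_measurable borel"
    unfolding H_def by (rule measurable_compose[OF _ measurable_coord_section[OF insert.hyps(4)]]) simp_all
  have op: "open ((\<lambda>t. x + t *\<^sub>R b) -` U)"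
    by (intro continuous_open_vimage insert.prems continuous_intros)
  have "\<not> (AE t in lborel. H t = 0)"
  proof
    assume ae: "AE t in lborel. H t = 0"
    have "AE t in lborel. t \<notin> (\<lambda>t. x + t *\<^sub>R b) -` U"
      using ae
    proof eventually_elim
      case (elim t)
      show ?case
      proof
        assume "t \<in> (\<lambda>t. x + t *\<^sub>R b) -` U"
        then have "H t > 0"
          unfolding H_def by (intro insert.IH insert.prems) simp
        with elim show False by simp
      qed
    qed
    then have "(\<lambda>t. x + t *\<^sub>R b) -` U \<in> null_sets lborel"
      using op by (subst AE_iff_null_sets) auto
    then have "negligible ((\<lambda>t. x + t *\<^sub>R b) -` U)"
      using negligible_iff_null_sets null_sets_completionI by blast
    then have "(\<lambda>t. x + t *\<^sub>R b) -` U = {}" using op open_not_negligible by blast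
    moreover have "0 \<in> (\<lambda>t. x + t *\<^sub>R b) -` U" using insert.prems by simp
    ultimately show False by blast
  qed
  then have "(\<integral>\<^sup>+t. H t \<partial>lborel) \<noteq> 0"
    by (subst nn_integral_0_iff_AE) auto
  moreover have "(\<integral>\<^sup>+y. indicator U (x + y) \<partial>coord_lborel (insert b A)) = (\<integral>\<^sup>+t. H t \<partial>lborel)"
    using insert.hyps by (subst nn_integral_coord_lborel_insert) (simp_all add: H_def[abs_def] add.assoc)
  ultimately show ?case by (simp add: zero_less_iff_neq_zero)
qed

section \<open>Log-concave functions and the inequality of Prekopa and Leindler\<close>

definition log_concave :: "('a::real_vector \<Rightarrow> real) \<Rightarrow> bool" where
  "log_concave F \<longleftrightarrow> (\<forall>x. 0 \<le> F x) \<and>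
     (\<forall>x y u v. 0 < u \<longrightarrow> 0 < v \<longrightarrow> u + v = 1 \<longrightarrow> F x powr u * F y powr v \<le> F (u *\<^sub>R x + v *\<^sub>R y))"

lemma log_concave_nonneg: "log_concave F \<Longrightarrow> 0 \<le> F x"
  by (simp add: log_concave_def)

lemma log_concaveD:
  "log_concave F \<Longrightarrow> 0 < u \<Longrightarrow> 0 < v \<Longrightarrow> u + v = 1 \<Longrightarrow> F x powr u * F y powr v \<le> F (u *\<^sub>R x + v *\<^sub>R y)"
  by (simp add: log_concave_def)

lemma weighted_arith_geo_mean:
  fixes a b :: real
  assumes "0 \<le> a" "0 \<le> b" "0 < u" "0 < v" "u + v = 1"
  shows "a powr u * b powr v \<le> u * a + v * b"
proof (cases "a = 0 \<or> b = 0")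
  case True
  then show ?thesis using assms by auto
next
  case False
  then show ?thesis using assms by (intro Youngs_inequality_0) auto
qed

lemma powr_weighted_less:
  fixes a b r :: real
  assumes "0 < r" "r < a" "r < b" "0 < u" "0 < v" "u + v = 1"
  shows "r < a powr u * b powr v"
proof -
  have "r = r powr u * r powr v" using assms by (simp flip: powr_add)
  also have "\<dots> < a powr u * b powr v"
    using assms by (intro mult_strict_mono powr_less_mono2) auto
  finally show ?thesis .
qed

lemma convex_superlevel_log_concave:
  assumes "log_concave F" "0 < r"
  shows "convex {x. r < F x}"
proof (rule convexI)
  fix x y u v assume *: "x \<in> {x. r < F x}" "y \<in> {x. r < F x}" "0 \<le> u" "0 \<le> v" "u + v = (1::real)"
  show "u *\<^sub>R x + v *\<^sub>R y \<in> {x. r < F x}"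
  proof (cases "u = 0 \<or> v = 0")
    case True
    then show ?thesis using * by auto
  next
    case False
    then have "r < F x powr u * F y powr v"
      using * assms by (intro powr_weighted_less) auto
    also have "\<dots> \<le> F (u *\<^sub>R x + v *\<^sub>R y)"
      using False * by (intro log_concaveD assms) auto
    finally show ?thesis by simp
  qed
qed

text \<open>
  The one-dimensional Brunn-Minkowski inequality. For intervals it is elementary: the combination
  contains the open interval between the combinations of the end points. Superlevel sets of
  log-concave functions on the line are intervals, so this case is enough here.
\<close>

lemma emeasure_interval_combination:
  fixes I J H :: "real set"
  assumes "convex I" "convex J" "bounded I" "bounded J" "I \<noteq> {}" "J \<noteq> {}"
    and "0 < u" "0 < v" and H: "H \<in> sets borel"
    and sub: "\<And>x y. x \<in> I \<Longrightarrow> y \<in> J \<Longrightarrow> u * x + v * y \<in> H"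
  shows "ennreal u * emeasure lborel I + ennreal v * emeasure lborel J \<le> emeasure lborel H"
proof -
  define W where "W = (\<lambda>x. u * x) ` I + (\<lambda>y. v * y) ` J"
  have bd: "bdd_below I" "bdd_above I" "bdd_below J" "bdd_above J"
    using assms bounded_imp_bdd_above bounded_imp_bdd_below by auto
  have "convex W" unfolding W_def using assms
    by (intro convex_set_plus convex_scaling[where 'a=real, simplified])
  then have int: "is_interval W" by (simp add: is_interval_convex_1)
  have WH: "W \<subseteq> H" using sub by (auto simp: W_def set_plus_def)
  have WI: "u * x + v * y \<in> W" if "x \<in> I" "y \<in> J" for x y
    using that by (auto simp: W_def set_plus_def)
  have I: "emeasure lborel I \<le> ennreal (Sup I - Inf I)"
  proof -
    have "I \<subseteq> {Inf I..Sup I}" using bd by (auto intro: cInf_lower cSup_upper)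
    then have "emeasure lborel I \<le> emeasure lborel {Inf I..Sup I}" by (intro emeasure_mono) auto
    also have "\<dots> = ennreal (Sup I - Inf I)"
      using bd assms by (intro emeasure_lborel_Icc cInf_le_cSup)
    finally show ?thesis .
  qed
  have J: "emeasure lborel J \<le> ennreal (Sup J - Inf J)"
  proof -
    have "J \<subseteq> {Inf J..Sup J}" using bd by (auto intro: cInf_lower cSup_upper)
    then have "emeasure lborel J \<le> emeasure lborel {Inf J..Sup J}" by (intro emeasure_mono) auto
    also have "\<dots> = ennreal (Sup J - Inf J)"
      using bd assms by (intro emeasure_lborel_Icc cInf_le_cSup)
    finally show ?thesis .
  qed
  have le: "Inf I \<le> Sup I" "Inf J \<le> Sup J" using bd assms by (auto intro: cInf_le_cSup)
  have "{u * Inf I + v * Inf J <..< u * Sup I + v * Sup J} \<subseteq> W"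
  proof
    fix z assume z: "z \<in> {u * Inf I + v * Inf J <..< u * Sup I + v * Sup J}"
    define d where "d = (z - (u * Inf I + v * Inf J)) / (u + v)"
    have "d > 0" using z assms by (simp add: d_def)
    then obtain i j where ij: "i \<in> I" "j \<in> J" "i < Inf I + d" "j < Inf J + d"
      using cInf_lessD[of I "Inf I + d"] cInf_lessD[of J "Inf J + d"] assms by force
    have "u * i + v * j \<le> u * (Inf I + d) + v * (Inf J + d)"
      using ij assms by (intro add_mono mult_left_mono) auto
    also have "\<dots> = u * Inf I + v * Inf J + (u + v) * d" by (simp add: algebra_simps)
    also have "\<dots> = z" using assms by (simp add: d_def)
    finally have 1: "u * i + v * j \<le> z" .
    define d' where "d' = (u * Sup I + v * Sup J - z) / (u + v)"
    have "d' > 0" using z assms by (simp add: d'_def)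
    then obtain i' j' where ij': "i' \<in> I" "j' \<in> J" "i' > Sup I - d'" "j' > Sup J - d'"
      using less_cSupD[of I "Sup I - d'"] less_cSupD[of J "Sup J - d'"] assms by force
    have "z = u * Sup I + v * Sup J - (u + v) * d'" using assms by (simp add: d'_def)
    also have "\<dots> = u * (Sup I - d') + v * (Sup J - d')" by (simp add: algebra_simps)
    also have "\<dots> \<le> u * i' + v * j'"
      using ij' assms by (intro add_mono mult_left_mono) auto
    finally have 2: "z \<le> u * i' + v * j'" .
    show "z \<in> W" using mem_is_interval_1_I[OF int WI[OF ij(1,2)] WI[OF ij'(1,2)] 1 2] .
  qed
  with WH have sub': "{u * Inf I + v * Inf J <..< u * Sup I + v * Sup J} \<subseteq> H" by blast
  have "ennreal u * emeasure lborel I + ennreal v * emeasure lborel J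
      \<le> ennreal u * ennreal (Sup I - Inf I) + ennreal v * ennreal (Sup J - Inf J)"
    by (intro add_mono mult_left_mono I J) auto
  also have "\<dots> = ennreal (u * (Sup I - Inf I) + v * (Sup J - Inf J))"
    using assms le by (simp add: ennreal_mult ennreal_plus)
  also have "\<dots> = emeasure lborel {u * Inf I + v * Inf J <..< u * Sup I + v * Sup J}"
    using le assms by (subst emeasure_lborel_Ioo) (auto simp: algebra_simps intro!: add_mono mult_left_mono)
  also have "\<dots> \<le> emeasure lborel H" using sub' H by (intro emeasure_mono) auto
  finally show ?thesis .
qed

lemma nn_integral_layer_cake_unit:
  fixes f :: "real \<Rightarrow> real"
  assumes [measurable]: "f \<in> borel_measurable borel"
    and "\<And>x. 0 \<le> f x" "\<And>x. f x \<le> 1"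
  shows "(\<integral>\<^sup>+x. f x \<partial>lborel) = (\<integral>\<^sup>+r. indicator {0<..<1} r * emeasure lborel {x. r < f x} \<partial>lborel)"
proof -
  have "(\<integral>\<^sup>+x. f x \<partial>lborel)
      = (\<integral>\<^sup>+x. (\<integral>\<^sup>+r. indicator {0<..<1} r * indicator {x. r < f x} x \<partial>lborel) \<partial>lborel)"
  proof (rule nn_integral_cong)
    fix x
    have "ennreal (f x) = emeasure lborel {0<..<f x}" using assms by simp
    also have "\<dots> = (\<integral>\<^sup>+r. indicator {0<..<f x} r \<partial>lborel)" by simp
    also have "\<dots> = (\<integral>\<^sup>+r. indicator {0<..<1} r * indicator {x. r < f x} x \<partial>lborel)"
      using assms(3)[of x] by (intro nn_integral_cong) (auto split: split_indicator)
    finally show "ennreal (f x) = (\<integral>\<^sup>+r. indicator {0<..<1} r * indicator {x. r < f x} x \<partial>lborel)" .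
  qed
  also have "\<dots> = (\<integral>\<^sup>+r. (\<integral>\<^sup>+x. indicator {0<..<1} r * indicator {x. r < f x} x \<partial>lborel) \<partial>lborel)"
    by (rule lborel_pair.Fubini') measurable
  also have "\<dots> = (\<integral>\<^sup>+r. indicator {0<..<1} r * emeasure lborel {x. r < f x} \<partial>lborel)"
    by (intro nn_integral_cong) (simp add: nn_integral_cmult)
  finally show ?thesis .
qed

text \<open>
  If \<open>f\<close> and \<open>g\<close> both have supremum \<open>1\<close>, their superlevel sets at a level \<open>r\<close> in \<open>(0, 1)\<close> are both nonempty and
  combine into the one of \<open>h\<close>; integrating the lengths over \<open>r\<close> gives an additive inequality, which is
  stronger than the multiplicative one.
\<close>

lemma prekopa_leindler_normalized:
  fixes f g h :: "real \<Rightarrow> real"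
  assumes [measurable]: "f \<in> borel_measurable borel" "g \<in> borel_measurable borel" "h \<in> borel_measurable borel"
    and f: "\<And>x. 0 \<le> f x" "\<And>x. f x \<le> 1" "\<And>r. r < 1 \<Longrightarrow> \<exists>x. r < f x"
      "\<And>r. 0 < r \<Longrightarrow> convex {x. r < f x}" "\<And>r. 0 < r \<Longrightarrow> bounded {x. r < f x}"
    and g: "\<And>x. 0 \<le> g x" "\<And>x. g x \<le> 1" "\<And>r. r < 1 \<Longrightarrow> \<exists>x. r < g x"
      "\<And>r. 0 < r \<Longrightarrow> convex {x. r < g x}" "\<And>r. 0 < r \<Longrightarrow> bounded {x. r < g x}"
    and h: "\<And>x. 0 \<le> h x"
    and uv: "0 < u" "0 < v" "u + v = 1"
    and fgh: "\<And>x y. f x powr u * g y powr v \<le> h (u * x + v * y)"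
  shows "ennreal u * (\<integral>\<^sup>+x. f x \<partial>lborel) + ennreal v * (\<integral>\<^sup>+x. g x \<partial>lborel) \<le> (\<integral>\<^sup>+x. h x \<partial>lborel)"
proof -
  have "ennreal u * (\<integral>\<^sup>+x. f x \<partial>lborel) + ennreal v * (\<integral>\<^sup>+x. g x \<partial>lborel)
      = (\<integral>\<^sup>+r. indicator {0<..<1} r *
            (ennreal u * emeasure lborel {x. r < f x} + ennreal v * emeasure lborel {x. r < g x}) \<partial>lborel)"
    by (simp add: nn_integral_layer_cake_unit f g nn_integral_cmult[symmetric] nn_integral_add[symmetric]
        distrib_left ac_simps)
  also have "\<dots> \<le> (\<integral>\<^sup>+r. indicator {0<..<1} r * emeasure lborel {x. r < min 1 (h x)} \<partial>lborel)"
  proof (rule nn_integral_mono)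
    fix r :: real
    show "indicator {0<..<1} r * (ennreal u * emeasure lborel {x. r < f x} + ennreal v * emeasure lborel {x. r < g x})
        \<le> indicator {0<..<1} r * emeasure lborel {x. r < min 1 (h x)}"
    proof (cases "0 < r \<and> r < 1")
      case True
      have "ennreal u * emeasure lborel {x. r < f x} + ennreal v * emeasure lborel {x. r < g x}
          \<le> emeasure lborel {x. r < min 1 (h x)}"
      proof (rule emeasure_interval_combination)
        show "{x. r < min 1 (h x)} \<in> sets borel" by measurable
        fix x y assume "x \<in> {x. r < f x}" "y \<in> {x. r < g x}"
        then have "r < f x powr u * g y powr v" using True uv by (intro powr_weighted_less) auto
        with fgh[of x y] True show "u * x + v * y \<in> {x. r < min 1 (h x)}" by simp
      qed (use True f g uv in auto)
      then show ?thesis by (simp add: mult_left_mono)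
    qed (auto simp: indicator_def)
  qed
  also have "\<dots> = (\<integral>\<^sup>+x. min 1 (h x) \<partial>lborel)"
    using h by (intro nn_integral_layer_cake_unit[symmetric]) auto
  also have "\<dots> \<le> (\<integral>\<^sup>+x. h x \<partial>lborel)"
    by (intro nn_integral_mono ennreal_leI) auto
  finally show ?thesis .
qed

text \<open>
  Dividing by the suprema reduces to the normalized case, and the weighted inequality between arithmetic
  and geometric mean turns the sum into a product.
\<close>

lemma prekopa_leindler_real:
  fixes f g h :: "real \<Rightarrow> real"
  assumes int: "integrable lborel f" "integrable lborel g" "integrable lborel h"
    and f: "\<And>x. 0 \<le> f x" "bdd_above (range f)"
      "\<And>r. 0 < r \<Longrightarrow> convex {x. r < f x}" "\<And>r. 0 < r \<Longrightarrow> bounded {x. r < f x}"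
    and g: "\<And>x. 0 \<le> g x" "bdd_above (range g)"
      "\<And>r. 0 < r \<Longrightarrow> convex {x. r < g x}" "\<And>r. 0 < r \<Longrightarrow> bounded {x. r < g x}"
    and h: "\<And>x. 0 \<le> h x"
    and uv: "0 < u" "0 < v" "u + v = 1"
    and fgh: "\<And>x y. f x powr u * g y powr v \<le> h (u * x + v * y)"
  shows "(\<integral>x. f x \<partial>lborel) powr u * (\<integral>x. g x \<partial>lborel) powr v \<le> (\<integral>x. h x \<partial>lborel)"
proof (cases "(\<forall>x. f x = 0) \<or> (\<forall>x. g x = 0)")
  case True
  then have "(\<integral>x. f x \<partial>lborel) = 0 \<or> (\<integral>x. g x \<partial>lborel) = 0" by auto
  then show ?thesis using h by (auto intro: Bochner_Integration.integral_nonneg)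
next
  case False
  note [measurable] = borel_measurable_integrable[OF int(1), simplified]
    borel_measurable_integrable[OF int(2), simplified] borel_measurable_integrable[OF int(3), simplified]
  define M where "M = (SUP x. f x)"
  define N where "N = (SUP x. g x)"
  have fM: "f x \<le> M" for x unfolding M_def using f by (intro cSUP_upper) auto
  have gN: "g x \<le> N" for x unfolding N_def using g by (intro cSUP_upper) auto
  obtain a b where "f a \<noteq> 0" "g b \<noteq> 0" using False by blast
  then have pos: "M > 0" "N > 0" using fM[of a] f(1)[of a] gN[of b] g(1)[of b] by linarith+
  have fs: "\<exists>x. r < f x" if "r < M" for r using that f by (auto simp: M_def less_cSUP_iff)
  have gs: "\<exists>x. r < g x" if "r < N" for r using that g by (auto simp: N_def less_cSUP_iff)
  define Q where "Q = M powr u * N powr v"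
  have Q: "Q > 0" using pos by (simp add: Q_def)
  have "ennreal u * (\<integral>\<^sup>+x. f x / M \<partial>lborel) + ennreal v * (\<integral>\<^sup>+x. g x / N \<partial>lborel) \<le> (\<integral>\<^sup>+x. h x / Q \<partial>lborel)"
  proof (rule prekopa_leindler_normalized)
    show "\<exists>x. r < f x / M" if "r < 1" for r using fs[of "r * M"] that pos by (simp add: field_simps)
    show "\<exists>x. r < g x / N" if "r < 1" for r using gs[of "r * N"] that pos by (simp add: field_simps)
    have eq: "{x. r < f x / M} = {x. r * M < f x}" "{x. r < g x / N} = {x. r * N < g x}" for r
      using pos by (auto simp: field_simps)
    show "convex {x. r < f x / M}" "bounded {x. r < f x / M}"
         "convex {x. r < g x / N}" "bounded {x. r < g x / N}" if "0 < r" for r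
      unfolding eq using that pos f g by auto
    fix x y
    have "(f x / M) powr u * (g y / N) powr v = (f x powr u * g y powr v) / Q"
      using f(1) g(1) pos by (simp add: powr_divide Q_def less_imp_le)
    also have "\<dots> \<le> h (u * x + v * y) / Q" using fgh Q by (simp add: divide_right_mono)
    finally show "(f x / M) powr u * (g y / N) powr v \<le> h (u * x + v * y) / Q" .
  qed (use f g h uv pos fM gN Q in auto)
  also have "(\<integral>\<^sup>+x. f x / M \<partial>lborel) = ennreal ((\<integral>x. f x \<partial>lborel) / M)"
    using int f pos by (subst nn_integral_eq_integral) auto
  also have "(\<integral>\<^sup>+x. g x / N \<partial>lborel) = ennreal ((\<integral>x. g x \<partial>lborel) / N)"
    using int g pos by (subst nn_integral_eq_integral) auto
  also have "(\<integral>\<^sup>+x. h x / Q \<partial>lborel) = ennreal ((\<integral>x. h x \<partial>lborel) / Q)"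
    using int h Q by (subst nn_integral_eq_integral) auto
  also have "ennreal u * ennreal ((\<integral>x. f x \<partial>lborel) / M) + ennreal v * ennreal ((\<integral>x. g x \<partial>lborel) / N)
     = ennreal (u * ((\<integral>x. f x \<partial>lborel) / M) + v * ((\<integral>x. g x \<partial>lborel) / N))"
    using uv f g pos
    by (subst ennreal_plus) (auto simp: ennreal_mult' Bochner_Integration.integral_nonneg simp del: times_divide_eq_right)
  finally have le: "u * ((\<integral>x. f x \<partial>lborel) / M) + v * ((\<integral>x. g x \<partial>lborel) / N) \<le> (\<integral>x. h x \<partial>lborel) / Q"
    using h Q by (subst (asm) ennreal_le_iff) (auto simp: Bochner_Integration.integral_nonneg)
  have "((\<integral>x. f x \<partial>lborel) / M) powr u * ((\<integral>x. g x \<partial>lborel) / N) powr v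
      \<le> u * ((\<integral>x. f x \<partial>lborel) / M) + v * ((\<integral>x. g x \<partial>lborel) / N)"
    using f g pos uv by (intro weighted_arith_geo_mean divide_nonneg_pos Bochner_Integration.integral_nonneg) auto
  also note le
  finally have "(((\<integral>x. f x \<partial>lborel) / M) powr u * ((\<integral>x. g x \<partial>lborel) / N) powr v) * Q \<le> (\<integral>x. h x \<partial>lborel)"
    using Q by (simp add: field_simps)
  moreover have "(((\<integral>x. f x \<partial>lborel) / M) powr u * ((\<integral>x. g x \<partial>lborel) / N) powr v) * Q
    = (\<integral>x. f x \<partial>lborel) powr u * (\<integral>x. g x \<partial>lborel) powr v"
    using f g pos by (simp add: powr_divide Q_def less_imp_le Bochner_Integration.integral_nonneg)
  ultimately show ?thesis by simp
qed

section \<open>Marginals of log-concave functions\<close>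

lemma distr_coord_lborel_uminus:
  assumes "A \<subseteq> (Basis :: 'a::euclidean_space set)"
  shows "distr (coord_lborel A) borel uminus = coord_lborel A"
proof (rule measure_eqI)
  fix X assume "X \<in> sets (distr (coord_lborel A) borel uminus)"
  then have [measurable]: "X \<in> sets borel" by simp
  have "emeasure (distr (coord_lborel A) borel uminus) X = (\<integral>\<^sup>+y. indicator X y \<partial>distr (coord_lborel A) borel uminus)"
    by (subst nn_integral_indicator) auto
  also have "\<dots> = (\<integral>\<^sup>+y. indicator X (- y) \<partial>coord_lborel A)"
    by (rule nn_integral_distr) auto
  also have "\<dots> = (\<integral>\<^sup>+y. indicator X y \<partial>coord_lborel A)"
    by (rule nn_integral_coord_lborel_uminus[OF assms]) auto
  finally show "emeasure (distr (coord_lborel A) borel uminus) X = emeasure (coord_lborel A) X"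
    by simp
qed simp

lemma distr_coord_lborel_translate:
  assumes "A \<subseteq> (Basis :: 'a::euclidean_space set)" and "\<And>b. b \<in> Basis - A \<Longrightarrow> z \<bullet> b = 0"
  shows "distr (coord_lborel A) borel (\<lambda>y. z + y) = coord_lborel A"
proof (rule measure_eqI)
  fix X assume "X \<in> sets (distr (coord_lborel A) borel (\<lambda>y. z + y))"
  then have [measurable]: "X \<in> sets borel" by simp
  have "emeasure (distr (coord_lborel A) borel (\<lambda>y. z + y)) X = (\<integral>\<^sup>+y. indicator X y \<partial>distr (coord_lborel A) borel (\<lambda>y. z + y))"
    by (subst nn_integral_indicator) auto
  also have "\<dots> = (\<integral>\<^sup>+y. indicator X (z + y) \<partial>coord_lborel A)"
    by (rule nn_integral_distr) auto
  also have "\<dots> = (\<integral>\<^sup>+y. indicator X y \<partial>coord_lborel A)"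
    by (rule nn_integral_coord_lborel_translate[OF assms(1) _ assms(2)]) auto
  finally show "emeasure (distr (coord_lborel A) borel (\<lambda>y. z + y)) X = emeasure (coord_lborel A) X"
    by simp
qed simp

text \<open>
  Measurable, bounded and of bounded support: this makes every section integrable with respect to every
  coordinate subspace, so that integrals can be split without further side conditions.
\<close>

definition tame :: "('a::euclidean_space \<Rightarrow> real) \<Rightarrow> bool" where
  "tame F \<longleftrightarrow> F \<in> borel_measurable borel \<and> bounded (range F) \<and> bounded {x. F x \<noteq> 0}"

lemma tame_integrable:
  fixes F :: "'a::euclidean_space \<Rightarrow> real"
  assumes A: "A \<subseteq> Basis" and "tame F"
  shows "integrable (coord_lborel A) (\<lambda>y. F (x + y))"
proof -
  have [measurable]: "F \<in> borel_measurable borel" using assms by (simp add: tame_def)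
  obtain c where c: "\<And>x. \<bar>F x\<bar> \<le> c" using assms(2) by (auto simp: tame_def bounded_iff)
  obtain R where R: "\<And>x. F x \<noteq> 0 \<Longrightarrow> norm x \<le> R" using assms(2) by (auto simp: tame_def bounded_iff)
  let ?S = "cball (- x) R"
  show ?thesis
  proof (rule Bochner_Integration.integrable_bound)
    show "integrable (coord_lborel A) (\<lambda>y. c * indicator ?S y :: real)"
      using emeasure_coord_lborel_bounded[OF A, of ?S]
      by (intro integrable_mult_right integrable_real_indicator) auto
    show "AE y in coord_lborel A. norm (F (x + y)) \<le> norm (c * indicator ?S y :: real)"
    proof (rule AE_I2)
      fix y
      show "norm (F (x + y)) \<le> norm (c * indicator ?S y :: real)"
      proof (cases "F (x + y) = 0")
        case False
        then have "y \<in> ?S" using R[of "x + y"] by (simp add: dist_norm norm_minus_commute algebra_simps)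
        then show ?thesis using c[of "x + y"] by auto
      qed auto
    qed
  qed measurable
qed

lemma measurable_section_integral:
  fixes F :: "'a::euclidean_space \<Rightarrow> real"
  assumes "A \<subseteq> Basis" and [measurable]: "F \<in> borel_measurable borel"
  shows "(\<lambda>x. \<integral>y. F (x + y) \<partial>coord_lborel A) \<in> borel_measurable borel"
proof -
  interpret sigma_finite_measure "coord_lborel A" by (rule sigma_finite_coord_lborel[OF assms(1)])
  show ?thesis by measurable
qed

lemma integral_coord_lborel_insert:
  fixes F :: "'a::euclidean_space \<Rightarrow> real"
  assumes A: "insert b A \<subseteq> Basis" "b \<notin> A" and F: "tame F" "\<And>x. 0 \<le> F x"
  shows "integrable lborel (\<lambda>t. \<integral>y. F (x + t *\<^sub>R b + y) \<partial>coord_lborel A)"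
    and "(\<integral>y. F (x + y) \<partial>coord_lborel (insert b A)) = (\<integral>t. (\<integral>y. F (x + t *\<^sub>R b + y) \<partial>coord_lborel A) \<partial>lborel)"
proof -
  have [measurable]: "F \<in> borel_measurable borel" using F by (simp add: tame_def)
  define H where "H t = (\<integral>y. F (x + t *\<^sub>R b + y) \<partial>coord_lborel A)" for t
  have A': "A \<subseteq> Basis" "finite A" using A by (auto intro: finite_subset[OF _ finite_Basis])
  have [measurable]: "H \<in> borel_measurable borel"
    unfolding H_def
    by (rule measurable_compose[OF _ measurable_section_integral[OF A'(1)]]) auto
  have H0: "0 \<le> H t" for t unfolding H_def using F by (intro Bochner_Integration.integral_nonneg) auto
  have "ennreal (\<integral>y. F (x + y) \<partial>coord_lborel (insert b A)) = (\<integral>\<^sup>+y. F (x + y) \<partial>coord_lborel (insert b A))"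
    using F A by (intro nn_integral_eq_integral[symmetric] tame_integrable) auto
  also have "\<dots> = (\<integral>\<^sup>+t. (\<integral>\<^sup>+y. F (x + (t *\<^sub>R b + y)) \<partial>coord_lborel A) \<partial>lborel)"
    using A A' by (intro nn_integral_coord_lborel_insert) auto
  also have "\<dots> = (\<integral>\<^sup>+t. ennreal (H t) \<partial>lborel)"
  proof (rule nn_integral_cong)
    fix t
    have "(\<integral>\<^sup>+y. F (x + t *\<^sub>R b + y) \<partial>coord_lborel A) = ennreal (H t)"
      unfolding H_def using F A' by (intro nn_integral_eq_integral tame_integrable) auto
    then show "(\<integral>\<^sup>+y. F (x + (t *\<^sub>R b + y)) \<partial>coord_lborel A) = ennreal (H t)"
      by (simp add: add.assoc)
  qed
  finally have eq: "ennreal (\<integral>y. F (x + y) \<partial>coord_lborel (insert b A)) = (\<integral>\<^sup>+t. ennreal (H t) \<partial>lborel)" .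
  show int: "integrable lborel (\<lambda>t. \<integral>y. F (x + t *\<^sub>R b + y) \<partial>coord_lborel A)"
    unfolding H_def[symmetric]
    by (rule integrableI_nonneg) (use H0 in \<open>auto simp: eq[symmetric]\<close>)
  show "(\<integral>y. F (x + y) \<partial>coord_lborel (insert b A)) = (\<integral>t. (\<integral>y. F (x + t *\<^sub>R b + y) \<partial>coord_lborel A) \<partial>lborel)"
    using eq nn_integral_eq_integral[of lborel H] int H0 F
    by (simp add: H_def[symmetric] Bochner_Integration.integral_nonneg)
qed

text \<open>
  The section through \<open>x\<close> misses the support of \<open>F\<close>, because moving along \<open>A\<close> does not change the coordinate \<open>b\<close>.
  In the induction for Prekopa's theorem this keeps the line integrals inside a bounded interval.
\<close>

lemma section_integral_eq_0:
  fixes F :: "'a::euclidean_space \<Rightarrow> real"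
  assumes A: "A \<subseteq> Basis" "b \<in> Basis" "b \<notin> A" and [measurable]: "F \<in> borel_measurable borel"
    and R: "\<And>x. F x \<noteq> 0 \<Longrightarrow> norm x \<le> R" and x: "\<bar>x \<bullet> b\<bar> > R"
  shows "(\<integral>y. F (x + y) \<partial>coord_lborel A) = 0"
proof -
  have "F (x + (\<Sum>c\<in>A. f c *\<^sub>R c)) = 0" for f
  proof (rule ccontr)
    assume "F (x + (\<Sum>c\<in>A. f c *\<^sub>R c)) \<noteq> 0"
    then have "\<bar>(x + (\<Sum>c\<in>A. f c *\<^sub>R c)) \<bullet> b\<bar> \<le> R"
      using R Basis_le_norm[OF A(2)] order_trans by blast
    then show False using x A by (simp add: inner_simps coord_sum_inner)
  qed
  then show ?thesis
    unfolding coord_lborel_def by (subst integral_distr) auto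
qed

text \<open>
  Prekopa's theorem. Integrating out one coordinate at a time needs only the inequality on the line,
  since the integrand stays log-concave from one step to the next. The uniform bound is part of the
  induction because the inequality on the line needs bounded functions.
\<close>

lemma prekopa:
  fixes F :: "'a::euclidean_space \<Rightarrow> real"
  assumes "A \<subseteq> Basis" and F: "tame F" "log_concave F"
  shows "log_concave (\<lambda>x. \<integral>y. F (x + y) \<partial>coord_lborel A)"
proof -
  have [measurable]: "F \<in> borel_measurable borel" using F by (simp add: tame_def)
  have F0: "0 \<le> F x" for x using F log_concave_nonneg by blast
  obtain c where c: "\<And>x. \<bar>F x\<bar> \<le> c" using F by (auto simp: tame_def bounded_iff)
  obtain R where R: "\<And>x. F x \<noteq> 0 \<Longrightarrow> norm x \<le> R" using F by (auto simp: tame_def bounded_iff)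
  have "log_concave (\<lambda>x. \<integral>y. F (x + y) \<partial>coord_lborel A) \<and> (\<exists>c. \<forall>x. (\<integral>y. F (x + y) \<partial>coord_lborel A) \<le> c)"
    using assms(1)
  proof (induction A rule: coord_lborel_induct)
    case empty
    have "(\<integral>y. F (x + y) \<partial>coord_lborel {}) = F x" for x
      unfolding coord_lborel_def
      by (subst integral_distr) (auto simp: PiM_empty lebesgue_integral_count_space_finite)
    moreover have "\<forall>x. F x \<le> c" using c abs_le_D1 by blast
    ultimately show ?case using F by auto
  next
    case (insert b A)
    define H where "H x = (\<integral>y. F (x + y) \<partial>coord_lborel A)" for x
    have H: "log_concave H" using insert.IH by (simp add: H_def[abs_def])
    obtain C where C: "\<And>x. H x \<le> C" using insert.IH by (auto simp: H_def)
    have H0: "0 \<le> H x" for x using H log_concave_nonneg by blast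
    have C0: "0 \<le> C" using C[of 0] H0[of 0] by linarith
    have zero: "H (x + t *\<^sub>R b) = 0" if "\<bar>x \<bullet> b + t\<bar> > R" for x t
      unfolding H_def using insert.hyps R that
      by (intro section_integral_eq_0[where b = b]) (auto simp: inner_simps)
    have int: "integrable lborel (\<lambda>t. H (x + t *\<^sub>R b))" for x
      unfolding H_def using insert.hyps F F0 by (intro integral_coord_lborel_insert) auto
    have eq: "(\<integral>y. F (x + y) \<partial>coord_lborel (insert b A)) = (\<integral>t. H (x + t *\<^sub>R b) \<partial>lborel)" for x
      unfolding H_def using insert.hyps F F0 by (intro integral_coord_lborel_insert) auto
    have cv: "convex {t. r < H (x + t *\<^sub>R b)}" if "0 < r" for x r
    proof -
      have "convex ((\<lambda>t. x + t *\<^sub>R b) -` {x. r < H x})"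
      proof (rule convexI)
        fix s t u v assume *: "s \<in> (\<lambda>t. x + t *\<^sub>R b) -` {x. r < H x}" "t \<in> (\<lambda>t. x + t *\<^sub>R b) -` {x. r < H x}"
          "0 \<le> u" "0 \<le> v" "u + v = (1::real)"
        have "x + (u * s + v * t) *\<^sub>R b = (u + v) *\<^sub>R x + (u * s + v * t) *\<^sub>R b"
          using * by simp
        also have "\<dots> = u *\<^sub>R (x + s *\<^sub>R b) + v *\<^sub>R (x + t *\<^sub>R b)"
          by (simp add: algebra_simps)
        finally show "u *\<^sub>R s + v *\<^sub>R t \<in> (\<lambda>t. x + t *\<^sub>R b) -` {x. r < H x}"
          using convexD[OF convex_superlevel_log_concave[OF H that], of "x + s *\<^sub>R b" "x + t *\<^sub>R b" u v] * by simp
      qed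
      then show ?thesis by (simp add: vimage_def)
    qed
    have bd: "bounded {t. r < H (x + t *\<^sub>R b)}" if "0 < r" for x r
    proof -
      have "{t. r < H (x + t *\<^sub>R b)} \<subseteq> {- (x \<bullet> b) - R .. R - x \<bullet> b}"
        using zero[of x] that by (force simp: abs_le_iff not_less[symmetric])
      then show ?thesis using bounded_closed_interval bounded_subset by blast
    qed
    have lc: "log_concave (\<lambda>x. \<integral>t. H (x + t *\<^sub>R b) \<partial>lborel)"
      unfolding log_concave_def
    proof (intro conjI allI impI)
      show "0 \<le> (\<integral>t. H (x + t *\<^sub>R b) \<partial>lborel)" for x
        using H0 by (intro Bochner_Integration.integral_nonneg) auto
      fix x y u v assume uv: "0 < u" "0 < v" "u + v = (1::real)"
      show "(\<integral>t. H (x + t *\<^sub>R b) \<partial>lborel) powr u * (\<integral>t. H (y + t *\<^sub>R b) \<partial>lborel) powr v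
              \<le> (\<integral>t. H (u *\<^sub>R x + v *\<^sub>R y + t *\<^sub>R b) \<partial>lborel)"
      proof (rule prekopa_leindler_real)
        fix s t
        have "H (x + s *\<^sub>R b) powr u * H (y + t *\<^sub>R b) powr v \<le> H (u *\<^sub>R (x + s *\<^sub>R b) + v *\<^sub>R (y + t *\<^sub>R b))"
          using uv by (intro log_concaveD H)
        also have "u *\<^sub>R (x + s *\<^sub>R b) + v *\<^sub>R (y + t *\<^sub>R b) = u *\<^sub>R x + v *\<^sub>R y + (u * s + v * t) *\<^sub>R b"
          by (simp add: algebra_simps)
        finally show "H (x + s *\<^sub>R b) powr u * H (y + t *\<^sub>R b) powr v
             \<le> H (u *\<^sub>R x + v *\<^sub>R y + (u * s + v * t) *\<^sub>R b)" .
      qed (use int H0 C cv bd uv in \<open>auto intro!: bdd_aboveI[of _ C]\<close>)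
    qed
    have "(\<integral>t. H (x + t *\<^sub>R b) \<partial>lborel) \<le> C * (2 * \<bar>R\<bar>)" for x
    proof -
      let ?J = "{- (x \<bullet> b) - \<bar>R\<bar> .. \<bar>R\<bar> - x \<bullet> b}"
      have "(\<integral>t. H (x + t *\<^sub>R b) \<partial>lborel) \<le> (\<integral>t. C * indicator ?J t \<partial>lborel)"
      proof (rule integral_mono[OF int])
        show "integrable lborel (\<lambda>t. C * indicator ?J t)" by (intro integrable_mult_right integrable_real_indicator) auto
        fix t
        show "H (x + t *\<^sub>R b) \<le> C * indicator ?J t"
          using zero[of x t] C[of "x + t *\<^sub>R b"] by (auto simp: indicator_def)
      qed
      also have "\<dots> = C * (2 * \<bar>R\<bar>)" by simp
      finally show ?thesis .
    qed
    then show ?case using lc by (auto simp: eq)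
  qed
  then show ?thesis by blast
qed

section \<open>Integrals over slices\<close>

lemma AE_coord_lborel_inner_eq_0:
  fixes b :: "'a::euclidean_space"
  assumes "A \<subseteq> Basis" "b \<in> Basis - A"
  shows "AE y in coord_lborel A. y \<bullet> b = 0"
  unfolding coord_lborel_def
  by (subst AE_distr_iff) (use assms in \<open>auto simp: coord_sum_inner\<close>)

definition slice_integral :: "'a::euclidean_space \<Rightarrow> ('a \<Rightarrow> real) \<Rightarrow> real \<Rightarrow> real" where
  "slice_integral e F s = (\<integral>y. F (s *\<^sub>R e + y) \<partial>coord_lborel (Basis - {e}))"

lemma slice_integrable:
  assumes "tame F"
  shows "integrable (coord_lborel (Basis - {e})) (\<lambda>y. F (s *\<^sub>R e + y))"
  using assms by (intro tame_integrable) auto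

lemma slice_integral_add:
  assumes "tame F" "tame G"
  shows "slice_integral e (\<lambda>x. F x + G x) s = slice_integral e F s + slice_integral e G s"
  unfolding slice_integral_def
  by (intro Bochner_Integration.integral_add slice_integrable assms)

lemma slice_integral_cmult: "slice_integral e (\<lambda>x. c * F x) s = c * slice_integral e F s"
  by (simp add: slice_integral_def)

lemma slice_integral_nonneg: "(\<And>x. 0 \<le> F x) \<Longrightarrow> 0 \<le> slice_integral e F s"
  by (simp add: slice_integral_def Bochner_Integration.integral_nonneg)

lemma slice_integral_uminus:
  assumes "tame F"
  shows "slice_integral e (\<lambda>x. F (- x)) s = slice_integral e F (- s)"
proof -
  have [measurable]: "F \<in> borel_measurable borel" using assms by (simp add: tame_def)
  have "slice_integral e F (- s) = (\<integral>y. F (- s *\<^sub>R e + y) \<partial>distr (coord_lborel (Basis - {e})) borel uminus)"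
    by (simp add: slice_integral_def distr_coord_lborel_uminus)
  also have "\<dots> = slice_integral e (\<lambda>x. F (- x)) s"
    unfolding slice_integral_def by (subst integral_distr) (simp_all add: algebra_simps)
  finally show ?thesis by simp
qed

lemma slice_integral_translate:
  assumes [measurable]: "F \<in> borel_measurable borel" and "e \<in> Basis" "z \<bullet> e = 0"
  shows "slice_integral e (\<lambda>x. F (x + z)) s = slice_integral e F s"
proof -
  have "slice_integral e F s = (\<integral>y. F (s *\<^sub>R e + y) \<partial>distr (coord_lborel (Basis - {e})) borel (\<lambda>y. z + y))"
    using assms by (subst distr_coord_lborel_translate) (auto simp: slice_integral_def)
  also have "\<dots> = slice_integral e (\<lambda>x. F (x + z)) s"
    unfolding slice_integral_def by (subst integral_distr) (simp_all add: algebra_simps)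
  finally show ?thesis by simp
qed

lemma AE_slice:
  assumes "e \<in> Basis"
  shows "AE y in coord_lborel (Basis - {e}). (s *\<^sub>R e + y) \<bullet> e = s"
  using AE_coord_lborel_inner_eq_0[of "Basis - {e}" e] assms
  by (auto simp: inner_simps elim!: eventually_mono)

lemma slice_integral_mono:
  assumes "tame F" "tame G" "e \<in> Basis" and le: "\<And>x. x \<bullet> e = s \<Longrightarrow> F x \<le> G x"
  shows "slice_integral e F s \<le> slice_integral e G s"
  unfolding slice_integral_def
  by (intro integral_mono_AE slice_integrable assms)
     (use AE_slice[OF assms(3), of s] le in \<open>auto elim!: eventually_mono\<close>)

lemma slice_integral_cong:
  assumes "tame F" "tame G" "e \<in> Basis" and "\<And>x. x \<bullet> e = s \<Longrightarrow> F x = G x"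
  shows "slice_integral e F s = slice_integral e G s"
  using assms by (intro antisym slice_integral_mono) auto

text \<open>
  Fubini's theorem for the decomposition into parallel hyperplanes.
\<close>

lemma integral_slices:
  assumes "e \<in> Basis" "tame F" "\<And>x. 0 \<le> F x"
  shows "integrable lborel (slice_integral e F)"
    and "(\<integral>x. F x \<partial>lborel) = (\<integral>s. slice_integral e F s \<partial>lborel)"
  using integral_coord_lborel_insert[of e "Basis - {e}" F 0] assms
  by (simp_all add: insert_absorb coord_lborel_Basis slice_integral_def[abs_def])

text \<open>
  The open set \<open>U\<close> meets the slice in a set of positive measure.
\<close>

lemma slice_integral_pos:
  assumes e: "e \<in> Basis" and F: "tame F" "\<And>x. 0 \<le> F x"
    and U: "open U" "z \<in> U" "z \<bullet> e = s" and \<epsilon>: "0 < \<epsilon>" "\<And>x. x \<in> U \<Longrightarrow> \<epsilon> \<le> F x"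
  shows "slice_integral e F s > 0"
proof -
  let ?M = "coord_lborel (Basis - {e})"
  have [measurable]: "U \<in> sets borel" using U by simp
  define y0 where "y0 = z - s *\<^sub>R e"
  have y0: "y0 \<bullet> e = 0" using U e by (simp add: y0_def inner_simps)
  have "0 < (\<integral>\<^sup>+y. indicator U (z + y) \<partial>?M)"
    using U by (intro nn_integral_coord_lborel_open_pos) auto
  also have "\<dots> = (\<integral>\<^sup>+y. indicator U (s *\<^sub>R e + (y0 + y)) \<partial>?M)"
    by (simp add: y0_def algebra_simps)
  also have "\<dots> = (\<integral>\<^sup>+y. indicator U (s *\<^sub>R e + y) \<partial>?M)"
    using y0 by (intro nn_integral_coord_lborel_translate[where F = "\<lambda>y. indicator U (s *\<^sub>R e + y)"]) auto
  finally have pos: "0 < (\<integral>\<^sup>+y. indicator U (s *\<^sub>R e + y) \<partial>?M)" .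
  have "ennreal \<epsilon> * (\<integral>\<^sup>+y. indicator U (s *\<^sub>R e + y) \<partial>?M) = (\<integral>\<^sup>+y. ennreal \<epsilon> * indicator U (s *\<^sub>R e + y) \<partial>?M)"
    by (intro nn_integral_cmult[symmetric]) auto
  also have "\<dots> \<le> (\<integral>\<^sup>+y. ennreal (F (s *\<^sub>R e + y)) \<partial>?M)"
    using \<epsilon> by (intro nn_integral_mono) (auto simp: indicator_def intro: ennreal_leI)
  also have "\<dots> = ennreal (slice_integral e F s)"
    unfolding slice_integral_def using F by (intro nn_integral_eq_integral slice_integrable) auto
  finally have "ennreal \<epsilon> * (\<integral>\<^sup>+y. indicator U (s *\<^sub>R e + y) \<partial>?M) \<le> ennreal (slice_integral e F s)" .
  moreover have "0 < ennreal \<epsilon> * (\<integral>\<^sup>+y. indicator U (s *\<^sub>R e + y) \<partial>?M)"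
    using pos \<epsilon> by (simp add: ennreal_zero_less_mult_iff)
  ultimately show ?thesis by (metis ennreal_less_zero_iff less_le_trans)
qed

lemma log_concave_slice_integral:
  assumes "tame F" "log_concave F"
  shows "log_concave (slice_integral e F)"
proof -
  have L: "log_concave (\<lambda>x. \<integral>y. F (x + y) \<partial>coord_lborel (Basis - {e}))"
    using assms by (intro prekopa) auto
  show ?thesis
    unfolding log_concave_def
  proof (intro conjI allI impI)
    show "0 \<le> slice_integral e F s" for s
      using assms by (intro slice_integral_nonneg log_concave_nonneg)
    fix s t u v :: real assume "0 < u" "0 < v" "u + v = 1"
    then show "slice_integral e F s powr u * slice_integral e F t powr v \<le> slice_integral e F (u *\<^sub>R s + v *\<^sub>R t)"
      using log_concaveD[OF L, of u v "s *\<^sub>R e" "t *\<^sub>R e"]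
      by (simp add: slice_integral_def algebra_simps)
  qed
qed

text \<open>
  The point \<open>s\<close> is a convex combination of \<open>t\<close> and \<open>- t\<close>, where \<open>m\<close> takes the same value.
\<close>

lemma log_concave_even_decreasing:
  fixes m :: "real \<Rightarrow> real"
  assumes m: "log_concave m" "\<And>s. m (- s) = m s" and st: "\<bar>s\<bar> \<le> \<bar>t\<bar>"
  shows "m t \<le> m s"
proof (cases "\<bar>s\<bar> = \<bar>t\<bar>")
  case True
  then show ?thesis using m(2)[of s] by (auto simp: abs_eq_iff)
next
  case False
  then have t: "t \<noteq> 0" using st by auto
  define u where "u = (1 + s / t) / 2"
  have "\<bar>s / t\<bar> < 1" using False st t by (simp add: abs_divide)
  then have "- 1 < s / t" "s / t < 1" unfolding abs_less_iff by linarith+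
  then have u: "0 < u" "0 < 1 - u" by (simp_all add: u_def)
  have "m t = m t powr u * m t powr (1 - u)"
    using log_concave_nonneg[OF m(1), of t] by (cases "m t = 0") (auto simp flip: powr_add)
  also have "\<dots> = m t powr u * m (- t) powr (1 - u)" by (simp add: m(2))
  also have "\<dots> \<le> m (u *\<^sub>R t + (1 - u) *\<^sub>R (- t))"
    using u by (intro log_concaveD m(1)) auto
  also have "u *\<^sub>R t + (1 - u) *\<^sub>R (- t) = s" using t by (simp add: u_def field_simps)
  finally show ?thesis .
qed

lemma slice_integral_unimodal:
  assumes "tame F" "log_concave F" "\<And>x. F (- x) = F x" "\<bar>s\<bar> \<le> \<bar>t\<bar>"
  shows "slice_integral e F t \<le> slice_integral e F s"
proof (rule log_concave_even_decreasing[OF log_concave_slice_integral[OF assms(1,2)] _ assms(4)])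
  show "slice_integral e F (- s) = slice_integral e F s" for s
    using slice_integral_uminus[OF assms(1), of e s] assms(3) by simp
qed

lemma tame_indicator_mult:
  assumes "compact K" "continuous_on UNIV q"
  shows "tame (\<lambda>x. indicator K x * q x)"
proof -
  have "continuous_on K q" using assms continuous_on_subset by blast
  then have "bounded (q ` K)" using assms compact_continuous_image compact_imp_bounded by blast
  then have "bounded (insert 0 (q ` K))" by simp
  moreover have "range (\<lambda>x. indicator K x * q x) \<subseteq> insert 0 (q ` K)"
    by (auto simp: indicator_def)
  ultimately have 1: "bounded (range (\<lambda>x. indicator K x * q x))" using bounded_subset by blast
  have "{x. indicator K x * q x \<noteq> 0} \<subseteq> K" by (auto simp: indicator_def)
  then have 2: "bounded {x. indicator K x * q x \<noteq> 0}"
    using assms compact_imp_bounded bounded_subset by blast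
  have [measurable]: "q \<in> borel_measurable borel" using assms by (intro borel_measurable_continuous_onI)
  have [measurable]: "K \<in> sets borel" using assms by (simp add: borel_compact)
  show ?thesis unfolding tame_def using 1 2 by auto
qed

text \<open>
  A nonnegative concave function on a convex set is log-concave by the inequality between arithmetic
  and geometric mean. All weights used on slices are of this form or squares of it.
\<close>

lemma log_concave_indicator_mult:
  assumes "concave_on K q" "\<And>x. x \<in> K \<Longrightarrow> 0 \<le> q x"
  shows "log_concave (\<lambda>x. indicator K x * q x)"
  unfolding log_concave_def
proof (intro conjI allI impI)
  show "0 \<le> indicator K x * q x" for x using assms by (auto simp: indicator_def)
  fix x y u v assume uv: "0 < u" "0 < v" "u + v = (1::real)"
  show "(indicator K x * q x) powr u * (indicator K y * q y) powr v
      \<le> indicator K (u *\<^sub>R x + v *\<^sub>R y) * q (u *\<^sub>R x + v *\<^sub>R y)"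
  proof (cases "x \<in> K \<and> y \<in> K")
    case True
    have *: "convex K" "u * q x + v * q y \<le> q (u *\<^sub>R x + v *\<^sub>R y)"
      using assms(1) True uv by (auto simp: concave_on_iff)
    have "u *\<^sub>R x + v *\<^sub>R y \<in> K" using * True uv by (intro convexD) auto
    moreover have "q x powr u * q y powr v \<le> u * q x + v * q y"
      using True assms uv by (intro weighted_arith_geo_mean) auto
    ultimately show ?thesis using True *(2) by simp
  next
    case False
    then have "(indicator K x * q x) powr u * (indicator K y * q y) powr v = 0" by (auto simp: indicator_def)
    then show ?thesis using assms by (auto simp: indicator_def)
  qed
qed

lemma log_concave_square:
  assumes "log_concave F"
  shows "log_concave (\<lambda>x. (F x)\<^sup>2)"
  unfolding log_concave_def
proof (intro conjI allI impI)
  fix x y u v assume uv: "0 < u" "0 < v" "u + v = (1::real)"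
  have "(F x)\<^sup>2 powr u * (F y)\<^sup>2 powr v = (F x powr u * F y powr v)\<^sup>2"
    by (simp add: power2_eq_square powr_mult log_concave_nonneg[OF assms] algebra_simps)
  also have "\<dots> \<le> (F (u *\<^sub>R x + v *\<^sub>R y))\<^sup>2"
    using log_concaveD[OF assms uv] by (intro power_mono) auto
  finally show "(F x)\<^sup>2 powr u * (F y)\<^sup>2 powr v \<le> (F (u *\<^sub>R x + v *\<^sub>R y))\<^sup>2" .
qed auto

section \<open>Symmetric convex bodies and their slices\<close>

locale symmetric_body =
  fixes K :: "'a::euclidean_space set" and e :: 'a
  assumes compact: "compact K" and convex: "convex K" and sym: "\<And>x. x \<in> K \<Longrightarrow> - x \<in> K"
    and int: "interior K \<noteq> {}" and e: "e \<in> Basis"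
begin

definition weight :: "('a \<Rightarrow> real) \<Rightarrow> real \<Rightarrow> real" where
  "weight q s = slice_integral e (\<lambda>x. indicator K x * q x) s"

definition height :: real where
  "height = (SUP x\<in>K. x \<bullet> e)"

lemma e_inner [simp]: "e \<bullet> e = 1"
  using e by simp

lemma sym_iff: "- x \<in> K \<longleftrightarrow> x \<in> K"
  using sym[of x] sym[of "- x"] by auto

lemma zero_interior: "0 \<in> interior K"
proof -
  obtain x where x: "x \<in> interior K" using int by blast
  then have "- x \<in> K" using interior_subset sym by blast
  then have "- x - (1/2) *\<^sub>R (- x - x) \<in> interior K"
    using x by (intro mem_interior_convex_shrink convex) auto
  moreover have "- x - (1/2) *\<^sub>R (- x - x) = - x + (1/2) *\<^sub>R (x + x)"
    by (metis add_uminus_conv_diff diff_minus_eq_add minus_add_distrib scaleR_minus_right)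
  ultimately show ?thesis by (simp flip: scaleR_2)
qed

lemma zero_mem: "0 \<in> K"
  using zero_interior interior_subset by blast

lemma ex_top: "\<exists>p\<in>K. p \<bullet> e = height"
  and inner_le_height: "x \<in> K \<Longrightarrow> x \<bullet> e \<le> height"
proof -
  have "continuous_on K (\<lambda>x. x \<bullet> e)" by (intro continuous_intros)
  then obtain p where p: "p \<in> K" "\<And>x. x \<in> K \<Longrightarrow> x \<bullet> e \<le> p \<bullet> e"
    using continuous_attains_sup[OF compact] zero_mem by blast
  then have "height = p \<bullet> e"
    unfolding height_def by (intro cSup_eq_maximum) auto
  then show "\<exists>p\<in>K. p \<bullet> e = height" "x \<in> K \<Longrightarrow> x \<bullet> e \<le> height" using p by auto
qed

lemma abs_inner_le_height: "x \<in> K \<Longrightarrow> \<bar>x \<bullet> e\<bar> \<le> height"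
  using inner_le_height[of x] inner_le_height[of "- x"] sym[of x] by auto

lemma height_pos: "0 < height"
proof -
  obtain r where r: "0 < r" "ball 0 r \<subseteq> K"
    using zero_interior mem_interior by blast
  then have "(r / 2) *\<^sub>R e \<in> K" using e by (intro subsetD[OF r(2)]) (simp add: norm_Basis)
  then show ?thesis using inner_le_height[of "(r / 2) *\<^sub>R e"] r by simp
qed

lemma ex_interior_slice:
  assumes "\<bar>s\<bar> < height"
  shows "\<exists>p\<in>interior K. p \<bullet> e = s"
proof -
  obtain p where p: "p \<in> K" "p \<bullet> e = height" using ex_top by blast
  define q where "q = (if 0 \<le> s then p else - p)"
  have q: "q \<in> K" "q \<bullet> e = (if 0 \<le> s then height else - height)" using p sym by (auto simp: q_def)
  let ?r = "1 - \<bar>s\<bar> / height"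
  have r: "0 < ?r" "?r \<le> 1" using assms height_pos by auto
  have "q - ?r *\<^sub>R (q - 0) \<in> interior K"
    using zero_interior q r by (intro mem_interior_convex_shrink convex) auto
  moreover have "(q - ?r *\<^sub>R (q - 0)) \<bullet> e = s"
    using height_pos q by (auto simp: inner_simps field_simps)
  ultimately show ?thesis by blast
qed

text \<open>
  Move \<open>x\<close> slightly towards an interior point at the same height.
\<close>

lemma ex_interior_slice_near:
  assumes "x \<in> K" "\<bar>x \<bullet> e\<bar> < height" "open U" "x \<in> U"
  shows "\<exists>z\<in>interior K \<inter> U. z \<bullet> e = x \<bullet> e"
proof -
  obtain p where p: "p \<in> interior K" "p \<bullet> e = x \<bullet> e" using ex_interior_slice[OF assms(2)] by blast
  obtain d where d: "0 < d" "ball x d \<subseteq> U" using assms open_contains_ball by blast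
  define r where "r = min 1 (d / (2 * (norm (x - p) + 1)))"
  have np: "0 < norm (x - p) + 1" by (simp add: add_nonneg_pos)
  have r: "0 < r" "r \<le> 1" using d np by (auto simp: r_def)
  have "r * norm (x - p) \<le> d / (2 * (norm (x - p) + 1)) * norm (x - p)"
    by (intro mult_right_mono) (auto simp: r_def)
  also have "\<dots> = d * (norm (x - p) / (2 * (norm (x - p) + 1)))" by simp
  also have "\<dots> < d * 1"
    using d np by (intro mult_strict_left_mono) (auto simp: divide_less_eq intro!: add_nonneg_pos)
  also have "\<dots> = d" by simp
  finally have "x - r *\<^sub>R (x - p) \<in> ball x d" using r by (simp add: dist_norm)
  then have "x - r *\<^sub>R (x - p) \<in> interior K \<inter> U"
    using d p r assms mem_interior_convex_shrink[OF convex p(1) assms(1) r] by blast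
  moreover have "(x - r *\<^sub>R (x - p)) \<bullet> e = x \<bullet> e" using p by (simp add: inner_simps)
  ultimately show ?thesis by blast
qed

lemma tame_weight: "continuous_on UNIV q \<Longrightarrow> tame (\<lambda>x. indicator K x * q x)"
  by (intro tame_indicator_mult compact)

lemma weight_add:
  assumes "continuous_on UNIV q" "continuous_on UNIV r"
  shows "weight (\<lambda>x. q x + r x) s = weight q s + weight r s"
  unfolding weight_def
  using slice_integral_add[OF tame_weight[OF assms(1)] tame_weight[OF assms(2)], of e s]
  by (simp add: distrib_left)

lemma weight_cmult: "weight (\<lambda>x. c * q x) s = c * weight q s"
  unfolding weight_def using slice_integral_cmult[of e c "\<lambda>x. indicator K x * q x" s] by (simp add: ac_simps)

lemma weight_const: "weight (\<lambda>x. c) s = c * weight (\<lambda>x. 1) s"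
  using weight_cmult[of c "\<lambda>x. 1" s] by simp

lemma weight_diff:
  assumes "continuous_on UNIV q" "continuous_on UNIV r"
  shows "weight (\<lambda>x. q x - r x) s = weight q s - weight r s"
  using weight_add[of q "\<lambda>x. (-1) * r x" s] weight_cmult[of "-1" r s] assms
  by (simp add: continuous_intros)

lemma weight_uminus:
  assumes "continuous_on UNIV q"
  shows "weight (\<lambda>x. q (- x)) s = weight q (- s)"
  unfolding weight_def
  using slice_integral_uminus[OF tame_weight[OF assms], of e s]
  by (simp add: indicator_def sym_iff)

lemma weight_mono:
  assumes "continuous_on UNIV q" "continuous_on UNIV r"
    and "\<And>x. x \<in> K \<Longrightarrow> x \<bullet> e = s \<Longrightarrow> q x \<le> r x"
  shows "weight q s \<le> weight r s"
  unfolding weight_def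
  by (intro slice_integral_mono tame_weight e assms) (use assms(3) in \<open>auto simp: indicator_def\<close>)

lemma weight_cong:
  assumes "continuous_on UNIV q" "continuous_on UNIV r"
    and "\<And>x. x \<in> K \<Longrightarrow> x \<bullet> e = s \<Longrightarrow> q x = r x"
  shows "weight q s = weight r s"
  using assms by (intro antisym weight_mono) auto

text \<open>
  This passes from statements about almost all points of a slice to all of them. The slices at \<open>\<plusminus>height\<close>
  are excluded: they may have measure zero.
\<close>

lemma weight_eq_0_imp:
  assumes q: "continuous_on UNIV q" "\<And>x. 0 \<le> q x" "weight q s = 0"
    and x: "x \<in> K" "x \<bullet> e = s" "\<bar>s\<bar> < height"
  shows "q x = 0"
proof (rule ccontr)
  assume "q x \<noteq> 0"
  then have qx: "q x > 0" using q(2)[of x] by simp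
  define U where "U = {z. q x / 2 < q z}"
  have U: "open U" "x \<in> U"
    using q(1) qx by (auto simp: U_def intro!: open_Collect_less continuous_intros)
  then obtain z where z: "z \<in> interior K \<inter> U" "z \<bullet> e = s"
    using ex_interior_slice_near[of x U] x by auto
  have "slice_integral e (\<lambda>x. indicator K x * q x) s > 0"
  proof (rule slice_integral_pos[OF e tame_weight[OF q(1)]])
    show "open (interior K \<inter> U)" using U by auto
    show "0 < q x / 2" using qx by simp
    show "q x / 2 \<le> indicator K y * q y" if "y \<in> interior K \<inter> U" for y
      using that interior_subset[of K] by (auto simp: U_def)
  qed (use z q in auto)
  then show False using q by (simp add: weight_def)
qed

lemma weight_one_pos:
  assumes "\<bar>s\<bar> < height"
  shows "weight (\<lambda>x. 1) s > 0"
proof -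
  obtain p where "p \<in> interior K" "p \<bullet> e = s" using ex_interior_slice[OF assms] by blast
  then have "weight (\<lambda>x. 1) s \<noteq> 0"
    using weight_eq_0_imp[of "\<lambda>x. 1" s p] interior_subset[of K] assms by auto
  moreover have "0 \<le> weight (\<lambda>x. 1) s" unfolding weight_def by (intro slice_integral_nonneg) auto
  ultimately show ?thesis by simp
qed

lemma weight_eq_0_outside:
  assumes "continuous_on UNIV q" "\<bar>s\<bar> > height"
  shows "weight q s = 0"
proof -
  have "weight q s = weight (\<lambda>x. 0) s"
    using assms abs_inner_le_height by (intro weight_cong) (auto simp: not_less[symmetric])
  then show ?thesis by (simp add: weight_def slice_integral_def)
qed

text \<open>
  Prekopa's theorem gives log-concavity in \<open>s\<close>, and symmetry turns this into monotonicity.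
\<close>

lemma weight_unimodal:
  assumes "continuous_on UNIV q" "concave_on K q" "\<And>x. x \<in> K \<Longrightarrow> 0 \<le> q x" "\<And>x. q (- x) = q x"
    and "\<bar>s\<bar> \<le> \<bar>t\<bar>"
  shows "weight q t \<le> weight q s"
  unfolding weight_def
  using assms by (intro slice_integral_unimodal tame_weight log_concave_indicator_mult)
    (auto simp: indicator_def sym_iff)

end

section \<open>Bodies whose slices have constant volume\<close>

lemma tame_diff:
  assumes "tame F" "tame G"
  shows "tame (\<lambda>x. F x - G x)"
proof -
  have [measurable]: "F \<in> borel_measurable borel" "G \<in> borel_measurable borel"
    using assms by (auto simp: tame_def)
  have "bounded (range (\<lambda>x. F x - G x))"
    using assms by (intro bounded_minus_comp) (auto simp: tame_def)
  moreover have "bounded {x. F x - G x \<noteq> 0}"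
  proof (rule bounded_subset)
    show "bounded ({x. F x \<noteq> 0} \<union> {x. G x \<noteq> 0})" using assms by (simp add: tame_def)
  qed auto
  ultimately show ?thesis by (simp add: tame_def)
qed

text \<open>
  The square, continued linearly beyond \<open>\<plusminus>w\<close>. What matters is that it is even and convex, that it equals the square
  on \<open>[-w, w]\<close>, and that it is strictly smaller elsewhere.
\<close>

definition huber :: "real \<Rightarrow> real \<Rightarrow> real" where
  "huber w r = r\<^sup>2 - (max 0 (\<bar>r\<bar> - w))\<^sup>2"

lemma continuous_on_huber [continuous_intros]:
  "continuous_on S f \<Longrightarrow> continuous_on S (\<lambda>x. huber w (f x))"
  unfolding huber_def by (intro continuous_intros)

lemma huber_eq_square: "\<bar>r\<bar> \<le> w \<Longrightarrow> huber w r = r\<^sup>2"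
  by (simp add: huber_def)

lemma huber_le_square: "huber w r \<le> r\<^sup>2"
  by (simp add: huber_def)

lemma huber_minus [simp]: "huber w (- r) = huber w r"
  by (simp add: huber_def)

lemma huber_tangent_le:
  assumes "\<bar>z\<bar> \<le> w"
  shows "2 * z * r - z\<^sup>2 \<le> huber w r"
proof -
  have "(max 0 (\<bar>r\<bar> - w))\<^sup>2 \<le> \<bar>r - z\<bar>\<^sup>2"
    using assms by (intro power_mono) auto
  then show ?thesis by (simp add: huber_def power2_eq_square algebra_simps)
qed

text \<open>
  Together with \<open>huber_tangent_le\<close> this writes the Huber function as a maximum of affine functions,
  namely the tangents of the square at points of \<open>[-w, w]\<close>; hence it is convex.
\<close>

lemma huber_eq_tangent:
  assumes "0 \<le> w"
  shows "\<exists>z. \<bar>z\<bar> \<le> w \<and> huber w r = 2 * z * r - z\<^sup>2"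
proof -
  consider "\<bar>r\<bar> \<le> w" | "r > w" | "r < - w" by linarith
  then show ?thesis
  proof cases
    case 1
    then show ?thesis by (intro exI[of _ r]) (simp add: huber_def power2_eq_square)
  next
    case 2
    then show ?thesis using assms by (intro exI[of _ w]) (simp add: huber_def power2_eq_square algebra_simps)
  next
    case 3
    then show ?thesis using assms by (intro exI[of _ "- w"]) (simp add: huber_def power2_eq_square algebra_simps)
  qed
qed

lemma huber_convex:
  assumes "0 \<le> w" "0 \<le> u" "0 \<le> v" "u + v = 1"
  shows "huber w (u * r + v * t) \<le> u * huber w r + v * huber w t"
proof -
  obtain z where z: "\<bar>z\<bar> \<le> w" "huber w (u * r + v * t) = 2 * z * (u * r + v * t) - z\<^sup>2"
    using huber_eq_tangent[OF assms(1)] by blast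
  have "2 * z * (u * r + v * t) - z\<^sup>2 = 2 * z * (u * r + v * t) - (u + v) * z\<^sup>2"
    using assms by simp
  also have "\<dots> = u * (2 * z * r - z\<^sup>2) + v * (2 * z * t - z\<^sup>2)"
    by (simp add: algebra_simps)
  also have "\<dots> \<le> u * huber w r + v * huber w t"
    using assms z by (intro add_mono mult_left_mono huber_tangent_le) auto
  finally show ?thesis using z by simp
qed

lemma linear_real_functional_inner:
  fixes L :: "'a::euclidean_space \<Rightarrow> real"
  assumes "linear L"
  obtains M where "\<And>c. L c = M \<bullet> c"
proof
  show "L c = adjoint L 1 \<bullet> c" for c
    using adjoint_works[OF assms, of c 1] by (simp add: inner_commute)
qed

context symmetric_body
begin

text \<open>
  Cutting the body with the slab \<open>\<bar>x \<bullet> c\<bar> \<le> w\<close> leaves the slice at \<open>s\<close> untouched. The slices of the smaller body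
  are again unimodal, so its central slice has volume at least \<open>V\<close>, which leaves no room for a
  point of the central slice outside the slab.
\<close>

lemma slice_bound_central:
  assumes V: "\<And>s. \<bar>s\<bar> < height \<Longrightarrow> weight (\<lambda>x. 1) s = V" and s: "\<bar>s\<bar> < height"
    and w: "\<And>x. x \<in> K \<Longrightarrow> x \<bullet> e = s \<Longrightarrow> \<bar>x \<bullet> c\<bar> \<le> w"
    and x: "x \<in> K" "x \<bullet> e = 0"
  shows "\<bar>x \<bullet> c\<bar> \<le> w"
proof (rule ccontr)
  assume contra: "\<not> \<bar>x \<bullet> c\<bar> \<le> w"
  define S where "S = {x. \<bar>x \<bullet> c\<bar> \<le> w}"
  have S_eq: "S = {x. x \<bullet> c \<le> w} \<inter> {x. - w \<le> x \<bullet> c}" by (auto simp: S_def abs_le_iff)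
  have clS: "closed S" unfolding S_def by (intro closed_Collect_le continuous_intros)
  have cvS: "convex S" unfolding S_eq
    using convex_halfspace_le[of c w] convex_halfspace_ge[of "-w" c] by (intro convex_Int) (simp_all add: inner_commute)
  define F where "F = (\<lambda>x. indicator (K \<inter> S) x * 1 :: real)"
  define G where "G = (\<lambda>x. indicator K x * 1 :: real)"
  have tF: "tame F" unfolding F_def using compact clS by (intro tame_indicator_mult) auto
  have tG: "tame G" unfolding G_def by (intro tame_weight) auto
  have lF: "log_concave F" unfolding F_def
    using convex_Int[OF convex cvS] by (intro log_concave_indicator_mult) (simp_all add: concave_on_const)
  have "slice_integral e F s \<le> slice_integral e F 0"
    by (rule slice_integral_unimodal[OF tF lF]) (auto simp: F_def indicator_def sym_iff S_def)
  moreover have "slice_integral e F s = slice_integral e G s"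
    by (rule slice_integral_cong[OF tF tG e]) (use w in \<open>auto simp: F_def G_def indicator_def S_def\<close>)
  moreover have "slice_integral e G s = V" "slice_integral e G 0 = V"
    using V[OF s] V[of 0] height_pos by (auto simp: weight_def G_def)
  moreover have "slice_integral e (\<lambda>x. G x - F x) 0 > 0"
  proof -
    have op: "open (- S)" using clS by auto
    then obtain z where z: "z \<in> interior K \<inter> - S" "z \<bullet> e = 0"
      using ex_interior_slice_near[of x "- S"] x contra height_pos by (auto simp: S_def)
    show ?thesis
    proof (rule slice_integral_pos[OF e tame_diff[OF tG tF]])
      show "open (interior K \<inter> - S)" using op by auto
      show "1 \<le> G x - F x" if "x \<in> interior K \<inter> - S" for x
        using that interior_subset[of K] by (auto simp: F_def G_def)
    qed (use z in \<open>auto simp: F_def G_def indicator_def\<close>)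
  qed
  moreover have "slice_integral e (\<lambda>x. G x - F x) 0 = slice_integral e G 0 - slice_integral e F 0"
    unfolding slice_integral_def
    by (intro Bochner_Integration.integral_diff slice_integrable tF tG)
  ultimately show False by linarith
qed

text \<open>
  Let \<open>X = x \<bullet> c\<close>. The weight \<open>(k + X)\<^sup>2\<close> is log-concave on \<open>K\<close> for large \<open>k\<close>. As \<open>X\<close> has mean zero on the slice at \<open>s\<close>, this
  weight has the same integral \<open>k\<^sup>2 V + \<integral> X\<^sup>2\<close> at \<open>s\<close> and at \<open>- s\<close>, and log-concavity bounds it by the value at \<open>0\<close>:
  the second moment at \<open>s\<close> is at most the central one. Conversely \<open>k\<^sup>2 - huber w X\<close> is an even concave
  weight, so the integral of \<open>huber w X\<close> is smallest at \<open>0\<close>, where it is the second moment. Hence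
  \<open>X\<^sup>2\<close> and \<open>huber w X\<close> agree on the slice at \<open>s\<close>.
\<close>

lemma slice_bound_centred:
  assumes V: "\<And>s. \<bar>s\<bar> < height \<Longrightarrow> weight (\<lambda>x. 1) s = V" and s: "\<bar>s\<bar> < height"
    and mean: "weight (\<lambda>x. x \<bullet> c) s = 0"
    and w: "\<And>x. x \<in> K \<Longrightarrow> x \<bullet> e = 0 \<Longrightarrow> x \<bullet> c \<le> w"
    and x: "x \<in> K" "x \<bullet> e = s"
  shows "\<bar>x \<bullet> c\<bar> \<le> w"
proof -
  have w0: "0 \<le> w" using w[of 0] zero_mem by simp
  have Vs: "weight (\<lambda>x. 1) s = V" "weight (\<lambda>x. 1) (- s) = V" "weight (\<lambda>x. 1) 0 = V"
    using V[of s] V[of "- s"] V[of 0] s height_pos by auto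
  have "bounded ((\<lambda>x. x \<bullet> c) ` K)"
    by (intro compact_imp_bounded compact_continuous_image continuous_intros compact)
  then obtain k where k: "0 < k" "\<And>x. x \<in> K \<Longrightarrow> \<bar>x \<bullet> c\<bar> \<le> k"
    by (auto simp: bounded_pos)
  have cont: "continuous_on UNIV (\<lambda>x. x \<bullet> c)" "continuous_on UNIV (\<lambda>x. (x \<bullet> c)\<^sup>2)"
    "continuous_on UNIV (\<lambda>x. huber w (x \<bullet> c))"
    by (intro continuous_intros)+
  have sq: "weight (\<lambda>x. (k + a * (x \<bullet> c))\<^sup>2) r
      = k\<^sup>2 * weight (\<lambda>x. 1) r + 2 * k * a * weight (\<lambda>x. x \<bullet> c) r + a\<^sup>2 * weight (\<lambda>x. (x \<bullet> c)\<^sup>2) r" for a r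
  proof -
    have "weight (\<lambda>x. (k + a * (x \<bullet> c))\<^sup>2) r = weight (\<lambda>x. (k\<^sup>2 + (2 * k * a) * (x \<bullet> c)) + a\<^sup>2 * (x \<bullet> c)\<^sup>2) r"
      by (simp add: power2_eq_square algebra_simps)
    also have "\<dots> = weight (\<lambda>x. k\<^sup>2) r + weight (\<lambda>x. (2 * k * a) * (x \<bullet> c)) r + weight (\<lambda>x. a\<^sup>2 * (x \<bullet> c)\<^sup>2) r"
      by (subst weight_add, (intro continuous_intros)+)+ simp
    also have "\<dots> = k\<^sup>2 * weight (\<lambda>x. 1) r + 2 * k * a * weight (\<lambda>x. x \<bullet> c) r + a\<^sup>2 * weight (\<lambda>x. (x \<bullet> c)\<^sup>2) r"
      by (simp only: weight_cmult weight_const[of "k\<^sup>2"])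
    finally show ?thesis .
  qed
  have odd: "weight (\<lambda>x. x \<bullet> c) (- r) = - weight (\<lambda>x. x \<bullet> c) r" for r
    using weight_uminus[OF cont(1), of r] weight_cmult[of "-1" "\<lambda>x. x \<bullet> c" r] by simp
  have even: "weight (\<lambda>x. (x \<bullet> c)\<^sup>2) (- r) = weight (\<lambda>x. (x \<bullet> c)\<^sup>2) r" for r
    using weight_uminus[OF cont(2), of r] by simp
  define F where "F = (\<lambda>x. indicator K x * (k + x \<bullet> c))"
  have F2: "(\<lambda>x. (F x)\<^sup>2) = (\<lambda>x. indicator K x * (k + 1 * (x \<bullet> c))\<^sup>2)"
    by (auto simp: F_def indicator_def fun_eq_iff)
  have "concave_on K (\<lambda>x. k + x \<bullet> c)"
    unfolding concave_on_iff
  proof (intro conjI ballI allI impI convex)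
    fix x y and u v :: real assume "u + v = 1"
    then have "u * k + v * k = k" by (simp flip: distrib_right)
    then show "u * (k + x \<bullet> c) + v * (k + y \<bullet> c) \<le> k + (u *\<^sub>R x + v *\<^sub>R y) \<bullet> c"
      by (simp add: inner_simps algebra_simps)
  qed
  moreover have "0 \<le> k + x \<bullet> c" if "x \<in> K" for x using k(2)[OF that] by linarith
  ultimately have "log_concave F" unfolding F_def by (rule log_concave_indicator_mult)
  then have "log_concave (\<lambda>x. (F x)\<^sup>2)" by (rule log_concave_square)
  then have "log_concave (\<lambda>x. indicator K x * (k + 1 * (x \<bullet> c))\<^sup>2)" by (simp add: F2)
  then have L: "log_concave (weight (\<lambda>x. (k + 1 * (x \<bullet> c))\<^sup>2))"
    unfolding weight_def[abs_def] by (intro log_concave_slice_integral tame_weight continuous_intros)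
  define X where "X = k\<^sup>2 * V + weight (\<lambda>x. (x \<bullet> c)\<^sup>2) s"
  have "weight (\<lambda>x. (k + 1 * (x \<bullet> c))\<^sup>2) s = X" "weight (\<lambda>x. (k + 1 * (x \<bullet> c))\<^sup>2) (- s) = X"
    by (simp_all only: sq odd even Vs mean X_def) simp_all
  then have X: "X powr (1/2) * X powr (1/2) \<le> weight (\<lambda>x. (k + 1 * (x \<bullet> c))\<^sup>2) 0" "0 \<le> X"
    using log_concaveD[OF L, of "1/2" "1/2" s "- s"] log_concave_nonneg[OF L, of s] by simp_all
  have "X powr (1/2) * X powr (1/2) = X" using X(2) by (cases "X = 0") (auto simp flip: powr_add)
  with X have "X \<le> k\<^sup>2 * V + weight (\<lambda>x. (x \<bullet> c)\<^sup>2) 0"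
    using odd[of 0] by (simp only: sq Vs) simp
  then have var: "weight (\<lambda>x. (x \<bullet> c)\<^sup>2) s \<le> weight (\<lambda>x. (x \<bullet> c)\<^sup>2) 0"
    by (simp add: X_def)
  have "weight (\<lambda>x. k\<^sup>2 - huber w (x \<bullet> c)) s \<le> weight (\<lambda>x. k\<^sup>2 - huber w (x \<bullet> c)) 0"
  proof (rule weight_unimodal)
    show "concave_on K (\<lambda>x. k\<^sup>2 - huber w (x \<bullet> c))"
      unfolding concave_on_iff
    proof (intro conjI ballI allI impI convex)
      fix x y and u v :: real assume uv: "0 \<le> u" "0 \<le> v" "u + v = 1"
      then have "u * k\<^sup>2 + v * k\<^sup>2 = k\<^sup>2" by (simp flip: distrib_right)
      then show "u * (k\<^sup>2 - huber w (x \<bullet> c)) + v * (k\<^sup>2 - huber w (y \<bullet> c))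
          \<le> k\<^sup>2 - huber w ((u *\<^sub>R x + v *\<^sub>R y) \<bullet> c)"
        using huber_convex[OF w0 uv, of "x \<bullet> c" "y \<bullet> c"] by (simp add: inner_simps algebra_simps)
    qed
    show "0 \<le> k\<^sup>2 - huber w (x \<bullet> c)" if "x \<in> K" for x
      using huber_le_square[of w "x \<bullet> c"] k(2)[OF that] k(1) abs_le_square_iff[of "x \<bullet> c" k] by simp
  qed (auto intro!: continuous_intros)
  also have "weight (\<lambda>x. k\<^sup>2 - huber w (x \<bullet> c)) s = k\<^sup>2 * V - weight (\<lambda>x. huber w (x \<bullet> c)) s"
    by (subst weight_diff, (intro continuous_intros)+) (simp only: weight_const[of "k\<^sup>2"] Vs)
  also have "weight (\<lambda>x. k\<^sup>2 - huber w (x \<bullet> c)) 0 = k\<^sup>2 * V - weight (\<lambda>x. huber w (x \<bullet> c)) 0"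
    by (subst weight_diff, (intro continuous_intros)+) (simp only: weight_const[of "k\<^sup>2"] Vs)
  also have "weight (\<lambda>x. huber w (x \<bullet> c)) 0 = weight (\<lambda>x. (x \<bullet> c)\<^sup>2) 0"
  proof (rule weight_cong[OF cont(3,2)])
    fix x assume "x \<in> K" "x \<bullet> e = 0"
    then show "huber w (x \<bullet> c) = (x \<bullet> c)\<^sup>2"
      using w[of x] w[of "- x"] sym by (intro huber_eq_square) auto
  qed
  finally have "weight (\<lambda>x. (x \<bullet> c)\<^sup>2 - huber w (x \<bullet> c)) s \<le> 0"
    using var by (simp add: weight_diff cont)
  moreover have "0 \<le> weight (\<lambda>x. (x \<bullet> c)\<^sup>2 - huber w (x \<bullet> c)) s"
    unfolding weight_def by (intro slice_integral_nonneg) (simp add: huber_le_square)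
  ultimately have zero: "weight (\<lambda>x. (x \<bullet> c)\<^sup>2 - huber w (x \<bullet> c)) s = 0" by (rule antisym)
  have "(x \<bullet> c)\<^sup>2 - huber w (x \<bullet> c) = 0"
    by (rule weight_eq_0_imp[OF continuous_on_diff[OF cont(2,3)] _ zero x s]) (simp add: huber_le_square)
  then show ?thesis by (simp add: huber_def max_def split: if_splits)
qed

text \<open>
  The translation vector is the centroid \<open>M\<close>. Both inclusions are shown by separating a point from a
  slice. A separating functional may be changed by a multiple of \<open>e\<close>, which is constant on slices, so as
  to vanish at \<open>M\<close>; that makes the two preceding bounds applicable.
\<close>

lemma slice_eq_translate:
  assumes V: "\<And>s. \<bar>s\<bar> < height \<Longrightarrow> weight (\<lambda>x. 1) s = V" and s: "0 < s" "s < height"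
  shows "\<exists>M. M \<bullet> e = s \<and> (\<forall>z. z \<bullet> e = 0 \<longrightarrow> (M + z \<in> K \<longleftrightarrow> z \<in> K))"
proof -
  have s': "\<bar>s\<bar> < height" using s by simp
  have Vs: "weight (\<lambda>x. 1) s = V" "V > 0" using V[OF s'] weight_one_pos[OF s'] by auto
  have cont: "continuous_on UNIV (\<lambda>x. x \<bullet> c)" for c :: 'a by (intro continuous_intros)
  have "linear (\<lambda>c. weight (\<lambda>x. x \<bullet> c) s / V)"
    by (rule linearI) (simp_all add: inner_simps weight_add cont weight_cmult add_divide_distrib)
  then obtain M where M: "weight (\<lambda>x. x \<bullet> c) s / V = M \<bullet> c" for c
    using linear_real_functional_inner by blast
  have "weight (\<lambda>x. x \<bullet> e) s = weight (\<lambda>x. s) s"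
    by (intro weight_cong cont) auto
  then have Me: "M \<bullet> e = s" using M[of e] Vs weight_const[of s s] by simp
  have centred: "\<bar>x \<bullet> c\<bar> \<le> w"
    if "M \<bullet> c = 0" "\<And>x. x \<in> K \<Longrightarrow> x \<bullet> e = 0 \<Longrightarrow> x \<bullet> c \<le> w" "x \<in> K" "x \<bullet> e = s" for c w x
    using slice_bound_centred[OF V s', of c w x] that M[of c] Vs by auto
  have slice: "closed (K \<inter> {x. x \<bullet> e = r})" "convex (K \<inter> {x. x \<bullet> e = r})" for r
    using compact convex compact_imp_closed convex_hyperplane[of e r] closed_hyperplane[of e r]
    by (auto simp: inner_commute[of _ e] intro!: closed_Int convex_Int)
  have 1: "z \<in> K" if z: "z \<bullet> e = 0" "M + z \<in> K" for z
  proof (rule ccontr)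
    assume "z \<notin> K"
    then obtain a b where ab: "a \<bullet> z < b" "\<And>x. x \<in> K \<Longrightarrow> x \<bullet> e = 0 \<Longrightarrow> b < a \<bullet> x"
      using separating_hyperplane_closed_point[OF slice(2,1), of z 0] by auto
    define c where "c = (M \<bullet> a / s) *\<^sub>R e - a"
    have c: "x \<bullet> c = (x \<bullet> e) * (M \<bullet> a / s) - x \<bullet> a" for x by (simp add: c_def inner_simps)
    have Mc: "M \<bullet> c = 0" using s by (simp add: c Me)
    have "\<bar>(M + z) \<bullet> c\<bar> \<le> - b"
    proof (rule centred[OF Mc])
      show "x \<bullet> c \<le> - b" if "x \<in> K" "x \<bullet> e = 0" for x
        using ab(2)[OF that] that by (simp only: c) (simp add: inner_commute)
    qed (use z Me in \<open>auto simp: inner_simps\<close>)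
    moreover have "(M + z) \<bullet> c = - (a \<bullet> z)" unfolding inner_add_left Mc using z by (simp only: c) (simp add: inner_commute)
    ultimately show False using ab(1) by linarith
  qed
  have 2: "M + z \<in> K" if z: "z \<bullet> e = 0" "z \<in> K" for z
  proof (rule ccontr)
    assume "M + z \<notin> K"
    then obtain a b where ab: "a \<bullet> (M + z) < b" "\<And>x. x \<in> K \<Longrightarrow> x \<bullet> e = s \<Longrightarrow> b < a \<bullet> x"
      using separating_hyperplane_closed_point[OF slice(2,1), of "M + z" s] by auto
    define c where "c = (M \<bullet> a / s) *\<^sub>R e - a"
    have c: "x \<bullet> c = (x \<bullet> e) * (M \<bullet> a / s) - x \<bullet> a" for x by (simp add: c_def inner_simps)
    have Mc: "M \<bullet> c = 0" using s by (simp add: c Me)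
    define q where "q = M \<bullet> a - b"
    have q: "x \<bullet> c \<le> q" if "x \<in> K" "x \<bullet> e = s" for x
    proof -
      have "x \<bullet> c = M \<bullet> a - x \<bullet> a" using c[of x] that s by simp
      then show ?thesis using ab(2)[OF that] inner_commute[of a x] unfolding q_def by linarith
    qed
    have zc: "q < z \<bullet> c"
      using ab(1) z c[of z] inner_commute[of a z] inner_commute[of a M] by (simp add: q_def inner_add_right)
    have "compact (K \<inter> {x. x \<bullet> e = 0})"
      using compact closed_hyperplane[of e 0] by (auto simp: inner_commute)
    moreover have "continuous_on (K \<inter> {x. x \<bullet> e = 0}) (\<lambda>x. x \<bullet> c)" by (intro continuous_intros)
    ultimately obtain z0 where z0: "z0 \<in> K" "z0 \<bullet> e = 0" "\<And>x. x \<in> K \<Longrightarrow> x \<bullet> e = 0 \<Longrightarrow> x \<bullet> c \<le> z0 \<bullet> c"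
      using continuous_attains_sup[of "K \<inter> {x. x \<bullet> e = 0}" "\<lambda>x. x \<bullet> c"] z by auto
    define w where "w = z0 \<bullet> c"
    have qw: "q < w" using zc z0(3)[of z] z by (simp add: w_def)
    \<comment> \<open>On the slice at \<open>s\<close> the functional \<open>c\<close> ranges in \<open>[-w, q]\<close>; subtracting \<open>g e\<close> centres this interval.\<close>
    define g where "g = (q - w) / (2 * s)"
    have "\<bar>z0 \<bullet> (c - g *\<^sub>R e)\<bar> \<le> (q + w) / 2"
    proof (rule slice_bound_central[OF V s'])
      fix x assume x: "x \<in> K" "x \<bullet> e = s"
      have "\<bar>x \<bullet> c\<bar> \<le> w" using centred[OF Mc _ x] z0(3) by (simp add: w_def)
      moreover have "x \<bullet> (c - g *\<^sub>R e) = x \<bullet> c - (q - w) / 2"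
        using x s by (simp add: inner_simps g_def)
      ultimately show "\<bar>x \<bullet> (c - g *\<^sub>R e)\<bar> \<le> (q + w) / 2"
        using q[OF x] unfolding abs_le_iff by (simp add: field_simps)
    qed (use z0 in auto)
    moreover have "z0 \<bullet> (c - g *\<^sub>R e) = w" using z0 by (simp add: inner_simps w_def)
    ultimately show False using qw by simp
  qed
  show ?thesis using Me 1 2 by blast
qed

end

lemma mem_closed_segment_uminus:
  fixes x :: "'a::real_vector"
  shows "y \<in> closed_segment (- x) x \<longleftrightarrow> (\<exists>t. \<bar>t\<bar> \<le> 1 \<and> y = t *\<^sub>R x)"
proof
  assume "y \<in> closed_segment (- x) x"
  then obtain u where u: "0 \<le> u" "u \<le> 1" "y = (1 - u) *\<^sub>R (- x) + u *\<^sub>R x"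
    unfolding closed_segment_def by blast
  have "y = (u - (1 - u)) *\<^sub>R x"
    unfolding scaleR_left_diff_distrib[of u] u(3) by simp
  moreover have "\<bar>u - (1 - u)\<bar> \<le> 1" using u by simp
  ultimately show "\<exists>t. \<bar>t\<bar> \<le> 1 \<and> y = t *\<^sub>R x" by blast
next
  assume "\<exists>t. \<bar>t\<bar> \<le> 1 \<and> y = t *\<^sub>R x"
  then obtain t where t: "\<bar>t\<bar> \<le> 1" "y = t *\<^sub>R x" by blast
  have "y = ((1 + t) / 2 - (1 - (1 + t) / 2)) *\<^sub>R x" using t by (simp add: field_simps)
  then have "y = (1 - (1 + t) / 2) *\<^sub>R (- x) + ((1 + t) / 2) *\<^sub>R x"
    unfolding scaleR_left_diff_distrib[of "(1 + t) / 2"] by simp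
  moreover have "0 \<le> (1 + t) / 2" "(1 + t) / 2 \<le> 1" using t by auto
  ultimately show "y \<in> closed_segment (- x) x" unfolding closed_segment_def by blast
qed

lemma mem_cylinder:
  fixes x :: "'a::real_vector"
  shows "y \<in> closed_segment (- x) x + D \<longleftrightarrow> (\<exists>t. \<exists>z\<in>D. \<bar>t\<bar> \<le> 1 \<and> y = t *\<^sub>R x + z)"
  by (force simp: set_plus_def mem_closed_segment_uminus)

context symmetric_body
begin

text \<open>
  A limit of the centroids at heights tending to the maximal one gives the end point \<open>x0\<close> of the axis. By
  convexity the slice at height \<open>s\<close> contains the central slice moved by \<open>(s / height) x0\<close>, and it is also a translate of the central
  slice. A nonempty compact set that is mapped into itself by a translation is not moved at all, so
  the two translation vectors agree.
\<close>

lemma cylinder_decomposition: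
  assumes V: "\<And>s. \<bar>s\<bar> < height \<Longrightarrow> weight (\<lambda>x. 1) s = V"
  shows "\<exists>x0. x0 \<bullet> e = height \<and> K = closed_segment (- x0) x0 + K \<inter> {x. x \<bullet> e = 0}"
proof -
  define s where "s n = height * (1 - 1 / real (n + 2))" for n
  have s: "0 < s n" "s n < height" for n using height_pos by (simp_all add: s_def)
  have "\<forall>n. \<exists>M. M \<bullet> e = s n \<and> (\<forall>z. z \<bullet> e = 0 \<longrightarrow> (M + z \<in> K \<longleftrightarrow> z \<in> K))"
    using slice_eq_translate[OF V s] by blast
  then obtain M where M: "\<And>n. M n \<bullet> e = s n" "\<And>n z. z \<bullet> e = 0 \<Longrightarrow> M n + z \<in> K \<longleftrightarrow> z \<in> K" by metis
  have "M n \<in> K" for n using M(2)[of 0 n] zero_mem by simp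
  then obtain x0 r where x0: "x0 \<in> K" "strict_mono r" "(M \<circ> r) \<longlonglongrightarrow> x0"
    using compact unfolding compact_def by metis
  have "s \<longlonglongrightarrow> height * (1 - 0)" unfolding s_def
    by (intro tendsto_intros LIMSEQ_ignore_initial_segment[OF lim_1_over_n])
  then have "(s \<circ> r) \<longlonglongrightarrow> height" using x0(2) LIMSEQ_subseq_LIMSEQ by fastforce
  moreover have "(\<lambda>n. (M \<circ> r) n \<bullet> e) \<longlonglongrightarrow> x0 \<bullet> e" by (intro tendsto_intros x0)
  ultimately have x0e: "x0 \<bullet> e = height" using M(1) LIMSEQ_unique by (auto simp: o_def)
  \<comment> \<open>The top slice contains a full translate of the central one, since \<open>K\<close> is closed.\<close>
  have top: "x0 + z \<in> K" if z: "z \<in> K" "z \<bullet> e = 0" for z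
  proof (rule closed_sequentially[OF compact_imp_closed[OF compact]])
    show "(M \<circ> r) n + z \<in> K" for n using M(2)[OF z(2)] z(1) by simp
    show "(\<lambda>n. (M \<circ> r) n + z) \<longlonglongrightarrow> x0 + z" by (intro tendsto_intros x0)
  qed
  let ?D = "K \<inter> {x. x \<bullet> e = 0}"
  have sub: "t *\<^sub>R x0 + z \<in> K" if z: "z \<in> ?D" and t: "\<bar>t\<bar> \<le> 1" for z t
  proof -
    have "- (x0 + - z) \<in> K" using top[of "- z"] z sym by (intro sym) auto
    then have b: "- x0 + z \<in> K" by simp
    have "((1 - t) / 2) *\<^sub>R (- x0 + z) + ((1 + t) / 2) *\<^sub>R (x0 + z) \<in> K"
      using t z by (intro convexD[OF convex b top]) (auto simp: field_simps)
    also have "((1 - t) / 2) *\<^sub>R (- x0 + z) + ((1 + t) / 2) *\<^sub>R (x0 + z)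
        = ((1 + t) / 2 - (1 - t) / 2) *\<^sub>R x0 + ((1 - t) / 2 + (1 + t) / 2) *\<^sub>R z"
      by (simp add: algebra_simps)
    also have "\<dots> = t *\<^sub>R x0 + z" by (simp add: field_simps)
    finally show ?thesis .
  qed
  have pos: "x \<in> closed_segment (- x0) x0 + ?D" if x: "x \<in> K" "0 < x \<bullet> e" "x \<bullet> e < height" for x
  proof -
    obtain N where N: "N \<bullet> e = x \<bullet> e" "\<And>z. z \<bullet> e = 0 \<Longrightarrow> N + z \<in> K \<longleftrightarrow> z \<in> K"
      using slice_eq_translate[OF V x(2,3)] by blast
    define t where "t = x \<bullet> e / height"
    have t: "\<bar>t\<bar> \<le> 1" using x by (auto simp: t_def)
    define d where "d = t *\<^sub>R x0 - N"
    have de: "d \<bullet> e = 0" using height_pos by (simp add: d_def inner_simps N x0e t_def)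
    have shift: "d + y \<in> ?D" if y: "y \<in> ?D" for y
    proof -
      have "N + (d + y) \<in> K" using sub[OF y t] by (simp add: d_def)
      then show ?thesis using N(2)[of "d + y"] de y by (auto simp: inner_simps)
    qed
    have "compact ?D"
      using compact closed_hyperplane[of e 0] by (auto simp: inner_commute)
    moreover have "continuous_on ?D (\<lambda>y. y \<bullet> d)" by (intro continuous_intros)
    moreover have "?D \<noteq> {}" using zero_mem by auto
    \<comment> \<open>A point of the central slice that is extremal in direction \<open>d\<close> cannot be moved by \<open>d \<noteq> 0\<close>.\<close>
    ultimately obtain y where y: "y \<in> ?D" "\<And>y'. y' \<in> ?D \<Longrightarrow> y' \<bullet> d \<le> y \<bullet> d"
      using continuous_attains_sup[of ?D "\<lambda>y. y \<bullet> d"] by blast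
    have "d \<bullet> d \<le> 0" using y(2)[OF shift[OF y(1)]] by (simp add: inner_simps)
    then have "d = 0" by (metis inner_eq_zero_iff inner_ge_zero order_antisym)
    then have N_eq: "N = t *\<^sub>R x0" by (simp add: d_def)
    have "x - N \<in> ?D" using N(2)[of "x - N"] N(1) x by (simp add: inner_simps)
    moreover have "x = t *\<^sub>R x0 + (x - N)" by (simp add: N_eq)
    ultimately show ?thesis unfolding mem_cylinder using t by blast
  qed
  have open_part: "x \<in> closed_segment (- x0) x0 + ?D" if x: "x \<in> K" "\<bar>x \<bullet> e\<bar> < height" for x
  proof -
    consider "x \<bullet> e = 0" | "0 < x \<bullet> e" | "0 < (- x) \<bullet> e" by fastforce
    then show ?thesis
    proof cases
      case 1
      then have "x \<in> ?D" "x = 0 *\<^sub>R x0 + x" "\<bar>0::real\<bar> \<le> 1" using x by auto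
      then show ?thesis unfolding mem_cylinder by blast
    next
      case 2
      then show ?thesis using pos x by simp
    next
      case 3
      then have "- x \<in> closed_segment (- x0) x0 + ?D" using x by (intro pos sym) auto
      then obtain t z where tz: "z \<in> ?D" "\<bar>t\<bar> \<le> 1" "- x = t *\<^sub>R x0 + z" unfolding mem_cylinder by blast
      have "x = (- t) *\<^sub>R x0 + - z" using arg_cong[OF tz(3), of uminus] by simp
      moreover have "- z \<in> ?D" "\<bar>- t\<bar> \<le> 1" using tz sym by auto
      ultimately show ?thesis unfolding mem_cylinder by blast
    qed
  qed
  have cl: "closed (closed_segment (- x0) x0 + ?D)"
  proof -
    have "compact ?D" using compact closed_hyperplane[of e 0] by (auto simp: inner_commute)
    then have "compact (\<Union>x\<in>closed_segment (- x0) x0. \<Union>y\<in>?D. {x + y})"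
      by (intro compact_sums') auto
    moreover have "(\<Union>x\<in>closed_segment (- x0) x0. \<Union>y\<in>?D. {x + y}) = closed_segment (- x0) x0 + ?D"
      by (auto simp: set_plus_def)
    ultimately show ?thesis using compact_imp_closed by metis
  qed
  have "x \<in> closed_segment (- x0) x0 + ?D" if x: "x \<in> K" for x
  proof (rule closed_sequentially[OF cl])
    let ?r = "\<lambda>n. 1 - 1 / real (n + 2)"
    have "?r \<longlonglongrightarrow> 1 - 0"
      by (intro tendsto_intros LIMSEQ_ignore_initial_segment[OF lim_1_over_n])
    then have "(\<lambda>n. ?r n *\<^sub>R x) \<longlonglongrightarrow> (1 - 0) *\<^sub>R x" by (rule tendsto_scaleR[OF _ tendsto_const])
    then show "(\<lambda>n. ?r n *\<^sub>R x) \<longlonglongrightarrow> x" by simp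
    fix n
    have r: "0 < ?r n" "?r n < 1" by (auto simp: field_simps)
    have "?r n *\<^sub>R x + (1 - ?r n) *\<^sub>R 0 \<in> K" using r by (intro convexD[OF convex x zero_mem]) auto
    moreover have "\<bar>(?r n *\<^sub>R x) \<bullet> e\<bar> < height"
    proof -
      have "\<bar>(?r n *\<^sub>R x) \<bullet> e\<bar> = ?r n * \<bar>x \<bullet> e\<bar>" using r by (simp add: abs_mult)
      also have "\<dots> \<le> ?r n * height" using r abs_inner_le_height[OF x] by (intro mult_left_mono) auto
      also have "\<dots> < 1 * height" using r height_pos by (intro mult_strict_right_mono) auto
      finally show ?thesis by simp
    qed
    ultimately show "?r n *\<^sub>R x \<in> closed_segment (- x0) x0 + ?D" using open_part by simp
  qed
  moreover have "closed_segment (- x0) x0 + ?D \<subseteq> K"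
    using sub by (auto simp: mem_cylinder)
  ultimately have "K = closed_segment (- x0) x0 + ?D" by blast
  then show ?thesis using x0e by blast
qed

text \<open>
  For a cylinder the slices are translates of each other, so their volumes agree.
\<close>

lemma weight_cylinder:
  assumes K: "K = closed_segment (- x0) x0 + D" and D: "D \<subseteq> {x. x \<bullet> e = 0}" and x0: "0 < x0 \<bullet> e"
  shows "height = x0 \<bullet> e" and "\<bar>s\<bar> \<le> height \<Longrightarrow> weight (\<lambda>x. 1) s = weight (\<lambda>x. 1) 0"
proof -
  have repr: "\<exists>t z. \<bar>t\<bar> \<le> 1 \<and> z \<in> D \<and> x = t *\<^sub>R x0 + z" if "x \<in> K" for x
  proof -
    have "x \<in> closed_segment (- x0) x0 + D" using that K by blast
    then show ?thesis unfolding mem_cylinder by blast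
  qed
  have seg: "t *\<^sub>R x0 + z \<in> K" if "\<bar>t\<bar> \<le> 1" "z \<in> D" for t z
  proof -
    have "t *\<^sub>R x0 + z \<in> closed_segment (- x0) x0 + D" unfolding mem_cylinder using that by blast
    then show ?thesis using K by blast
  qed
  have inner: "(t *\<^sub>R x0 + z) \<bullet> e = t * (x0 \<bullet> e)" if "z \<in> D" for t z
    using that D by (auto simp: inner_simps)
  show h: "height = x0 \<bullet> e"
  proof (rule antisym)
    obtain p where p: "p \<in> K" "p \<bullet> e = height" using ex_top by blast
    obtain t z where tz: "\<bar>t\<bar> \<le> 1" "z \<in> D" "p = t *\<^sub>R x0 + z" using repr[OF p(1)] by blast
    have "height = t * (x0 \<bullet> e)" using p tz inner by simp
    also have "\<dots> \<le> 1 * (x0 \<bullet> e)" using tz x0 by (intro mult_right_mono) auto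
    finally show "height \<le> x0 \<bullet> e" by simp
    have "1 *\<^sub>R x0 + z \<in> K" using tz by (intro seg) auto
    then show "x0 \<bullet> e \<le> height" using inner_le_height[of "1 *\<^sub>R x0 + z"] inner[OF tz(2), of 1] by simp
  qed
  assume s: "\<bar>s\<bar> \<le> height"
  have mem: "x \<in> K \<longleftrightarrow> x - (s / height) *\<^sub>R x0 \<in> K" if x: "x \<bullet> e = s" for x
  proof
    assume "x \<in> K"
    then obtain t z where tz: "\<bar>t\<bar> \<le> 1" "z \<in> D" "x = t *\<^sub>R x0 + z" using repr by blast
    have "t = s / height" using inner[OF tz(2), of t] tz x h x0 by (simp add: field_simps)
    then show "x - (s / height) *\<^sub>R x0 \<in> K" using seg[of 0 z] tz by simp
  next
    assume "x - (s / height) *\<^sub>R x0 \<in> K"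
    then obtain t z where tz: "\<bar>t\<bar> \<le> 1" "z \<in> D" "x - (s / height) *\<^sub>R x0 = t *\<^sub>R x0 + z" using repr by blast
    have "(x - (s / height) *\<^sub>R x0) \<bullet> e = 0" using x h x0 by (simp add: inner_simps)
    then have "t = 0" using inner[OF tz(2), of t] tz x0 by simp
    then have "x = (s / height) *\<^sub>R x0 + z" using tz by (simp add: algebra_simps)
    moreover have "\<bar>s / height\<bar> \<le> 1" using s height_pos by simp
    ultimately show "x \<in> K" using seg tz by simp
  qed
  define z where "z = s *\<^sub>R e - (s / height) *\<^sub>R x0"
  have ze: "z \<bullet> e = 0" using h x0 by (simp add: z_def inner_simps)
  have [measurable]: "K \<in> sets borel" using compact by (simp add: borel_compact)
  have "weight (\<lambda>x. 1) s = (\<integral>y. indicator K (s *\<^sub>R e + y) \<partial>coord_lborel (Basis - {e}))"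
    by (simp add: weight_def slice_integral_def)
  also have "\<dots> = (\<integral>y. indicator K (0 *\<^sub>R e + y + z) \<partial>coord_lborel (Basis - {e}))"
  proof (rule integral_cong_AE)
    show "AE y in coord_lborel (Basis - {e}). (indicator K (s *\<^sub>R e + y) :: real) = indicator K (0 *\<^sub>R e + y + z)"
      using AE_slice[OF e, of s]
    proof eventually_elim
      case (elim y)
      have *: "0 *\<^sub>R e + y + z = s *\<^sub>R e + y - (s / height) *\<^sub>R x0" by (simp add: z_def)
      show ?case unfolding * indicator_def using mem[OF elim] by simp
    qed
  qed measurable
  also have "\<dots> = weight (\<lambda>x. 1) 0"
    using slice_integral_translate[of "indicator K" e z 0] ze e by (simp add: weight_def slice_integral_def)
  finally show "weight (\<lambda>x. 1) s = weight (\<lambda>x. 1) 0" .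
qed

end

section \<open>Averages with respect to a unimodal weight\<close>

text \<open>
  A nonempty open set is not a null set.
\<close>

lemma AE_lborel_open_ex:
  assumes "AE x in lborel. P x" "open U" "U \<noteq> ({} :: 'a::euclidean_space set)"
  shows "\<exists>x\<in>U. P x"
proof (rule ccontr)
  assume "\<not> (\<exists>x\<in>U. P x)"
  then have "AE x in lborel. x \<notin> U" using assms(1) by (auto elim!: eventually_mono)
  then have "U \<in> null_sets lborel" using assms(2) by (subst AE_iff_null_sets) auto
  then have "negligible U" using negligible_iff_null_sets null_sets_completionI by blast
  then show False using assms open_not_negligible by blast
qed

text \<open>
  The average of \<open>\<psi>\<close> is attained at some \<open>s0\<close> by the intermediate value theorem. On either side of \<open>\<plusminus>s0\<close> the
  factors \<open>\<psi> s0 - \<psi> s\<close> and \<open>m s - m s0\<close> have the same sign, so their product is nonnegative; its integral is the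
  difference of the two sides. In the case of equality the product vanishes almost everywhere, and
  monotonicity of \<open>m\<close> removes the exceptional points, except for \<open>s = 0\<close>, where a
  monotone function may still jump.
\<close>

lemma unimodal_average_le:
  fixes m \<psi> :: "real \<Rightarrow> real"
  assumes h: "0 < h" and m: "integrable lborel m" "\<And>s t. \<bar>s\<bar> \<le> \<bar>t\<bar> \<Longrightarrow> m t \<le> m s"
      "\<And>s. h < \<bar>s\<bar> \<Longrightarrow> m s = 0"
    and \<psi>: "continuous_on UNIV \<psi>" "\<And>s t. \<bar>s\<bar> \<le> \<bar>t\<bar> \<Longrightarrow> \<bar>t\<bar> \<le> h \<Longrightarrow> \<psi> s \<le> \<psi> t"
    and int: "integrable lborel (\<lambda>s. \<psi> s * m s)"
  shows "2 * h * (\<integral>s. \<psi> s * m s \<partial>lborel) \<le> (\<integral>s. indicator {-h..h} s * \<psi> s \<partial>lborel) * (\<integral>s. m s \<partial>lborel)"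
    and "2 * h * (\<integral>s. \<psi> s * m s \<partial>lborel) = (\<integral>s. indicator {-h..h} s * \<psi> s \<partial>lborel) * (\<integral>s. m s \<partial>lborel) \<Longrightarrow>
         (\<And>s t. \<bar>s\<bar> < \<bar>t\<bar> \<Longrightarrow> \<bar>t\<bar> \<le> h \<Longrightarrow> \<psi> s < \<psi> t) \<Longrightarrow> \<exists>V. \<forall>s. 0 < \<bar>s\<bar> \<longrightarrow> \<bar>s\<bar> < h \<longrightarrow> m s = V"
proof -
  let ?I = "indicator {-h..h} :: real \<Rightarrow> real"
  define S where "S = (\<integral>s. ?I s * \<psi> s \<partial>lborel)"
  have int\<psi>: "integrable lborel (\<lambda>s. ?I s * \<psi> s)"
    using borel_integrable_atLeastAtMost'[of "-h" h \<psi>] continuous_on_subset[OF \<psi>(1)]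
    by (simp add: set_integrable_def)
  have intI: "integrable lborel ?I"
    by (intro integrable_real_indicator) (auto simp: emeasure_lborel_Icc_eq)
  have I: "(\<integral>s. ?I s \<partial>lborel) = 2 * h" using h by simp
  have "(\<integral>s. ?I s * \<psi> 0 \<partial>lborel) \<le> S" unfolding S_def
  proof (rule integral_mono[OF integrable_mult_left[OF intI] int\<psi>])
    show "?I s * \<psi> 0 \<le> ?I s * \<psi> s" for s using \<psi>(2)[of 0 s] by (simp add: indicator_def abs_le_iff)
  qed
  moreover have "S \<le> (\<integral>s. ?I s * \<psi> h \<partial>lborel)" unfolding S_def
  proof (rule integral_mono[OF int\<psi> integrable_mult_left[OF intI]])
    show "?I s * \<psi> s \<le> ?I s * \<psi> h" for s using \<psi>(2)[of s h] h by (simp add: indicator_def abs_le_iff)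
  qed
  ultimately have "\<psi> 0 \<le> S / (2 * h)" "S / (2 * h) \<le> \<psi> h"
    using h I by (simp_all add: field_simps)
  then obtain s0 where s0: "0 \<le> s0" "s0 \<le> h" "\<psi> s0 = S / (2 * h)"
    using IVT'[of \<psi> 0 "S / (2 * h)" h] h continuous_on_subset[OF \<psi>(1)] by auto
  define D where "D s = ?I s * ((\<psi> s0 - \<psi> s) * (m s - m s0))" for s
  have D0: "0 \<le> D s" for s
  proof -
    have "0 \<le> (\<psi> s0 - \<psi> s) * (m s - m s0)" if "\<bar>s\<bar> \<le> h"
    proof (cases "\<bar>s\<bar> \<le> \<bar>s0\<bar>")
      case True
      then show ?thesis using \<psi>(2)[of s s0] m(2)[of s s0] s0 by (intro mult_nonneg_nonneg) auto
    next
      case False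
      then show ?thesis using \<psi>(2)[of s0 s] m(2)[of s0 s] s0 that by (intro mult_nonpos_nonpos) auto
    qed
    then show ?thesis by (auto simp: D_def indicator_def)
  qed
  have D_eq: "D s = \<psi> s0 * m s - \<psi> s0 * m s0 * ?I s - \<psi> s * m s + m s0 * (?I s * \<psi> s)" for s
    using m(3)[of s] by (cases "s \<in> {-h..h}") (auto simp: D_def algebra_simps indicator_def)
  have intD: "integrable lborel D" unfolding D_eq[abs_def]
    by (intro Bochner_Integration.integrable_add Bochner_Integration.integrable_diff integrable_mult_right m(1) intI int int\<psi>)
  have "(\<integral>s. D s \<partial>lborel) = \<psi> s0 * (\<integral>s. m s \<partial>lborel) - \<psi> s0 * m s0 * (2 * h) - (\<integral>s. \<psi> s * m s \<partial>lborel) + m s0 * S"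
    unfolding D_eq[abs_def] S_def
    by (subst Bochner_Integration.integral_add Bochner_Integration.integral_diff;
        (intro Bochner_Integration.integrable_add Bochner_Integration.integrable_diff integrable_mult_right m(1) intI int int\<psi>)?)+
       (simp add: I h less_imp_le)
  also have "\<dots> = S / (2 * h) * (\<integral>s. m s \<partial>lborel) - (\<integral>s. \<psi> s * m s \<partial>lborel)"
    using h by (simp add: s0)
  finally have D: "2 * h * (\<integral>s. D s \<partial>lborel) = S * (\<integral>s. m s \<partial>lborel) - 2 * h * (\<integral>s. \<psi> s * m s \<partial>lborel)"
    using h by (simp add: field_simps)
  have "0 \<le> (\<integral>s. D s \<partial>lborel)" using D0 by (intro Bochner_Integration.integral_nonneg)
  then have "0 \<le> 2 * h * (\<integral>s. D s \<partial>lborel)" using h by simp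
  then show "2 * h * (\<integral>s. \<psi> s * m s \<partial>lborel) \<le> (\<integral>s. ?I s * \<psi> s \<partial>lborel) * (\<integral>s. m s \<partial>lborel)"
    using D by (simp add: S_def)
  assume eq: "2 * h * (\<integral>s. \<psi> s * m s \<partial>lborel) = (\<integral>s. ?I s * \<psi> s \<partial>lborel) * (\<integral>s. m s \<partial>lborel)"
    and strict: "\<And>s t. \<bar>s\<bar> < \<bar>t\<bar> \<Longrightarrow> \<bar>t\<bar> \<le> h \<Longrightarrow> \<psi> s < \<psi> t"
  have "(\<integral>s. D s \<partial>lborel) = 0" using D eq h by (simp add: S_def)
  then have AE: "AE s in lborel. D s = 0" using integral_nonneg_eq_0_iff_AE[OF intD] D0 by auto
  have D_imp: "m s = m s0" if "D s = 0" "\<bar>s\<bar> < h" "s \<noteq> s0" "s \<noteq> - s0" for s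
  proof -
    have "\<psi> s \<noteq> \<psi> s0"
      using strict[of s s0] strict[of s0 s] that s0 by (cases "\<bar>s\<bar> < \<bar>s0\<bar>") force+
    then show ?thesis using that by (auto simp: D_def indicator_def split: if_splits)
  qed
  \<comment> \<open>The equality \<open>m t = m s0\<close> is only known off \<open>\<plusminus>s0\<close>, so the interval is shortened to avoid \<open>s0\<close>.\<close>
  have ex: "\<exists>t. a < t \<and> t < b \<and> m t = m s0" if "0 \<le> a" "a < b" "b \<le> h" for a b
  proof -
    obtain c d where cd: "a \<le> c" "c < d" "d \<le> b" "s0 \<notin> {c<..<d}"
    proof (cases "a < s0 \<and> s0 < b")
      case True
      then show ?thesis using that[of a s0] by simp
    next
      case False
      then show ?thesis using that[of a b] \<open>a < b\<close> by simp
    qed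
    obtain t where "t \<in> {c<..<d}" "D t = 0"
      using AE_lborel_open_ex[OF AE, of "{c<..<d}"] cd by auto
    then show ?thesis using D_imp[of t] cd that s0 by (intro exI[of _ t]) auto
  qed
  have "m s = m s0" if s: "0 < \<bar>s\<bar>" "\<bar>s\<bar> < h" for s
  proof (rule antisym)
    obtain t where "0 < t" "t < \<bar>s\<bar>" "m t = m s0" using ex[of 0 "\<bar>s\<bar>"] s by auto
    then show "m s \<le> m s0" using m(2)[of t s] by simp
    obtain t' where "\<bar>s\<bar> < t'" "t' < h" "m t' = m s0" using ex[of "\<bar>s\<bar>" h] s by auto
    then show "m s0 \<le> m s" using m(2)[of s t'] by simp
  qed
  then show "\<exists>V. \<forall>s. 0 < \<bar>s\<bar> \<longrightarrow> \<bar>s\<bar> < h \<longrightarrow> m s = V" by blast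
qed

lemma convex_nonneg_mono:
  fixes \<phi> :: "real \<Rightarrow> real"
  assumes \<phi>: "convex_on {0..} \<phi>" "\<And>t. 0 \<le> t \<Longrightarrow> 0 \<le> \<phi> t" "\<phi> 0 = 0" and st: "0 \<le> s" "s \<le> t"
  shows "\<phi> s \<le> \<phi> t"
proof (cases "t = 0")
  case False
  then have t: "0 < t" using st by simp
  have "\<phi> ((1 - s / t) *\<^sub>R 0 + (s / t) *\<^sub>R t) \<le> (1 - s / t) * \<phi> 0 + (s / t) * \<phi> t"
    using t st by (intro convex_onD[OF \<phi>(1)]) auto
  then have "\<phi> s \<le> (s / t) * \<phi> t" using t \<phi>(3) by simp
  also have "\<dots> \<le> 1 * \<phi> t" using st t \<phi>(2)[of t] by (intro mult_right_mono) auto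
  finally show ?thesis by simp
qed (use st in simp)

lemma strictly_convex_strict_mono:
  assumes \<phi>: "strictly_convex_on {0..} \<phi>" "\<And>t. 0 \<le> t \<Longrightarrow> 0 \<le> \<phi> t" "\<phi> 0 = 0" and st: "0 \<le> s" "s < t"
  shows "\<phi> s < \<phi> t"
proof -
  have *: "\<phi> (u * t) < u * \<phi> t" if "0 < u" "u < 1" for u
  proof -
    have "\<phi> ((1 - u) * 0 + u * t) < (1 - u) * \<phi> 0 + u * \<phi> t"
      using \<phi>(1)[unfolded strictly_convex_on_def, THEN conjunct2, rule_format, of 0 t u] st that by simp
    then show ?thesis by (simp add: \<phi>(3))
  qed
  have pos: "0 < \<phi> t" using *[of "1/2"] \<phi>(2)[of "1/2 * t"] st by simp
  show ?thesis
  proof (cases "s = 0")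
    case False
    then have "\<phi> (s / t * t) < s / t * \<phi> t" using st by (intro *) auto
    also have "\<dots> \<le> 1 * \<phi> t" using st pos by (intro mult_right_mono) auto
    finally show ?thesis using st by simp
  qed (use pos \<phi> in simp)
qed

text \<open>
  Extending \<open>\<phi>\<close> by \<open>0\<close> to the negative half line keeps it convex, hence continuous, so that no
  measurability questions arise at \<open>0\<close> or for negative arguments.
\<close>

lemma convex_on_max_0:
  fixes \<phi> :: "real \<Rightarrow> real"
  assumes \<phi>: "convex_on {0..} \<phi>" "\<And>t. 0 \<le> t \<Longrightarrow> 0 \<le> \<phi> t" "\<phi> 0 = 0"
  shows "convex_on UNIV (\<lambda>u. \<phi> (max 0 u))"
  unfolding convex_on_def
proof (intro conjI ballI allI impI)
  fix x y u v :: real assume uv: "0 \<le> u" "0 \<le> v" "u + v = 1"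
  have "u * x + v * y \<le> u * max 0 x + v * max 0 y"
    using uv by (intro add_mono mult_left_mono) auto
  moreover have nn: "0 \<le> u * max 0 x + v * max 0 y" using uv by simp
  ultimately have "\<phi> (max 0 (u *\<^sub>R x + v *\<^sub>R y)) \<le> \<phi> (u *\<^sub>R max 0 x + v *\<^sub>R max 0 y)"
    by (intro convex_nonneg_mono[OF \<phi>]) auto
  also have "\<dots> \<le> u * \<phi> (max 0 x) + v * \<phi> (max 0 y)"
    using \<phi>(1) uv unfolding convex_on_def by auto
  finally show "\<phi> (max 0 (u *\<^sub>R x + v *\<^sub>R y)) \<le> u * \<phi> (max 0 x) + v * \<phi> (max 0 y)" .
qed simp

definition sym_avg :: "(real \<Rightarrow> real) \<Rightarrow> real \<Rightarrow> real \<Rightarrow> real" where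
  "sym_avg P c u = (P (c + u) + P (c - u)) / 2"

lemma sym_avg_uminus [simp]: "sym_avg P c (- u) = sym_avg P c u"
  by (simp add: sym_avg_def)

text \<open>
  Write \<open>u\<close> as a convex combination of \<open>v\<close> and \<open>- v\<close>.
\<close>

lemma sym_avg_mono:
  assumes P: "convex_on UNIV P" and uv: "\<bar>u\<bar> \<le> \<bar>v\<bar>"
  shows "sym_avg P c u \<le> sym_avg P c v"
proof (cases "v = 0")
  case False
  define l where "l = (1 + u / v) / 2"
  have "\<bar>u / v\<bar> \<le> 1" using uv False by (simp add: abs_divide)
  then have "- 1 \<le> u / v" "u / v \<le> 1" unfolding abs_le_iff by linarith+
  then have l: "0 \<le> l" "l \<le> 1" by (auto simp: l_def)
  have u: "u = l * v - (1 - l) * v" using False by (simp add: l_def field_simps)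
  have "P (c + u) \<le> (1 - l) * P (c - v) + l * P (c + v)"
    using convex_onD[OF P l, of "c - v" "c + v"] by (simp add: u algebra_simps)
  moreover have "P (c - u) \<le> (1 - l) * P (c + v) + l * P (c - v)"
    using convex_onD[OF P l, of "c + v" "c - v"] by (simp add: u algebra_simps)
  ultimately have "P (c + u) + P (c - u) \<le> P (c + v) + P (c - v)"
    by (simp add: algebra_simps)
  then show ?thesis by (simp add: sym_avg_def)
qed (use uv in simp)

lemma sym_avg_strict_mono:
  assumes P: "strictly_convex_on {0..} P" and uv: "\<bar>u\<bar> < \<bar>v\<bar>" "\<bar>v\<bar> \<le> c"
  shows "sym_avg P c u < sym_avg P c v"
proof -
  have v: "v \<noteq> 0" using uv by auto
  define l where "l = (1 + u / v) / 2"
  have "\<bar>u / v\<bar> < 1" using uv v by (simp add: abs_divide)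
  then have "- 1 < u / v" "u / v < 1" unfolding abs_less_iff by linarith+
  then have l: "0 < l" "l < 1" by (auto simp: l_def)
  have u: "u = l * v - (1 - l) * v" using v by (simp add: l_def field_simps)
  have cv: "c - v \<in> {0..}" "c + v \<in> {0..}" "c - v \<noteq> c + v" using uv v by auto
  have P': "P ((1 - l) * s + l * t) < (1 - l) * P s + l * P t" if "s \<in> {0..}" "t \<in> {0..}" "s \<noteq> t" for s t
    using P that l unfolding strictly_convex_on_def by blast
  have "P (c + u) < (1 - l) * P (c - v) + l * P (c + v)"
    using P'[OF cv] by (simp add: u algebra_simps)
  moreover have "P (c - u) < (1 - l) * P (c + v) + l * P (c - v)"
    using P'[OF cv(2,1)] cv(3) by (simp add: u algebra_simps)
  ultimately have "P (c + u) + P (c - u) < P (c + v) + P (c - v)"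
    by (simp add: algebra_simps)
  then show ?thesis by (simp add: sym_avg_def)
qed

lemma integral_symmetric_interval_scale:
  fixes q :: "real \<Rightarrow> real"
  assumes "0 < h"
  shows "(\<integral>s. indicator {-h..h} s * q s \<partial>lborel) = h * (\<integral>t. indicator {-1..1} t * q (h * t) \<partial>lborel)"
proof -
  have "indicator {-h..h} (h * t) = (indicator {-1..1} t :: real)" for t
    using mult_le_cancel_left_pos[OF assms, of "-1" t] mult_le_cancel_left_pos[OF assms, of t 1]
    by (simp add: indicator_def)
  then show ?thesis
    using assms by (subst lborel_integral_real_affine[where c = h and t = 0]) simp_all
qed

lemma integral_interval_continuous_integrable:
  fixes q :: "real \<Rightarrow> real"
  assumes "continuous_on UNIV q"
  shows "integrable lborel (\<lambda>s. indicator {a..b} s * q s)"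
  using borel_integrable_atLeastAtMost'[of a b q] continuous_on_subset[OF assms]
  by (simp add: set_integrable_def)

lemma integral_sym_avg:
  assumes "continuous_on UNIV P"
  shows "(\<integral>t. indicator {-1..1} t * sym_avg P c (c * t) \<partial>lborel)
       = (\<integral>t. indicator {-1..1} t * P (c * (1 + t)) \<partial>lborel)"
proof -
  have cP: "continuous_on UNIV (\<lambda>t. P (c * (1 + t)))" "continuous_on UNIV (\<lambda>t. P (c * (1 - t)))"
    by (intro continuous_on_compose2[OF assms] continuous_intros subset_UNIV)+
  note int = integral_interval_continuous_integrable[OF cP(1)] integral_interval_continuous_integrable[OF cP(2)]
  have refl: "(\<integral>t. indicator {-1..1} t * P (c * (1 - t)) \<partial>lborel) = (\<integral>t. indicator {-1..1} t * P (c * (1 + t)) \<partial>lborel)"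
    by (subst lborel_integral_real_affine[where c = "-1" and t = 0])
       (auto simp: indicator_def intro!: Bochner_Integration.integral_cong)
  have "(\<integral>t. indicator {-1..1} t * sym_avg P c (c * t) \<partial>lborel)
      = (\<integral>t. (indicator {-1..1} t * P (c * (1 + t)) + indicator {-1..1} t * P (c * (1 - t))) / 2 \<partial>lborel)"
    by (simp add: sym_avg_def algebra_simps add_divide_distrib)
  also have "\<dots> = ((\<integral>t. indicator {-1..1} t * P (c * (1 + t)) \<partial>lborel) + (\<integral>t. indicator {-1..1} t * P (c * (1 - t)) \<partial>lborel)) / 2"
    using int by (simp add: Bochner_Integration.integral_add)
  finally show ?thesis using refl by simp
qed

context symmetric_body
begin

abbreviation volume :: "real \<Rightarrow> real" where
  "volume \<equiv> weight (\<lambda>x. 1)"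

lemma volume_nonneg: "0 \<le> volume s"
  unfolding weight_def by (intro slice_integral_nonneg) auto

lemma volume_uminus: "volume (- s) = volume s"
  using weight_uminus[of "\<lambda>x. 1" s] by simp

lemma volume_unimodal: "\<bar>s\<bar> \<le> \<bar>t\<bar> \<Longrightarrow> volume t \<le> volume s"
  using convex by (intro weight_unimodal) (auto simp: concave_on_const)

lemma log_concave_volume: "log_concave volume"
  unfolding weight_def[abs_def]
  using convex
  by (intro log_concave_slice_integral tame_weight log_concave_indicator_mult) (auto simp: concave_on_const)

text \<open>
  Integrals of functions of the height alone reduce to the line, weighted with the slice volumes.
\<close>

lemma integral_profile:
  assumes q: "continuous_on UNIV q" "\<And>s. 0 \<le> q s"
  shows "integrable lborel (\<lambda>s. q s * volume s)"
    and "integrable lborel (\<lambda>x. indicator K x * q (x \<bullet> e))"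
    and "(\<integral>x. indicator K x * q (x \<bullet> e) \<partial>lborel) = (\<integral>s. q s * volume s \<partial>lborel)"
proof -
  have cq: "continuous_on UNIV (\<lambda>x. q (x \<bullet> e))"
    by (intro continuous_on_compose2[OF q(1)] continuous_intros subset_UNIV)
  have t: "tame (\<lambda>x. indicator K x * q (x \<bullet> e))" by (rule tame_weight[OF cq])
  have eq: "slice_integral e (\<lambda>x. indicator K x * q (x \<bullet> e)) = (\<lambda>s. q s * volume s)"
  proof (rule ext)
    fix s
    have "slice_integral e (\<lambda>x. indicator K x * q (x \<bullet> e)) s = weight (\<lambda>x. q s) s"
      unfolding weight_def[of "\<lambda>x. q (x \<bullet> e)", symmetric] by (intro weight_cong cq) auto
    then show "slice_integral e (\<lambda>x. indicator K x * q (x \<bullet> e)) s = q s * volume s"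
      by (simp add: weight_const[of "q s"])
  qed
  show "integrable lborel (\<lambda>s. q s * volume s)"
    using integral_slices(1)[OF e t] q(2) by (simp add: eq)
  show "(\<integral>x. indicator K x * q (x \<bullet> e) \<partial>lborel) = (\<integral>s. q s * volume s \<partial>lborel)"
    using integral_slices(2)[OF e t] q(2) by (simp add: eq)
  show "integrable lborel (\<lambda>x. indicator K x * q (x \<bullet> e))"
    using tame_integrable[OF order_refl t, of 0] by (simp add: coord_lborel_Basis)
qed

lemma volume_integrable: "integrable lborel volume"
  using integral_profile(1)[of "\<lambda>s. 1"] by simp

lemma measure_eq_integral_volume: "measure lborel K = (\<integral>s. volume s \<partial>lborel)"
  using integral_profile(3)[of "\<lambda>s. 1"] by simp

lemma integral_profile_reflect:
  assumes q: "continuous_on UNIV q" "\<And>s. 0 \<le> q s"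
  shows "(\<integral>s. q (- s) * volume s \<partial>lborel) = (\<integral>s. q s * volume s \<partial>lborel)"
  by (subst lborel_integral_real_affine[where c = "-1" and t = 0]) (simp_all add: volume_uminus)

text \<open>
  Symmetrize in the height, enlarge the slope to its largest admissible value \<open>c / height\<close>, and compare the weight
  with the uniform one. Equality forces the slope to be maximal and the slice volume to be constant;
  the value at \<open>0\<close> is the only one that monotonicity leaves open, and log-concavity settles it.
\<close>

lemma affine_profile_average:
  assumes P: "continuous_on UNIV P" "\<And>u. 0 \<le> P u" "convex_on UNIV P"
    and c: "0 < c" "0 \<le> a" "a * height \<le> c"
  defines "I \<equiv> (\<integral>x. indicator K x * P (c + a * (x \<bullet> e)) \<partial>lborel)"
    and "R \<equiv> (\<integral>t. indicator {-1..1} t * P (c * (1 + t)) \<partial>lborel)"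
  shows "2 * I \<le> R * measure lborel K"
    and "2 * I = R * measure lborel K \<Longrightarrow> strictly_convex_on {0..} P \<Longrightarrow>
           a * height = c \<and> (\<exists>V. \<forall>s. \<bar>s\<bar> < height \<longrightarrow> volume s = V)"
proof -
  note h = height_pos
  define \<psi> where "\<psi> = sym_avg P c"
  have c\<psi>: "continuous_on UNIV \<psi>" unfolding \<psi>_def sym_avg_def[abs_def]
    by (intro continuous_intros continuous_on_compose2[OF P(1)] subset_UNIV) simp_all
  have \<psi>0: "0 \<le> \<psi> u" for u using P(2) by (simp add: \<psi>_def sym_avg_def)
  have c1: "continuous_on UNIV (\<lambda>s. P (c + a * s))" "continuous_on UNIV (\<lambda>s. P (c - a * s))"
    by (intro continuous_on_compose2[OF P(1)] continuous_intros subset_UNIV)+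
  have c\<psi>': "continuous_on UNIV (\<lambda>s. \<psi> (b * s))" for b
    by (intro continuous_on_compose2[OF c\<psi>] continuous_intros subset_UNIV)
  have int: "integrable lborel (\<lambda>s. \<psi> (b * s) * volume s)" for b
    by (intro integral_profile(1) c\<psi>' \<psi>0)
  have "I = (\<integral>s. P (c + a * s) * volume s \<partial>lborel)"
    unfolding I_def using integral_profile(3)[OF c1(1)] P(2) by simp
  moreover have "(\<integral>s. P (c - a * s) * volume s \<partial>lborel) = (\<integral>s. P (c + a * s) * volume s \<partial>lborel)"
    using integral_profile_reflect[OF c1(1)] P(2) by simp
  moreover have "(\<integral>s. \<psi> (a * s) * volume s \<partial>lborel)
      = ((\<integral>s. P (c + a * s) * volume s \<partial>lborel) + (\<integral>s. P (c - a * s) * volume s \<partial>lborel)) / 2"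
  proof -
    have "(\<integral>s. \<psi> (a * s) * volume s \<partial>lborel)
        = (\<integral>s. (P (c + a * s) * volume s + P (c - a * s) * volume s) / 2 \<partial>lborel)"
      by (simp add: \<psi>_def sym_avg_def algebra_simps add_divide_distrib)
    then show ?thesis
      using integral_profile(1)[OF c1(1)] integral_profile(1)[OF c1(2)] P(2)
      by (simp add: Bochner_Integration.integral_add)
  qed
  ultimately have I: "I = (\<integral>s. \<psi> (a * s) * volume s \<partial>lborel)" by simp
  define b where "b = c / height"
  have ab: "a \<le> b" "0 < b" using c h by (simp_all add: b_def field_simps)
  have le: "\<psi> (a * s) * volume s \<le> \<psi> (b * s) * volume s" for s
  proof -
    have "\<bar>a * s\<bar> \<le> \<bar>b * s\<bar>" using ab c by (auto simp: abs_mult intro!: mult_right_mono)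
    then show ?thesis unfolding \<psi>_def using P(3) volume_nonneg
      by (intro mult_right_mono sym_avg_mono) auto
  qed
  have I_le: "I \<le> (\<integral>s. \<psi> (b * s) * volume s \<partial>lborel)"
    unfolding I by (intro integral_mono int le)
  have S: "(\<integral>s. indicator {-height..height} s * \<psi> (b * s) \<partial>lborel) = height * R"
    using integral_symmetric_interval_scale[OF h, of "\<lambda>s. \<psi> (b * s)"] integral_sym_avg[OF P(1), of c] h
    by (simp add: b_def \<psi>_def R_def)
  have mono\<psi>: "\<psi> (b * s) \<le> \<psi> (b * t)" if "\<bar>s\<bar> \<le> \<bar>t\<bar>" for s t
    unfolding \<psi>_def using that ab by (intro sym_avg_mono P(3)) (auto simp: abs_mult intro!: mult_left_mono)
  have zero: "volume s = 0" if "height < \<bar>s\<bar>" for s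
    using weight_eq_0_outside[of "\<lambda>x. 1" s] that by simp
  note avg = unimodal_average_le[OF h volume_integrable volume_unimodal zero c\<psi>'[of b] mono\<psi> int[of b]]
  have "2 * height * (\<integral>s. \<psi> (b * s) * volume s \<partial>lborel) \<le> height * R * measure lborel K"
    using avg(1) S by (simp add: measure_eq_integral_volume)
  then have J_le: "2 * (\<integral>s. \<psi> (b * s) * volume s \<partial>lborel) \<le> R * measure lborel K"
    using h by (simp add: mult.assoc mult.left_commute[of 2])
  then show "2 * I \<le> R * measure lborel K" using I_le by linarith
  assume eq: "2 * I = R * measure lborel K" and strict: "strictly_convex_on {0..} P"
  have J_eq: "I = (\<integral>s. \<psi> (b * s) * volume s \<partial>lborel)" using eq J_le I_le by linarith
  have ah: "a * height = c"
  proof (rule ccontr)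
    assume "a * height \<noteq> c"
    then have "a < b" using c h by (simp add: b_def field_simps)
    have "(\<integral>s. \<psi> (b * s) * volume s - \<psi> (a * s) * volume s \<partial>lborel) = 0"
      using J_eq I int by (simp add: Bochner_Integration.integral_diff)
    then have "AE s in lborel. \<psi> (b * s) * volume s - \<psi> (a * s) * volume s = 0"
      using le int by (subst (asm) integral_nonneg_eq_0_iff_AE) (auto intro!: Bochner_Integration.integrable_diff)
    then obtain s where s: "s \<in> {0<..<height}" "\<psi> (b * s) * volume s - \<psi> (a * s) * volume s = 0"
      using AE_lborel_open_ex[of _ "{0<..<height}"] h by fastforce
    then have "\<psi> (b * s) = \<psi> (a * s)" using weight_one_pos[of s] by simp
    moreover have "\<psi> (a * s) < \<psi> (b * s)" unfolding \<psi>_def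
    proof (rule sym_avg_strict_mono[OF strict])
      show "\<bar>a * s\<bar> < \<bar>b * s\<bar>" using \<open>a < b\<close> c s ab by (simp add: abs_mult)
      have "b * s \<le> b * height" using s ab by (intro mult_left_mono) auto
      then have "b * s \<le> c" using h by (simp add: b_def)
      moreover have "0 \<le> b * s" using s ab by simp
      ultimately show "\<bar>b * s\<bar> \<le> c" by linarith
    qed
    ultimately show False by simp
  qed
  have "\<exists>V. \<forall>s. 0 < \<bar>s\<bar> \<longrightarrow> \<bar>s\<bar> < height \<longrightarrow> volume s = V"
  proof (rule avg(2))
    show "2 * height * (\<integral>s. \<psi> (b * s) * volume s \<partial>lborel)
        = (\<integral>s. indicator {-height..height} s * \<psi> (b * s) \<partial>lborel) * (\<integral>s. volume s \<partial>lborel)"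
      using J_eq eq S by (simp add: measure_eq_integral_volume)
    show "\<psi> (b * s) < \<psi> (b * t)" if "\<bar>s\<bar> < \<bar>t\<bar>" "\<bar>t\<bar> \<le> height" for s t
      unfolding \<psi>_def
    proof (rule sym_avg_strict_mono[OF strict])
      show "\<bar>b * s\<bar> < \<bar>b * t\<bar>" using that ab by (simp add: abs_mult)
      have "\<bar>b * t\<bar> \<le> b * height" using that ab by (auto simp: abs_mult intro!: mult_left_mono)
      then show "\<bar>b * t\<bar> \<le> c" using h by (simp add: b_def)
    qed
  qed
  then obtain V where V: "\<And>s. 0 < \<bar>s\<bar> \<Longrightarrow> \<bar>s\<bar> < height \<Longrightarrow> volume s = V" by blast
  \<comment> \<open>Log-concavity between the heights \<open>0\<close> and \<open>height / 2\<close>, whose midpoint is \<open>height / 4\<close>, bounds \<open>volume 0\<close>.\<close>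
  have V2: "volume (height / 4) = V" "volume (height / 2) = V" using h by (auto intro!: V)
  have Vpos: "0 < V" using weight_one_pos[of "height / 2"] V2 h by simp
  have "volume 0 powr (1/2) * V powr (1/2) \<le> V"
    using log_concaveD[OF log_concave_volume, of "1/2" "1/2" 0 "height / 2"] V2 by simp
  moreover have "V powr (1/2) * V powr (1/2) = V" using Vpos by (simp flip: powr_add)
  ultimately have "volume 0 powr (1/2) * V powr (1/2) \<le> V powr (1/2) * V powr (1/2)" by linarith
  then have "volume 0 powr (1/2) \<le> V powr (1/2)" by (rule mult_right_le_imp_le) (use Vpos in simp)
  then have "volume 0 \<le> V" using Vpos powr_less_mono2[of "1/2" V "volume 0"] by fastforce
  moreover have "V \<le> volume 0" using volume_unimodal[of 0 "height / 2"] V2 by simp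
  ultimately have "volume s = V" if "\<bar>s\<bar> < height" for s
    using V[of s] that by (cases "s = 0") auto
  then show "a * height = c \<and> (\<exists>V. \<forall>s. \<bar>s\<bar> < height \<longrightarrow> volume s = V)" using ah by blast
qed

lemma affine_profile_cylinder:
  assumes P: "continuous_on UNIV P" "\<And>u. 0 \<le> P u"
    and V: "\<And>s. \<bar>s\<bar> \<le> height \<Longrightarrow> volume s = V"
  shows "2 * (\<integral>x. indicator K x * P (c * (1 + x \<bullet> e / height)) \<partial>lborel)
       = (\<integral>t. indicator {-1..1} t * P (c * (1 + t)) \<partial>lborel) * measure lborel K"
proof -
  note h = height_pos
  have vol: "volume s = V * indicator {-height..height} s" for s
    using V[of s] weight_eq_0_outside[of "\<lambda>x. 1" s] by (auto simp: indicator_def abs_le_iff)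
  have cP: "continuous_on UNIV (\<lambda>s. P (c * (1 + s / height)))"
    using h by (intro continuous_on_compose2[OF P(1)] continuous_intros subset_UNIV) auto
  have "(\<integral>x. indicator K x * P (c * (1 + x \<bullet> e / height)) \<partial>lborel)
      = (\<integral>s. V * (indicator {-height..height} s * P (c * (1 + s / height))) \<partial>lborel)"
    using integral_profile(3)[OF cP P(2)] by (simp add: vol ac_simps)
  also have "\<dots> = V * (height * (\<integral>t. indicator {-1..1} t * P (c * (1 + t)) \<partial>lborel))"
    using integral_symmetric_interval_scale[OF h, of "\<lambda>s. P (c * (1 + s / height))"] h by simp
  finally have 1: "(\<integral>x. indicator K x * P (c * (1 + x \<bullet> e / height)) \<partial>lborel)
      = V * (height * (\<integral>t. indicator {-1..1} t * P (c * (1 + t)) \<partial>lborel))" .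
  have "measure lborel K = V * (2 * height)"
    unfolding measure_eq_integral_volume vol using h by simp
  then show ?thesis using 1 by simp
qed

end

section \<open>Rotations and supporting affine functions\<close>

text \<open>
  The image measure is invariant under translations, hence a multiple of Lebesgue measure, and it gives
  the unit ball the right measure. The proportionality is obtained by evaluating the integral of \<open>1\<^sub>A(x) 1\<^sub>B(y - x)\<close>
  over the product of the two measures in two ways, where \<open>B\<close> is the ball.
\<close>

lemma distr_lborel_orthogonal:
  fixes T :: "'a::euclidean_space \<Rightarrow> 'a"
  assumes T: "orthogonal_transformation T"
  shows "distr lborel borel T = lborel"
proof (rule measure_eqI)
  have lin: "linear T" using T by (rule orthogonal_transformation_linear)
  then have cT: "continuous_on UNIV T" by (intro linear_continuous_on linear_conv_bounded_linear[THEN iffD1])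
  then have [measurable]: "T \<in> borel \<rightarrow>\<^sub>M borel" by (intro borel_measurable_continuous_onI)
  define \<mu> where "\<mu> = distr lborel borel T"
  have [measurable_cong, simp]: "sets \<mu> = sets borel" and [simp]: "space \<mu> = UNIV" by (simp_all add: \<mu>_def)
  have ball: "T -` ball 0 r = ball 0 r" for r
    using T by (auto simp: orthogonal_transformation_norm)
  have \<mu>ball: "emeasure \<mu> (ball 0 r) = emeasure lborel (ball (0::'a) r)" for r
    unfolding \<mu>_def by (subst emeasure_distr) (simp_all add: ball)
  interpret \<mu>: sigma_finite_measure \<mu>
  proof
    let ?R = "range (\<lambda>n::nat. ball (0::'a) (real n))"
    have "(\<Union>n::nat. ball (0::'a) (real n)) = UNIV"
      using reals_Archimedean2 by (auto simp: set_eq_iff)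
    then have "countable ?R \<and> ?R \<subseteq> sets \<mu> \<and> \<Union> ?R = space \<mu> \<and> (\<forall>a\<in>?R. emeasure \<mu> a \<noteq> \<infinity>)"
      using emeasure_lborel_ball_finite[of "0::'a"] by (simp add: image_subset_iff \<mu>ball less_top)
    then show "\<exists>A. countable A \<and> A \<subseteq> sets \<mu> \<and> \<Union> A = space \<mu> \<and> (\<forall>a\<in>A. emeasure \<mu> a \<noteq> \<infinity>)"
      by (rule exI)
  qed
  interpret pair_sigma_finite \<mu> "lborel :: 'a measure" ..
  have lborel_shift: "(\<integral>\<^sup>+y. f (c + y) \<partial>lborel) = (\<integral>\<^sup>+y. f y \<partial>lborel)"
    if [measurable]: "f \<in> borel_measurable borel" for f :: "'a \<Rightarrow> ennreal" and c
    by (subst (2) lborel_distr_plus[of c, symmetric]) (simp add: nn_integral_distr)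
  have \<mu>_shift: "(\<integral>\<^sup>+x. f (x + c) \<partial>\<mu>) = (\<integral>\<^sup>+x. f x \<partial>\<mu>)"
    if [measurable]: "f \<in> borel_measurable borel" for f :: "'a \<Rightarrow> ennreal" and c
  proof -
    obtain d where d: "c = T d"
      using orthogonal_transformation_surj[OF T] by (metis surjD)
    have "(\<integral>\<^sup>+x. f (x + c) \<partial>\<mu>) = (\<integral>\<^sup>+x. f (T (d + x)) \<partial>lborel)"
      unfolding \<mu>_def by (subst nn_integral_distr) (simp_all add: d linear_add[OF lin] add.commute)
    also have "\<dots> = (\<integral>\<^sup>+x. f x \<partial>\<mu>)"
      unfolding \<mu>_def by (subst lborel_shift) (simp_all add: nn_integral_distr)
    finally show ?thesis .
  qed
  fix A assume "A \<in> sets (distr lborel borel T)"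
  then have [measurable]: "A \<in> sets borel" by simp
  define B where "B = ball (0::'a) 1"
  have [measurable]: "B \<in> sets borel" by (simp add: B_def)
  have \<mu>B: "emeasure \<mu> B = emeasure lborel B" and symB: "- x \<in> B \<longleftrightarrow> x \<in> B" for x
    by (simp_all add: B_def \<mu>ball)
  have "emeasure \<mu> A * emeasure lborel B = (\<integral>\<^sup>+x. indicator A x * emeasure lborel B \<partial>\<mu>)"
    by (simp add: nn_integral_multc)
  also have "\<dots> = (\<integral>\<^sup>+x. (\<integral>\<^sup>+y. indicator A x * indicator B (- x + y) \<partial>lborel) \<partial>\<mu>)"
  proof (rule nn_integral_cong)
    fix x
    show "indicator A x * emeasure lborel B = (\<integral>\<^sup>+y. indicator A x * indicator B (- x + y) \<partial>lborel)"
    proof -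
      have "(\<integral>\<^sup>+y. indicator A x * indicator B (- x + y) \<partial>lborel) = indicator A x * (\<integral>\<^sup>+y. indicator B (- x + y) \<partial>lborel)"
        by (rule nn_integral_cmult) measurable
      also have "(\<integral>\<^sup>+y. indicator B (- x + y) \<partial>lborel) = emeasure lborel B"
        by (subst lborel_shift[of "indicator B" "- x"]) (auto intro!: borel_measurable_indicator)
      finally show ?thesis by simp
    qed
  qed
  also have "\<dots> = (\<integral>\<^sup>+y. (\<integral>\<^sup>+x. indicator A x * indicator B (- x + y) \<partial>\<mu>) \<partial>lborel)"
    by (rule Fubini'[symmetric]) measurable
  also have "\<dots> = (\<integral>\<^sup>+y. (\<integral>\<^sup>+x. indicator A (x + y) * indicator B (- x) \<partial>\<mu>) \<partial>lborel)"
  proof (rule nn_integral_cong)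
    fix y
    show "(\<integral>\<^sup>+x. indicator A x * indicator B (- x + y) \<partial>\<mu>) = (\<integral>\<^sup>+x. indicator A (x + y) * indicator B (- x) \<partial>\<mu>)"
      using \<mu>_shift[of "\<lambda>x. indicator A x * indicator B (- x + y)" y, symmetric] by simp
  qed
  also have "\<dots> = (\<integral>\<^sup>+x. (\<integral>\<^sup>+y. indicator A (x + y) * indicator B (- x) \<partial>lborel) \<partial>\<mu>)"
    by (rule Fubini') measurable
  also have "\<dots> = (\<integral>\<^sup>+x. emeasure lborel A * indicator B x \<partial>\<mu>)"
  proof (rule nn_integral_cong)
    fix x
    show "(\<integral>\<^sup>+y. indicator A (x + y) * indicator B (- x) \<partial>lborel) = emeasure lborel A * indicator B x"
    proof -
      have "(\<integral>\<^sup>+y. indicator A (x + y) * indicator B (- x) \<partial>lborel) = (\<integral>\<^sup>+y. indicator A (x + y) \<partial>lborel) * indicator B (- x)"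
        by (rule nn_integral_multc) measurable
      also have "(\<integral>\<^sup>+y. indicator A (x + y) \<partial>lborel) = emeasure lborel A"
        using lborel_shift[of "indicator A" x] by simp
      finally show ?thesis by (simp add: indicator_def symB)
    qed
  qed
  also have "\<dots> = emeasure lborel A * emeasure lborel B"
    by (simp add: nn_integral_cmult \<mu>B)
  finally have eq: "emeasure \<mu> A * emeasure lborel B = emeasure lborel A * emeasure lborel B" .
  have "emeasure lborel B \<noteq> 0"
    using open_not_negligible[of B] by (auto simp: B_def negligible_iff_null_sets null_sets_def)
  moreover have "emeasure lborel B \<noteq> top"
    using emeasure_lborel_ball_finite[of "0::'a" 1] by (simp add: B_def)
  moreover have "emeasure lborel B * emeasure \<mu> A = emeasure lborel B * emeasure lborel A"
    using eq by (simp only: mult.commute)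
  ultimately show "emeasure (distr lborel borel T) A = emeasure lborel A"
    unfolding ennreal_mult_cancel_left by (simp add: \<mu>_def)
qed simp

text \<open>
  Separate the hypograph of \<open>f\<close> from the vertical ray above \<open>(0, f 0)\<close>. The separating hyperplane is not
  vertical because \<open>0\<close> is interior.
\<close>

lemma concave_supporting_affine:
  fixes f :: "'a::euclidean_space \<Rightarrow> real"
  assumes f: "concave_on C f" and 0: "0 \<in> interior C"
  shows "\<exists>a. \<forall>x\<in>C. f x \<le> f 0 + a \<bullet> x"
proof -
  have C0: "0 \<in> C" using 0 interior_subset by blast
  define S where "S = {(x, t). x \<in> C \<and> t \<le> f x}"
  define U where "U = {(x, t). x = (0::'a) \<and> f 0 < t}"
  have f': "convex C" "\<And>x y u v. x \<in> C \<Longrightarrow> y \<in> C \<Longrightarrow> 0 \<le> u \<Longrightarrow> 0 \<le> v \<Longrightarrow> u + v = 1 \<Longrightarrow>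
      u * f x + v * f y \<le> f (u *\<^sub>R x + v *\<^sub>R y)"
    using f by (auto simp: concave_on_iff)
  have "convex S"
  proof (rule convexI)
    fix p q u v assume *: "p \<in> S" "q \<in> S" "0 \<le> u" "0 \<le> v" "u + v = (1::real)"
    have "u * snd p + v * snd q \<le> u * f (fst p) + v * f (fst q)"
      using * by (intro add_mono mult_left_mono) (auto simp: S_def)
    also have "\<dots> \<le> f (u *\<^sub>R fst p + v *\<^sub>R fst q)"
      using * by (intro f'(2)) (auto simp: S_def)
    finally show "u *\<^sub>R p + v *\<^sub>R q \<in> S"
      using * convexD[OF f'(1), of "fst p" "fst q" u v] by (auto simp: S_def split_beta)
  qed
  moreover have "U = {0} \<times> {f 0<..}" by (auto simp: U_def)
  then have "convex U" by (simp add: convex_Times)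
  moreover have "(0, f 0) \<in> S" using C0 by (simp add: S_def)
  moreover have "(0, f 0 + 1) \<in> U" by (simp add: U_def)
  moreover have "S \<inter> U = {}" by (auto simp: S_def U_def)
  ultimately obtain p b where p: "p \<noteq> 0" "\<And>z. z \<in> S \<Longrightarrow> p \<bullet> z \<le> b" "\<And>z. z \<in> U \<Longrightarrow> p \<bullet> z \<ge> b"
    using separating_hyperplane_sets[of S U] by blast
  define a q where "a = fst p" and "q = snd p"
  have pq: "p \<bullet> (x, t) = a \<bullet> x + q * t" for x t by (simp add: a_def q_def inner_prod_def)
  have S: "a \<bullet> x + q * t \<le> b" if "x \<in> C" "t \<le> f x" for x t
    using p(2)[of "(x, t)"] that by (simp add: S_def pq)
  have U: "b \<le> q * t" if "f 0 < t" for t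
    using p(3)[of "(0, t)"] that by (simp add: U_def pq)
  have b1: "q * f 0 \<le> b" using S[of 0 "f 0"] C0 by simp
  have "q \<ge> 0" using b1 U[of "f 0 + 1"] by (simp add: algebra_simps)
  have "q \<noteq> 0"
  proof
    assume q: "q = 0"
    then have "a \<noteq> 0" using p(1) by (auto simp: a_def q_def prod_eq_iff)
    obtain r where r: "0 < r" "ball 0 r \<subseteq> C" using 0 mem_interior by blast
    have "(r / (2 * norm a)) *\<^sub>R a \<in> C" using r \<open>a \<noteq> 0\<close> by (intro subsetD[OF r(2)]) simp
    then have "a \<bullet> ((r / (2 * norm a)) *\<^sub>R a) \<le> b" using S[OF _ order_refl] q by fastforce
    moreover have "b \<le> 0" using U[of "f 0 + 1"] q by simp
    moreover have "0 < a \<bullet> ((r / (2 * norm a)) *\<^sub>R a)" using r \<open>a \<noteq> 0\<close> by simp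
    ultimately show False by linarith
  qed
  with \<open>q \<ge> 0\<close> have q: "0 < q" by simp
  have "b \<le> q * f 0"
  proof (rule field_le_epsilon)
    fix d :: real assume "0 < d"
    then have "b \<le> q * (f 0 + d / q)" using q by (intro U) simp
    also have "\<dots> = q * f 0 + d" using q by (simp add: algebra_simps)
    finally show "b \<le> q * f 0 + d" .
  qed
  have "f x \<le> f 0 + ((- 1 / q) *\<^sub>R a) \<bullet> x" if "x \<in> C" for x
  proof -
    have "a \<bullet> x + q * f x \<le> q * f 0" using S[OF that order_refl] \<open>b \<le> q * f 0\<close> by linarith
    then show ?thesis using q by (simp add: field_simps)
  qed
  then show ?thesis by blast
qed

lemma concave_continuous_on_interior:
  fixes f :: "'a::euclidean_space \<Rightarrow> real"
  assumes "concave_on C f"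
  shows "continuous_on (interior C) f"
proof -
  have "convex C" using assms by (rule concave_on_imp_convex)
  then have "convex_on (interior C) (\<lambda>x. - f x)"
    using assms interior_subset[of C] convex_interior[of C] unfolding concave_on_def by (rule_tac convex_on_subset) auto
  then have "continuous_on (interior C) (\<lambda>x. - f x)" by (intro convex_on_continuous) auto
  then have "continuous_on (interior C) (\<lambda>x. - (- f x))" by (rule continuous_on_minus)
  then show ?thesis by simp
qed

lemma measurable_profile_interior:
  fixes f :: "'a::euclidean_space \<Rightarrow> real" and P :: "real \<Rightarrow> real"
  assumes f: "concave_on C f" and P: "continuous_on UNIV P"
  shows "(\<lambda>x. indicator (interior C) x * P (f x)) \<in> borel_measurable borel"
proof -
  have "continuous_on (interior C) (\<lambda>x. P (f x))"
    by (intro continuous_on_compose2[OF P] concave_continuous_on_interior[OF f] subset_UNIV)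
  then show ?thesis
    using borel_measurable_continuous_on_indicator[of "interior C" "\<lambda>x. P (f x)"] by simp
qed

text \<open>
  A concave function may be discontinuous at the boundary, but the boundary of a convex set is a null set.
\<close>

lemma set_integral_eq_interior:
  fixes f :: "'a::euclidean_space \<Rightarrow> real" and P :: "real \<Rightarrow> real"
  assumes f: "concave_on C f" and P: "continuous_on UNIV P"
    and eq: "\<And>x. x \<in> C \<Longrightarrow> \<phi> (f x) = P (f x)"
  shows "(LINT x:C|lebesgue. \<phi> (f x)) = (\<integral>x. indicator (interior C) x * P (f x) \<partial>lborel)"
proof -
  have cv: "convex C" using f by (rule concave_on_imp_convex)
  note m = measurable_profile_interior[OF f P]
  have "frontier C \<in> null_sets lebesgue"
    using negligible_convex_frontier[OF cv] by (simp add: negligible_iff_null_sets)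
  then have ae: "AE x in lebesgue. indicator (interior C) x * P (f x) = indicator C x *\<^sub>R \<phi> (f x)"
  proof (rule AE_I'[of "frontier C"])
    show "{x \<in> space lebesgue. indicator (interior C) x * P (f x) \<noteq> indicator C x *\<^sub>R \<phi> (f x)} \<subseteq> frontier C"
      using interior_subset[of C] closure_subset[of C] eq by (auto simp: frontier_def indicator_def)
  qed
  have "(\<lambda>x. indicator (interior C) x * P (f x)) \<in> borel_measurable lebesgue"
    using m by (intro measurable_completion) simp
  then have "(LINT x:C|lebesgue. \<phi> (f x)) = (\<integral>x. indicator (interior C) x * P (f x) \<partial>lebesgue)"
    unfolding set_lebesgue_integral_def
    using ae borel_measurable_AE[OF _ ae] by (intro integral_cong_AE) (auto elim: eventually_mono)
  also have "\<dots> = (\<integral>x. indicator (interior C) x * P (f x) \<partial>lborel)"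
    using m by (intro integral_completion) simp
  finally show ?thesis .
qed

lemma continuous_eq_on_open_AE:
  fixes f g :: "'a::euclidean_space \<Rightarrow> real"
  assumes "open U" "continuous_on U f" "continuous_on U g" "AE x in lborel. x \<in> U \<longrightarrow> f x = g x" "x \<in> U"
  shows "f x = g x"
proof (rule ccontr)
  assume ne: "f x \<noteq> g x"
  have "open (U \<inter> (\<lambda>x. f x - g x) -` (- {0}))"
    using assms by (intro continuous_open_preimage continuous_intros) auto
  moreover have "x \<in> U \<inter> (\<lambda>x. f x - g x) -` (- {0})" using ne assms by simp
  ultimately obtain y where "y \<in> U \<inter> (\<lambda>x. f x - g x) -` (- {0})" "y \<in> U \<longrightarrow> f y = g y"
    using AE_lborel_open_ex[OF assms(4)] by blast
  then show False by simp
qed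

section \<open>Averages of concave functions over a symmetric body\<close>

context symmetric_body
begin

lemma measure_lebesgue_eq: "measure lebesgue K = measure lborel K"
  using compact by (intro measure_completion) (simp add: borel_compact)

lemma measure_pos: "0 < measure lborel K"
proof -
  have "measure lborel K \<noteq> 0"
  proof
    assume "measure lborel K = 0"
    then have "AE s in lborel. volume s = 0"
      using measure_eq_integral_volume integral_nonneg_eq_0_iff_AE[OF volume_integrable] volume_nonneg by auto
    then obtain s where "s \<in> {0<..<height}" "volume s = 0"
      using AE_lborel_open_ex[of _ "{0<..<height}"] height_pos by fastforce
    then show False using weight_one_pos[of s] by simp
  qed
  then show ?thesis by (simp add: less_le)
qed

text \<open>
  At the lowest point of \<open>K\<close> the affine upper bound of \<open>f\<close> is nonnegative because \<open>f\<close> is, so the slope is at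
  most \<open>f 0 / height\<close> and the preceding comparison applies. In the case of equality \<open>P (f x)\<close> agrees almost everywhere
  with its upper bound, and continuity of \<open>f\<close> in the interior removes the exceptional points there.
\<close>

lemma concave_average:
  assumes f: "concave_on K f" "\<And>x. x \<in> K \<Longrightarrow> 0 \<le> f x" "0 < f 0"
    and a: "0 \<le> a" "\<And>x. x \<in> K \<Longrightarrow> f x \<le> f 0 + a * (x \<bullet> e)"
    and P: "continuous_on UNIV P" "\<And>u. 0 \<le> P u" "convex_on UNIV P"
      "\<And>s t. 0 \<le> s \<Longrightarrow> s \<le> t \<Longrightarrow> P s \<le> P t"
  defines "I \<equiv> (\<integral>x. indicator (interior K) x * P (f x) \<partial>lborel)"
    and "R \<equiv> (\<integral>t. indicator {-1..1} t * P (f 0 * (1 + t)) \<partial>lborel)"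
  shows "2 * I \<le> R * measure lborel K"
    and "2 * I = R * measure lborel K \<Longrightarrow> strictly_convex_on {0..} P \<Longrightarrow>
           (\<And>s t. 0 \<le> s \<Longrightarrow> s < t \<Longrightarrow> P s < P t) \<Longrightarrow>
           a * height = f 0 \<and> (\<forall>x\<in>interior K. f x = f 0 + a * (x \<bullet> e)) \<and>
           (\<exists>x0. x0 \<bullet> e = height \<and> K = closed_segment (- x0) x0 + K \<inter> {x. x \<bullet> e = 0})"
proof -
  have ah: "a * height \<le> f 0"
  proof -
    obtain p where p: "p \<in> K" "p \<bullet> e = height" using ex_top by blast
    then show ?thesis using a(2)[OF sym[OF p(1)]] f(2)[OF sym[OF p(1)]] by simp
  qed
  let ?g = "\<lambda>x. indicator K x * P (f 0 + a * (x \<bullet> e))"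
  let ?f = "\<lambda>x. indicator (interior K) x * P (f x)"
  have le: "?f x \<le> ?g x" for x
    using interior_subset[of K] P(4)[OF f(2) a(2)] P(2) by (auto simp: indicator_def)
  have cg: "continuous_on UNIV (\<lambda>s. P (f 0 + a * s))"
    by (intro continuous_on_compose2[OF P(1)] continuous_intros subset_UNIV)
  have intg: "integrable lborel ?g" using integral_profile(2)[OF cg] P(2) by simp
  have intf: "integrable lborel ?f"
    using le P(2) measurable_profile_interior[OF f(1) P(1)]
    by (intro Bochner_Integration.integrable_bound[OF intg]) auto
  have I_le: "I \<le> (\<integral>x. ?g x \<partial>lborel)" unfolding I_def by (intro integral_mono intf intg le)
  note avg = affine_profile_average[OF P(1,2,3) f(3) a(1) ah]
  show "2 * I \<le> R * measure lborel K" using I_le avg(1) unfolding R_def by linarith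
  assume eq: "2 * I = R * measure lborel K" and strict: "strictly_convex_on {0..} P"
    and smono: "\<And>s t. 0 \<le> s \<Longrightarrow> s < t \<Longrightarrow> P s < P t"
  have g_eq: "2 * (\<integral>x. ?g x \<partial>lborel) = R * measure lborel K"
    using I_le avg(1) eq unfolding R_def by linarith
  have 1: "a * height = f 0" and "\<exists>V. \<forall>s. \<bar>s\<bar> < height \<longrightarrow> volume s = V"
    using avg(2)[OF _ strict] g_eq unfolding R_def by auto
  then obtain V where "\<And>s. \<bar>s\<bar> < height \<Longrightarrow> volume s = V" by blast
  then have 2: "\<exists>x0. x0 \<bullet> e = height \<and> K = closed_segment (- x0) x0 + K \<inter> {x. x \<bullet> e = 0}"
    by (rule cylinder_decomposition)
  have "(\<integral>x. ?g x - ?f x \<partial>lborel) = 0"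
    using eq g_eq intf intg by (simp add: I_def Bochner_Integration.integral_diff)
  then have AE: "AE x in lborel. ?g x - ?f x = 0"
    using le intf intg by (subst (asm) integral_nonneg_eq_0_iff_AE) (auto intro!: Bochner_Integration.integrable_diff)
  have 3: "f x = f 0 + a * (x \<bullet> e)" if x: "x \<in> interior K" for x
  proof (rule continuous_eq_on_open_AE[OF open_interior concave_continuous_on_interior[OF f(1)] _ _ x])
    show "continuous_on (interior K) (\<lambda>x. f 0 + a * (x \<bullet> e))" by (intro continuous_intros)
    show "AE x in lborel. x \<in> interior K \<longrightarrow> f x = f 0 + a * (x \<bullet> e)"
      using AE
    proof eventually_elim
      case (elim x)
      show ?case
      proof
        assume "x \<in> interior K"
        then have x: "x \<in> interior K" "x \<in> K" using interior_subset by auto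
        then have "P (f x) = P (f 0 + a * (x \<bullet> e))" using elim by simp
        then show "f x = f 0 + a * (x \<bullet> e)"
          using smono[OF f(2)[OF x(2)], of "f 0 + a * (x \<bullet> e)"] a(2)[OF x(2)] by fastforce
      qed
    qed
  qed
  show "a * height = f 0 \<and> (\<forall>x\<in>interior K. f x = f 0 + a * (x \<bullet> e)) \<and>
      (\<exists>x0. x0 \<bullet> e = height \<and> K = closed_segment (- x0) x0 + K \<inter> {x. x \<bullet> e = 0})"
    using 1 2 3 by blast
qed

lemma cylinder_average:
  assumes K: "K = closed_segment (- x0) x0 + D" "D \<subseteq> {x. x \<bullet> e = 0}" "0 < x0 \<bullet> e"
    and f: "\<And>x. x \<in> interior K \<Longrightarrow> f x = c * (1 + x \<bullet> e / (x0 \<bullet> e))"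
    and P: "continuous_on UNIV P" "\<And>u. 0 \<le> P u"
  shows "2 * (\<integral>x. indicator (interior K) x * P (f x) \<partial>lborel)
       = (\<integral>t. indicator {-1..1} t * P (c * (1 + t)) \<partial>lborel) * measure lborel K"
proof -
  have h: "height = x0 \<bullet> e" and vol: "\<And>s. \<bar>s\<bar> \<le> height \<Longrightarrow> volume s = volume 0"
    using weight_cylinder[OF K] by blast+
  have fr: "frontier K \<in> null_sets lborel"
  proof -
    have "frontier K \<in> null_sets lebesgue"
      using negligible_convex_frontier[OF convex] negligible_iff_null_sets by blast
    then show ?thesis using null_sets_completion_iff[of "frontier K" lborel] by simp
  qed
  define G where "G x = P (c * (1 + x \<bullet> e / height))" for x
  have "continuous_on UNIV G"
    unfolding G_def using height_pos
    by (intro continuous_on_compose2[OF P(1)] continuous_intros subset_UNIV) auto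
  then have mG: "G \<in> borel_measurable borel" by (rule borel_measurable_continuous_onI)
  have "(\<integral>x. indicator (interior K) x * P (f x) \<partial>lborel) = (\<integral>x. indicator (interior K) x * G x \<partial>lborel)"
    using f by (intro Bochner_Integration.integral_cong) (simp_all add: indicator_def G_def h)
  also have "\<dots> = (\<integral>x. indicator K x * G x \<partial>lborel)"
  proof (rule integral_cong_AE)
    have "K \<in> sets borel" "interior K \<in> sets borel" using compact by (auto simp: borel_compact)
    then show "(\<lambda>x. indicator (interior K) x * G x) \<in> borel_measurable lborel"
      "(\<lambda>x. indicator K x * G x) \<in> borel_measurable lborel"
      using mG by simp_all
    show "AE x in lborel. indicator (interior K) x * G x = indicator K x * G x"
      using AE_not_in[OF fr]
    proof eventually_elim
      case (elim x)
      then have "x \<in> interior K \<longleftrightarrow> x \<in> K"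
        using interior_subset closure_subset unfolding frontier_def by blast
      then show ?case by (simp add: indicator_def)
    qed
  qed
  finally have "(\<integral>x. indicator (interior K) x * P (f x) \<partial>lborel) = (\<integral>x. indicator K x * P (c * (1 + x \<bullet> e / height)) \<partial>lborel)"
    by (simp add: G_def)
  then show ?thesis using affine_profile_cylinder[OF P vol] by simp
qed

end

section \<open>The theorem\<close>

lemma symmetric_body_axis:
  fixes K :: "(real ^ 'n) set"
  assumes "compact K" "convex K" "aff_dim K = int CARD('n)" "uminus ` K = K"
  shows "symmetric_body K (axis k 1)"
proof
  show "- x \<in> K" if "x \<in> K" for x using assms(4) that by blast
  have "K \<noteq> {}" using assms(3) by auto
  moreover have "interior K = rel_interior K" using assms(3) by (simp add: interior_rel_interior_gen)
  ultimately show "interior K \<noteq> {}" using assms(2) rel_interior_eq_empty by metis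
qed (use assms in \<open>auto simp: axis_in_Basis_iff\<close>)

lemma ex_rotation_to_axis:
  fixes a :: "real ^ 'n"
  shows "\<exists>T. is_rotation T \<and> T a = norm a *\<^sub>R axis k 1"
proof (cases "2 \<le> CARD('n)")
  case True
  moreover have "norm a = norm (norm a *\<^sub>R axis k (1::real) :: real ^ 'n)" by simp
  ultimately show ?thesis using rotation_exists unfolding is_rotation_def by metis
next
  case False
  moreover have "norm a = norm (norm a *\<^sub>R axis k (1::real) :: real ^ 'n)" by simp
  ultimately show ?thesis using orthogonal_transformation_exists unfolding is_rotation_def by metis
qed

lemma image_orthogonal_body:
  fixes T :: "real ^ 'n \<Rightarrow> real ^ 'n" and C :: "(real ^ 'n) set"
  assumes T: "orthogonal_transformation T"
    and C: "compact C" "convex C" "aff_dim C = int CARD('n)" "uminus ` C = C"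
  shows "compact (T ` C)" "convex (T ` C)" "aff_dim (T ` C) = int CARD('n)" "uminus ` (T ` C) = T ` C"
    "interior (T ` C) = T ` interior C"
proof -
  have lin: "linear T" and inj: "inj T" and bl: "bounded_linear T"
    using T by (auto simp: orthogonal_transformation_linear orthogonal_transformation_inj linear_conv_bounded_linear[symmetric])
  show "compact (T ` C)" using C bl
    by (intro compact_continuous_image linear_continuous_on)
  show "convex (T ` C)" using C lin by (intro convex_linear_image)
  show ad: "aff_dim (T ` C) = int CARD('n)"
    using aff_dim_injective_linear_image[OF lin inj, of C] C by simp
  show "uminus ` (T ` C) = T ` C"
  proof -
    have "uminus ` (T ` C) = T ` (uminus ` C)"
      by (simp add: image_image linear_neg[OF lin])
    then show ?thesis using C by simp
  qed
  show "interior (T ` C) = T ` interior C"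
    using rel_interior_injective_linear_image[OF bl inj, of C] ad C by (simp add: interior_rel_interior_gen)
qed

lemma concave_on_compose_inv:
  fixes T :: "'a::euclidean_space \<Rightarrow> 'a"
  assumes T: "orthogonal_transformation T" and f: "concave_on C f"
  shows "concave_on (T ` C) (f \<circ> inv T)"
proof -
  have lin: "linear T" and inj: "inj T"
    using T by (auto simp: orthogonal_transformation_linear orthogonal_transformation_inj)
  have f': "convex C" "\<And>x y u v. x \<in> C \<Longrightarrow> y \<in> C \<Longrightarrow> 0 \<le> u \<Longrightarrow> 0 \<le> v \<Longrightarrow> u + v = 1 \<Longrightarrow>
      u * f x + v * f y \<le> f (u *\<^sub>R x + v *\<^sub>R y)"
    using f by (auto simp: concave_on_iff)
  show ?thesis
    unfolding concave_on_iff
  proof (intro conjI ballI allI impI)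
    show "convex (T ` C)" using f'(1) lin by (intro convex_linear_image)
    fix x y u v assume *: "x \<in> T ` C" "y \<in> T ` C" "0 \<le> u" "0 \<le> v" "u + v = (1::real)"
    then obtain x' y' where xy: "x = T x'" "y = T y'" "x' \<in> C" "y' \<in> C" by blast
    have "u *\<^sub>R x + v *\<^sub>R y = T (u *\<^sub>R x' + v *\<^sub>R y')"
      by (simp add: xy linear_add[OF lin] linear_scale[OF lin])
    then show "u * (f \<circ> inv T) x + v * (f \<circ> inv T) y \<le> (f \<circ> inv T) (u *\<^sub>R x + v *\<^sub>R y)"
      using f'(2)[OF xy(3,4) *(3-5)] inj by (simp add: xy)
  qed
qed

lemma integral_orthogonal_image:
  fixes T :: "'a::euclidean_space \<Rightarrow> 'a" and G :: "'a \<Rightarrow> real"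
  assumes T: "orthogonal_transformation T" and G: "(\<lambda>x. indicator (T ` S) x * G x) \<in> borel_measurable borel"
  shows "(\<integral>x. indicator (T ` S) x * G x \<partial>lborel) = (\<integral>x. indicator S x * G (T x) \<partial>lborel)"
proof -
  have cT: "continuous_on UNIV T"
    using T by (intro linear_continuous_on) (simp add: linear_conv_bounded_linear[symmetric] orthogonal_transformation_linear)
  then have mT: "T \<in> borel \<rightarrow>\<^sub>M borel" by (intro borel_measurable_continuous_onI)
  have inj: "inj T" using T by (rule orthogonal_transformation_inj)
  have "(\<integral>x. indicator (T ` S) x * G x \<partial>lborel) = (\<integral>x. indicator (T ` S) x * G x \<partial>distr lborel borel T)"
    by (simp add: distr_lborel_orthogonal[OF T])
  also have "\<dots> = (\<integral>x. indicator (T ` S) (T x) * G (T x) \<partial>lborel)"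
    using mT G by (subst integral_distr) auto
  also have "\<dots> = (\<integral>x. indicator S x * G (T x) \<partial>lborel)"
    by (simp add: indicator_def inj_image_mem_iff[OF inj])
  finally show ?thesis .
qed

text \<open>
  Upper semicontinuity rules out that \<open>f\<close> jumps down at a boundary point.
\<close>

lemma upper_semicontinuous_ge_limit:
  fixes f G :: "real ^ 'n \<Rightarrow> real"
  assumes usc: "upper_semicontinuous_fun_on C f" and C: "convex C" "interior C \<noteq> {}"
    and G: "continuous_on UNIV G" "\<And>y. y \<in> interior C \<Longrightarrow> f y = G y" and x: "x \<in> C"
  shows "G x \<le> f x"
proof (rule ccontr)
  assume neg: "\<not> G x \<le> f x"
  then have xi: "x \<notin> interior C" using G(2) by auto
  define d where "d = (G x - f x) / 2"
  have d: "0 < d" using neg by (simp add: d_def)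
  have "eventually (\<lambda>y. f y < f x + d) (at x within C)"
    using usc x d by (simp add: upper_semicontinuous_fun_on_def)
  then have 1: "eventually (\<lambda>y. f y < f x + d) (at x within interior C)"
    using filter_leD[OF at_le[OF interior_subset]] by blast
  have "isCont G x" using G(1) by (simp add: continuous_on_eq_continuous_at)
  then have "(G \<longlongrightarrow> G x) (at x within interior C)"
    by (simp add: isCont_def tendsto_within_subset[of _ _ _ UNIV])
  then have 2: "eventually (\<lambda>y. G x - d < G y) (at x within interior C)"
    using d by (intro order_tendstoD) auto
  have 3: "eventually (\<lambda>y. y \<in> interior C) (at x within interior C)"
    by (simp add: eventually_at_filter)
  have "eventually (\<lambda>y. False) (at x within interior C)"
    using 1 2 3
  proof eventually_elim
    case (elim y)
    then show ?case using G(2)[of y] by (simp add: d_def field_simps)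
  qed
  moreover have "x \<in> closure (interior C)"
    using convex_closure_interior[OF C] x closure_subset by blast
  then have "at x within interior C \<noteq> bot"
    using xi by (simp add: trivial_limit_within islimpt_in_closure)
  ultimately show False by (simp add: trivial_limit_def)
qed

text \<open>
  The set \<open>D\<close> is the central slice; it has full dimension in its hyperplane because \<open>0\<close> is interior to \<open>K\<close>.
\<close>

lemma cylinder_with_affine_functionI:
  fixes K :: "(real ^ 'n) set"
  assumes "symmetric_body K (axis k 1)" and K: "uminus ` K = K"
    and x0: "x0 $ k > 0" "K = closed_segment (- x0) x0 + K \<inter> {x. x $ k = 0}"
    and f: "\<forall>x\<in>S. f x = c * (1 + x $ k / x0 $ k)"
  shows "cylinder_with_affine_function k S K f"
proof -
  interpret symmetric_body K "axis k 1" by fact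
  let ?D = "K \<inter> {x. x $ k = 0}"
  have D: "?D = {x. axis k 1 \<bullet> x = 0} \<inter> K" by (auto simp: inner_axis')
  have "aff_dim ?D = aff_dim {x. axis k (1::real) \<bullet> x = 0}"
    unfolding D
  proof (intro aff_dim_convex_Int_nonempty_interior convex_hyperplane)
    have "0 \<in> {x. axis k 1 \<bullet> x = 0} \<inter> interior K" using zero_interior by simp
    then show "{x. axis k 1 \<bullet> x = 0} \<inter> interior K \<noteq> {}" by blast
  qed
  also have "\<dots> = int CARD('n) - 1" by (subst aff_dim_hyperplane) (auto simp: axis_eq_0_iff)
  finally have "aff_dim ?D = int CARD('n) - 1" .
  moreover have "compact ?D" "convex ?D"
    unfolding D using compact convex closed_hyperplane[of "axis k 1" 0] convex_hyperplane[of "axis k 1" 0]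
    by (auto intro!: closed_Int_compact convex_Int)
  moreover have "uminus ` ?D = ?D" using sym by (force simp: image_iff)
  moreover have "affine_function (\<lambda>x. c * (1 + x $ k / x0 $ k))"
    unfolding affine_function_def
  proof (intro exI conjI)
    show "linear (\<lambda>x. c / x0 $ k * x $ k)" by (rule linearI) (simp_all add: algebra_simps add_divide_distrib)
    show "(\<lambda>x. c * (1 + x $ k / x0 $ k)) = (\<lambda>x. c / x0 $ k * x $ k + c)"
      by (auto simp: algebra_simps)
  qed
  moreover have "\<forall>x. x $ k = 0 \<longrightarrow> c * (1 + (- x0 + x) $ k / x0 $ k) = 0"
    using x0(1) by simp
  ultimately show ?thesis
    unfolding cylinder_with_affine_function_def using x0 f
    by (intro exI[of _ ?D] exI[of _ x0] exI[of _ "\<lambda>x. c * (1 + x $ k / x0 $ k)"]) auto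
qed

lemma cylinder_with_affine_function_mono:
  assumes "cylinder_with_affine_function k S K f" "S' \<subseteq> S"
  shows "cylinder_with_affine_function k S' K f"
proof -
  obtain D x0 g where D: "D \<subseteq> {x. x $ k = 0}" "compact D" "convex D"
      "aff_dim D = int CARD('a) - 1" "uminus ` D = D" "x0 $ k > 0" "K = closed_segment (- x0) x0 + D"
      "affine_function g" "\<forall>x. x $ k = 0 \<longrightarrow> g (- x0 + x) = 0"
    and g: "\<forall>x\<in>S. f x = g x"
    using assms(1) unfolding cylinder_with_affine_function_def by (elim exE conjE) (rule that; assumption)
  have "\<forall>x\<in>S'. f x = g x" using g assms(2) by blast
  with D show ?thesis
    unfolding cylinder_with_affine_function_def
    by (intro exI[of _ D] exI[of _ x0] exI[of _ g] conjI)
qed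

text \<open>
  An affine function that is constant on one hyperplane \<open>x $ k = const\<close> depends on \<open>x $ k\<close> only.
\<close>

lemma cylinder_with_affine_functionE:
  assumes "cylinder_with_affine_function k S K f"
  obtains D x0 c where "D \<subseteq> {x. x $ k = 0}" "x0 $ k > 0" "K = closed_segment (- x0) x0 + D"
    "\<And>x. x \<in> S \<Longrightarrow> f x = c * (1 + x $ k / x0 $ k)"
proof -
  obtain D x0 g where D: "D \<subseteq> {x. x $ k = 0}" "x0 $ k > 0" "K = closed_segment (- x0) x0 + D"
    and g: "affine_function g" "\<forall>x\<in>S. f x = g x" "\<forall>x. x $ k = 0 \<longrightarrow> g (- x0 + x) = 0"
    using assms unfolding cylinder_with_affine_function_def by blast
  obtain l c where l: "linear l" "g = (\<lambda>x. l x + c)" using g(1) unfolding affine_function_def by blast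
  have lx0: "l x0 = c" using g(3)[rule_format, of 0] by (simp add: l linear_neg[OF l(1)])
  have "g x = c * (1 + x $ k / x0 $ k)" for x
  proof -
    define z where "z = x - (x $ k / x0 $ k) *\<^sub>R x0"
    have "z $ k = 0" using D by (simp add: z_def)
    then have "g (- x0 + z) = 0" using g(3) by blast
    then have "l z = 0" using lx0 by (simp add: l linear_diff[OF l(1)])
    moreover have "x = (x $ k / x0 $ k) *\<^sub>R x0 + z" by (simp add: z_def)
    ultimately have "l x = (x $ k / x0 $ k) * c"
      using lx0 by (metis add.right_neutral l(1) linear_add linear_scale real_scaleR_def)
    then show ?thesis by (simp add: l algebra_simps)
  qed
  then show ?thesis using that[OF D] g(2) by metis
qed

theorem theorem0p2:
  fixes C :: "(real ^ 'n) set" and f :: "real ^ 'n \<Rightarrow> real" and \<phi> :: "real \<Rightarrow> real" and k :: 'n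
  assumes "compact C" and "convex C" and "aff_dim C = int CARD('n)" and "uminus ` C = C"
    and "concave_on C f" and "\<forall>x\<in>C. 0 \<le> f x"
    and "convex_on {0..} \<phi>" and "\<forall>t\<ge>0. 0 \<le> \<phi> t" and "\<exists>t\<ge>0. \<phi> t \<noteq> 0" and "\<phi> 0 = 0"
  shows "1 / measure lebesgue C * (LINT x:C|lebesgue. \<phi> (f x))
           \<le> 1 / 2 * (LINT t:{-1..1}|lebesgue. \<phi> (f 0 * (1 + t)))
    \<and> (strictly_convex_on {0..} \<phi> \<longrightarrow> upper_semicontinuous_fun_on C f \<longrightarrow> (\<exists>x\<in>C. f x \<noteq> 0) \<longrightarrow>
         (1 / measure lebesgue C * (LINT x:C|lebesgue. \<phi> (f x))
            = 1 / 2 * (LINT t:{-1..1}|lebesgue. \<phi> (f 0 * (1 + t)))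
          \<longleftrightarrow> (\<exists>T. is_rotation T \<and>
                cylinder_with_affine_function k (T ` C) (T ` C) (f \<circ> inv T))))
    \<and> (strictly_convex_on {0..} \<phi> \<longrightarrow>
         (1 / measure lebesgue C * (LINT x:C|lebesgue. \<phi> (f x))
            = 1 / 2 * (LINT t:{-1..1}|lebesgue. \<phi> (f 0 * (1 + t)))
          \<longleftrightarrow> (\<forall>x\<in>C. f x = 0) \<or>
              (\<exists>T. is_rotation T \<and>
                cylinder_with_affine_function k (interior (T ` C)) (T ` C) (f \<circ> inv T))))"
proof -
  note C = assms(1-4) and f = assms(5) and f0 = assms(6)[rule_format]
    and \<phi> = assms(7) assms(8)[rule_format] assms(10)
  interpret C: symmetric_body C "axis k 1" by (rule symmetric_body_axis[OF C])
  define P where "P u = \<phi> (max 0 u)" for u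
  have P_eq: "P u = \<phi> u" if "0 \<le> u" for u using that by (simp add: P_def max_def)
  have Pconv: "convex_on UNIV P" unfolding P_def using convex_on_max_0[OF \<phi>] .
  have Pcont: "continuous_on UNIV P" using Pconv by (intro convex_on_continuous) auto
  have P0: "0 \<le> P u" for u using \<phi>(2) by (simp add: P_def)
  have Pmono: "P s \<le> P t" if "0 \<le> s" "s \<le> t" for s t
    using convex_nonneg_mono[OF \<phi> that] that by (simp add: P_eq)
  have Psmono: "P s < P t" if "strictly_convex_on {0..} \<phi>" "0 \<le> s" "s < t" for s t
    using strictly_convex_strict_mono[OF that(1) \<phi>(2,3) that(2,3)] that by (simp add: P_eq)
  have Pstrict: "strictly_convex_on {0..} P" if "strictly_convex_on {0..} \<phi>"
    using that unfolding strictly_convex_on_def by (simp add: P_eq)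
  define L where "L = (LINT x:C|lebesgue. \<phi> (f x))"
  define R where "R = (LINT t:{-1..1}|lebesgue. \<phi> (f 0 * (1 + t)))"
  define I where "I = (\<integral>x. indicator (interior C) x * P (f x) \<partial>lborel)"
  have L_eq: "L = I" unfolding L_def I_def using f0
    by (intro set_integral_eq_interior[OF f Pcont]) (simp add: P_eq)
  have f00: "0 \<le> f 0" using f0 C.zero_mem by simp
  have R_eq: "R = (\<integral>t. indicator {-1..1} t * P (f 0 * (1 + t)) \<partial>lborel)"
  proof -
    have "R = (\<integral>t. indicator {-1..1} t * P (f 0 * (1 + t)) \<partial>lebesgue)"
      unfolding R_def set_lebesgue_integral_def
      using f00 by (intro Bochner_Integration.integral_cong) (auto simp: indicator_def P_eq)
    also have "\<dots> = (\<integral>t. indicator {-1..1} t * P (f 0 * (1 + t)) \<partial>lborel)"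
    proof (rule integral_completion)
      have "continuous_on UNIV (\<lambda>t. P (f 0 * (1 + t)))"
        by (intro continuous_on_compose2[OF Pcont] continuous_intros subset_UNIV)
      then show "(\<lambda>t. indicator {-1..1} t * P (f 0 * (1 + t))) \<in> lborel \<rightarrow>\<^sub>M borel"
        by (intro borel_measurable_times) (auto intro: borel_measurable_continuous_onI)
    qed
    finally show ?thesis .
  qed
  define V where "V = measure lborel C"
  have V: "measure lebesgue C = V" "0 < V" using C.measure_lebesgue_eq C.measure_pos by (simp_all add: V_def)
  have ineq_iff: "1 / measure lebesgue C * L \<le> 1 / 2 * R \<longleftrightarrow> 2 * I \<le> R * V"
    and eq_iff: "1 / measure lebesgue C * L = 1 / 2 * R \<longleftrightarrow> 2 * I = R * V"
    using V by (simp_all add: L_eq field_simps)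
  \<comment> \<open>Rotating the body together with the function changes neither side of the inequality.\<close>
  have body: "symmetric_body (T ` C) (axis k 1)" if "orthogonal_transformation T" for T :: "real ^ 'n \<Rightarrow> real ^ 'n"
    using image_orthogonal_body[OF that C] by (intro symmetric_body_axis)
  have trans: "(\<integral>x. indicator (interior (T ` C)) x * P ((f \<circ> inv T) x) \<partial>lborel) = I"
      "measure lborel (T ` C) = V" "(f \<circ> inv T) 0 = f 0"
    if T: "orthogonal_transformation T" for T :: "real ^ 'n \<Rightarrow> real ^ 'n"
  proof -
    have int: "interior (T ` C) = T ` interior C" by (rule image_orthogonal_body(5)[OF T C])
    have inj: "inj T" using T by (rule orthogonal_transformation_inj)
    show "(\<integral>x. indicator (interior (T ` C)) x * P ((f \<circ> inv T) x) \<partial>lborel) = I"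
      unfolding I_def
      using integral_orthogonal_image[OF T, of "interior C" "\<lambda>x. P ((f \<circ> inv T) x)"]
        measurable_profile_interior[OF concave_on_compose_inv[OF T f] Pcont] inj
      by (simp add: int)
    have "compact (T ` C)" by (rule image_orthogonal_body(1)[OF T C])
    then have "T ` C \<in> sets borel" by (rule borel_compact)
    then have "(\<lambda>x. indicator (T ` C) x * 1 :: real) \<in> borel_measurable borel" by simp
    then show "measure lborel (T ` C) = V"
      unfolding V_def using integral_orthogonal_image[OF T, of C "\<lambda>x. 1"] by simp
    have "T 0 = 0" using orthogonal_transformation_linear[OF T] by (rule linear_0)
    then have "inv T 0 = 0" using inv_f_f[OF inj, of 0] by simp
    then show "(f \<circ> inv T) 0 = f 0" by simp
  qed
  have conv: "2 * I = R * V"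
    if T: "is_rotation T" and cyl: "cylinder_with_affine_function k (interior (T ` C)) (T ` C) (f \<circ> inv T)" for T :: "real ^ 'n \<Rightarrow> real ^ 'n"
  proof -
    have oT: "orthogonal_transformation T" using T by (simp add: is_rotation_def)
    interpret K: symmetric_body "T ` C" "axis k 1" by (rule body[OF oT])
    obtain D x0 c where D: "D \<subseteq> {x. x $ k = 0}" "x0 $ k > 0" "T ` C = closed_segment (- x0) x0 + D"
      "\<And>x. x \<in> interior (T ` C) \<Longrightarrow> (f \<circ> inv T) x = c * (1 + x $ k / x0 $ k)"
      using cylinder_with_affine_functionE[OF cyl] by metis
    have "c = f 0" using D(4)[OF K.zero_interior] trans(3)[OF oT] by simp
    then show ?thesis
      using K.cylinder_average[of x0 D "f \<circ> inv T" c P] D Pcont P0 trans(1,2)[OF oT]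
      by (simp add: inner_axis R_eq)
  qed
  show ?thesis
  proof (cases "f 0 = 0")
    case True
    have fz: "f x = 0" if "x \<in> C" for x
    proof -
      have "(1/2) * f x + (1/2) * f (- x) \<le> f ((1/2) *\<^sub>R x + (1/2) *\<^sub>R (- x))"
        using f that C.sym[OF that] unfolding concave_on_iff by (metis field_sum_of_halves half_gt_zero less_eq_real_def zero_less_one)
      then show ?thesis using f0[OF that] f0[OF C.sym[OF that]] True by simp
    qed
    have "I = 0"
      unfolding I_def using fz interior_subset[of C] P_eq[of 0] \<phi>(3)
      by (intro Bochner_Integration.integral_eq_zero_AE AE_I2) (auto simp: indicator_def)
    moreover have "R = 0" using P_eq[of 0] \<phi>(3) True by (simp add: R_eq)
    ultimately show ?thesis
      using ineq_iff eq_iff fz unfolding L_def R_def by auto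
  next
    case False
    then have fpos: "0 < f 0" using f00 by simp
    obtain a where a: "\<And>x. x \<in> C \<Longrightarrow> f x \<le> f 0 + a \<bullet> x"
      using concave_supporting_affine[OF f C.zero_interior] by blast
    obtain T where T: "is_rotation T" "T a = norm a *\<^sub>R axis k 1" using ex_rotation_to_axis by blast
    have oT: "orthogonal_transformation T" using T by (simp add: is_rotation_def)
    have injT: "inj T" using oT by (rule orthogonal_transformation_inj)
    interpret K: symmetric_body "T ` C" "axis k 1" by (rule body[OF oT])
    define g where "g = f \<circ> inv T"
    have gT: "g (T x) = f x" for x using injT by (simp add: g_def)
    have g0: "g 0 = f 0" using trans(3)[OF oT] by (simp add: g_def)
    have gc: "concave_on (T ` C) g" unfolding g_def by (rule concave_on_compose_inv[OF oT f])
    have gn: "0 \<le> g x" if "x \<in> T ` C" for x using that f0 gT by auto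
    have gle: "g x \<le> g 0 + norm a * (x \<bullet> axis k 1)" if x: "x \<in> T ` C" for x
    proof -
      obtain y where y: "x = T y" "y \<in> C" using x by blast
      have "a \<bullet> y = T a \<bullet> T y" using oT by (simp add: orthogonal_transformation_def)
      then show ?thesis using a[OF y(2)] by (simp add: y gT g0 T(2) inner_commute)
    qed
    have g0pos: "0 < g 0" using fpos g0 by simp
    have I_eq: "(\<integral>x. indicator (interior (T ` C)) x * P (g x) \<partial>lborel) = I"
      and V_eq: "measure lborel (T ` C) = V"
      and R_g: "(\<integral>t. indicator {-1..1} t * P (g 0 * (1 + t)) \<partial>lborel) = R"
      using trans[OF oT] by (simp_all add: g_def R_eq)
    have "2 * (\<integral>x. indicator (interior (T ` C)) x * P (g x) \<partial>lborel)
        \<le> (\<integral>t. indicator {-1..1} t * P (g 0 * (1 + t)) \<partial>lborel) * measure lborel (T ` C)"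
      by (rule K.concave_average(1)[OF gc _ g0pos norm_ge_zero _ Pcont P0 Pconv])
         (rule gn gle Pmono; assumption)+
    then have I_le: "2 * I \<le> R * V" unfolding I_eq V_eq R_g .
    have eqD: "cylinder_with_affine_function k (interior (T ` C)) (T ` C) g"
        "upper_semicontinuous_fun_on C f \<Longrightarrow> cylinder_with_affine_function k (T ` C) (T ` C) g"
      if strict: "strictly_convex_on {0..} \<phi>" and eq: "2 * I = R * V"
    proof -
      have "norm a * K.height = g 0 \<and> (\<forall>x\<in>interior (T ` C). g x = g 0 + norm a * (x \<bullet> axis k 1)) \<and>
        (\<exists>x0. x0 \<bullet> axis k 1 = K.height \<and> T ` C = closed_segment (- x0) x0 + T ` C \<inter> {x. x \<bullet> axis k 1 = 0})"
      proof (rule K.concave_average(2)[OF gc _ g0pos norm_ge_zero _ Pcont P0 Pconv])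
        show "2 * (\<integral>x. indicator (interior (T ` C)) x * P (g x) \<partial>lborel)
            = (\<integral>t. indicator {-1..1} t * P (g 0 * (1 + t)) \<partial>lborel) * measure lborel (T ` C)"
          unfolding I_eq V_eq R_g by (rule eq)
      qed (rule gn gle Pmono Pstrict[OF strict] Psmono[OF strict]; assumption?)+
      then have *: "norm a * K.height = g 0" "\<forall>x\<in>interior (T ` C). g x = g 0 + norm a * (x \<bullet> axis k 1)"
        "\<exists>x0. x0 \<bullet> axis k 1 = K.height \<and> T ` C = closed_segment (- x0) x0 + T ` C \<inter> {x. x \<bullet> axis k 1 = 0}"
        by blast+
      have ax: "x \<bullet> axis k 1 = x $ k" for x :: "real ^ 'n" by (simp add: inner_axis)
      obtain x0 where x0: "x0 $ k = K.height" "T ` C = closed_segment (- x0) x0 + T ` C \<inter> {x. x $ k = 0}"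
        using *(3) unfolding ax by blast
      have x0k: "x0 $ k > 0" using x0(1) K.height_pos by simp
      have form: "g 0 + norm a * (x \<bullet> axis k 1) = f 0 * (1 + x $ k / x0 $ k)" for x
      proof -
        have "norm a = f 0 / x0 $ k" using *(1) x0(1) x0k g0 by (simp add: field_simps)
        then show ?thesis by (simp add: g0 inner_axis algebra_simps)
      qed
      have sym: "uminus ` (T ` C) = T ` C" by (rule image_orthogonal_body(4)[OF oT C])
      have gi: "\<forall>x\<in>interior (T ` C). g x = f 0 * (1 + x $ k / x0 $ k)" using *(2) form by simp
      then show "cylinder_with_affine_function k (interior (T ` C)) (T ` C) g"
        by (rule cylinder_with_affine_functionI[OF body[OF oT] sym x0k x0(2)])
      assume usc: "upper_semicontinuous_fun_on C f"
      have "\<forall>x\<in>T ` C. g x = f 0 * (1 + x $ k / x0 $ k)"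
      proof (intro ballI antisym)
        fix x assume x: "x \<in> T ` C"
        show "g x \<le> f 0 * (1 + x $ k / x0 $ k)" using gle[OF x] form by simp
        obtain y where y: "x = T y" "y \<in> C" using x by blast
        have cT: "continuous_on UNIV T"
          using oT by (intro linear_continuous_on) (simp add: linear_conv_bounded_linear[symmetric] orthogonal_transformation_linear)
        have "f 0 * (1 + T y $ k / x0 $ k) \<le> f y"
        proof (rule upper_semicontinuous_ge_limit[OF usc C(2) C.int _ _ y(2)])
          show "continuous_on UNIV (\<lambda>y. f 0 * (1 + T y $ k / x0 $ k))"
            using x0k by (intro continuous_intros cT) auto
          show "f z = f 0 * (1 + T z $ k / x0 $ k)" if "z \<in> interior C" for z
            using gi that gT[of z] by (simp add: image_orthogonal_body(5)[OF oT C])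
        qed
        then show "f 0 * (1 + x $ k / x0 $ k) \<le> g x" by (simp add: y gT)
      qed
      then show "cylinder_with_affine_function k (T ` C) (T ` C) g"
        by (rule cylinder_with_affine_functionI[OF body[OF oT] sym x0k x0(2)])
    qed
    have weaken: "cylinder_with_affine_function k (interior (T ` C)) (T ` C) (f \<circ> inv T)"
      if "cylinder_with_affine_function k (T ` C) (T ` C) (f \<circ> inv T)" for T :: "real ^ 'n \<Rightarrow> real ^ 'n"
      using that interior_subset by (rule cylinder_with_affine_function_mono)
    have fne: "\<not> (\<forall>x\<in>C. f x = 0)" using False C.zero_mem by blast
    show ?thesis
      unfolding L_def[symmetric] R_def[symmetric] ineq_iff eq_iff
      using I_le eqD conv weaken T(1) fne unfolding g_def by blast
  qed
qed

end
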